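(* Both parts of the Letac–Massam conjecture are false. The conjecture asserts that for every non-homogeneous decomposable graph $\mathcal{G}$, $$\text{(I)}\ \bigcup_{\mathcal{P}\in\mathrm{Ord}(\mathcal{G})}A_{\mathcal{P}}=\mathcal{A},\qquad \text{(II)}\ \bigcup_{\mathcal{P}\in\mathrm{Ord}(\mathcal{G})}B_{\mathcal{P}}=\mathcal{B}.$$ More precisely: (1) If $\mathcal{G}$ is the (non-homogeneous, decomposable) graph on $\{1,\ldots,6\}$ with maximal cliques $\{2,3,5\},\{2,4,5\},\{4,6\},\{1,2\}$, then $\bigcup_{\mathcal{P}\in\mathrm{Ord}(\mathcal{G})}B_{\mathcal{P}}\neq\mathcal{B}$. (2) If $\mathcal{G}$ is the (non-homogeneous, decomposable) graph on $\{1,\ldots,8\}$ with maximal cliques $\{4,7,8\},\{3,7,8\},\{6,8\},\{2,5,6\},\{1,5,6\}$, then $\bigcup_{\mathcal{P}\in\mathrm{Ord}(\mathcal{G})}A_{\mathcal{P}}\neq\mathcal{A}$.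
   Context: Let $\mathcal{G}=(V,E)$ be a decomposable (chordal) undirected graph, $V=\{1,\ldots,p\}$; all loops are regarded as belonging to $E$. "Clique" means maximal complete vertex set. $\mathcal{G}$ is homogeneous if for any two adjacent $i,j$, $\mathrm{ne}(j)\cup\{j\}\subseteq\mathrm{ne}(i)\cup\{i\}$ or $\mathrm{ne}(i)\cup\{i\}\subseteq\mathrm{ne}(j)\cup\{j\}$, where $\mathrm{ne}$ denotes the set of neighbors. A perfect order of the cliques is an enumeration $\mathcal{P}=(C_1,\ldots,C_r)$ of all cliques such that, with $H_j=C_1\cup\cdots\cup C_j$, each separator $S_j=H_{j-1}\cap C_j$ ($2\le j\le r$) is contained in some $C_i$ with $i<j$. $\mathrm{Ord}(\mathcal{G})$ is the set of perfect orders. The collection of separators with multiplicities does not depend on the perfect order; $\nu(S)$ is the multiplicity of $S$, and $J(\mathcal{P},S)=\{j:S_j=S\}$. Put $c_j=|C_j|$, $s_j=|S_j|$. Cones. $\mathrm{P}_{\mathcal{G}}$ is the set of positive definite $p\times p$ matrices $\Omega$ with $\Omega_{ij}=0$ whenever $\{i,j\}\notin E$; $\mathrm{PD}_{\mathcal{G}}=\{\Omega^{-1}:\Omega\in\mathrm{P}_{\mathcal{G}}\}$. $\mathrm{Q}_{\mathcal{G}}$ is the set of symmetric incomplete matrices $\Gamma=(\Gamma_{ij})_{\{i,j\}\in E}$ (entries specified only on edges and the diagonal) with $\Gamma_C$ positive definite for each clique $C$. Each $\Sigma^E\in\mathrm{Q}_{\mathcal{G}}$ has a unique completion $\Sigma\in\mathrm{PD}_{\mathcal{G}}$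 agreeing with it on $E$; for $\Omega\in\mathrm{P}_{\mathcal{G}}$, $\Omega^{-E}:=(\Omega^{-1})^E$. Multi-shape parameters $(\alpha,\beta)\in\mathbb{R}^r\times\mathbb{R}^{r-1}$ are indexed by cliques and by separators, so that $\alpha_j=\alpha(C_j)$ and $\beta_j=\beta(S_j)$ for each perfect order (in the two graphs of the claim all separators are distinct). The Markov ratio is $$H_{\mathcal{G}}(\alpha,\beta,\Sigma^E)=\frac{\prod_{i=1}^r\det(\Sigma_{C_i})^{\alpha_i}}{\prod_{i=2}^r\det(\Sigma_{S_i})^{\beta_i}}.$$ With $c=(c_1,\ldots,c_r)$, $s=(s_2,\ldots,s_r)$ and Lebesgue measures $d\Sigma^E$ on $\mathrm{Q}_{\mathcal{G}}$, $d\Omega$ on $\mathrm{P}_{\mathcal{G}}$, let $\mu_{\mathcal{G}}(d\Sigma^E)=H_{\mathcal{G}}(-\tfrac{c+1}{2},-\tfrac{s+1}{2},\Sigma^E)\,d\Sigma^E$ and $\nu_{\mathcal{G}}(d\Omega)=H_{\mathcal{G}}(\tfrac{c+1}{2},\tfrac{s+1}{2},\Omega^{-E})\,d\Omega$ ($c+1$, $s+1$ componentwise). For $U^E\in\mathrm{Q}_{\mathcal{G}}$ with completion $U\in\mathrm{PD}_{\mathcal{G}}$ define $$\omega_{\mathrm{Q}_{\mathcal{G}}}(\alpha,\beta,U^E,d\Sigma^E)=e^{-\mathrm{tr}(\Sigma U^{-1})}H_{\mathcal{G}}(\alpha,\beta,\Sigma^E)\mu_{\mathcal{G}}(d\Sigma^E),\qquad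 \omega_{\mathrm{P}_{\mathcal{G}}}(\alpha,\beta,U^E,d\Omega)=e^{-\mathrm{tr}(\Omega U)}H_{\mathcal{G}}(\alpha,\beta,\Omega^{-E})\nu_{\mathcal{G}}(d\Omega).$$ $\mathcal{A}$ is the set of $(\alpha,\beta)$ such that $\int_{\mathrm{Q}_{\mathcal{G}}}\omega_{\mathrm{Q}_{\mathcal{G}}}(\alpha,\beta,U^E,d\Sigma^E)<\infty$ for every $U^E\in\mathrm{Q}_{\mathcal{G}}$ and $\int_{\mathrm{Q}_{\mathcal{G}}}\omega_{\mathrm{Q}_{\mathcal{G}}}(\alpha,\beta,U^E,d\Sigma^E)/H_{\mathcal{G}}(\alpha,\beta,U^E)$ does not depend on $U^E$. $\mathcal{B}$ is the set of $(\alpha,\beta)$ such that $\int_{\mathrm{P}_{\mathcal{G}}}\omega_{\mathrm{P}_{\mathcal{G}}}(\alpha,\beta,U^E,d\Omega)<\infty$ for every $U^E\in\mathrm{Q}_{\mathcal{G}}$ and $\int_{\mathrm{P}_{\mathcal{G}}}\omega_{\mathrm{P}_{\mathcal{G}}}(\alpha,\beta,U^E,d\Omega)/H_{\mathcal{G}}(\alpha,\beta,U^E)$ does not depend on $U^E$. $A_{\mathcal{P}}$ is the set of $(\alpha,\beta)$ such that: (a) $\sum_{j\in J(\mathcal{P},S)}\alpha_j-\nu(S)\beta(S)=0$ for each separator $S\ne S_2$; (b) $\alpha_j-(c_j-1)/2>0$ for $j=1,\ldots,r$; (c) $\alpha_1+\delta_2>(s_2-1)/2$, where $\delta_2=\sum_{j\in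 J(\mathcal{P},S_2)}\alpha_j-\nu(S_2)\beta_2$. $B_{\mathcal{P}}$ is the set of $(\alpha,\beta)$ such that: (a) $\sum_{j\in J(\mathcal{P},S)}(\alpha_j+(c_j-s_j)/2)-\nu(S)\beta(S)=0$ for each separator $S\ne S_2$; (b) $-\alpha_j-(c_j-s_j-1)/2>0$ for $j=2,\ldots,r$ and $-\alpha_1-(c_1-s_2-1)/2>0$; (c) $-\alpha_1-(c_1-s_2)/2-\eta_2>(s_2-1)/2$, where $\eta_2=\sum_{j\in J(\mathcal{P},S_2)}(\alpha_j+(c_j-s_2)/2)-\nu(S_2)\beta_2$. *)

theory Defs
  imports "HOL-Analysis.Lebesgue_Measure" "Jordan_Normal_Form.Determinant"
    "Jordan_Normal_Form.Gauss_Jordan_Elimination"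
begin

section \<open>Graphs\<close>

text \<open>A graph is a pair consisting of the number \<open>p\<close> of vertices and the set of edges; an edge
  is a set \<open>{i, j}\<close>, and the loop at \<open>i\<close> is the singleton \<open>{i} = {i, i}\<close>.\<close>

type_synonym ugraph = "nat \<times> nat set set"

definition verts :: "ugraph \<Rightarrow> nat set" where
  "verts G = {1..fst G}"

definition edges :: "ugraph \<Rightarrow> nat set set" where
  "edges G = snd G"

definition is_graph :: "ugraph \<Rightarrow> bool" where
  "is_graph G \<longleftrightarrow> edges G \<subseteq> {{i, j} | i j. i \<in> verts G \<and> j \<in> verts G} \<and>
     (\<forall>i\<in>verts G. {i} \<in> edges G)"

definition ne :: "ugraph \<Rightarrow> nat \<Rightarrow> nat set" where
  "ne G i = {j \<in> verts G. j \<noteq> i \<and> {i, j} \<in> edges G}"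

definition is_cycle :: "ugraph \<Rightarrow> nat list \<Rightarrow> bool" where
  "is_cycle G vs \<longleftrightarrow> distinct vs \<and> set vs \<subseteq> verts G \<and>
     (\<forall>k<length vs. {vs ! k, vs ! ((k + 1) mod length vs)} \<in> edges G)"

definition has_chord :: "ugraph \<Rightarrow> nat list \<Rightarrow> bool" where
  "has_chord G vs \<longleftrightarrow> (\<exists>k<length vs. \<exists>l<length vs. k \<noteq> l \<and>
     l \<noteq> (k + 1) mod length vs \<and> k \<noteq> (l + 1) mod length vs \<and> {vs ! k, vs ! l} \<in> edges G)"

definition decomposable :: "ugraph \<Rightarrow> bool" where
  "decomposable G \<longleftrightarrow> (\<forall>vs. is_cycle G vs \<and> 4 \<le> length vs \<longrightarrow> has_chord G vs)"

definition homogeneous :: "ugraph \<Rightarrow> bool" where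
  "homogeneous G \<longleftrightarrow> (\<forall>i\<in>verts G. \<forall>j\<in>ne G i.
     ne G j \<union> {j} \<subseteq> ne G i \<union> {i} \<or> ne G i \<union> {i} \<subseteq> ne G j \<union> {j})"

definition complete_set :: "ugraph \<Rightarrow> nat set \<Rightarrow> bool" where
  "complete_set G C \<longleftrightarrow> C \<subseteq> verts G \<and> (\<forall>i\<in>C. \<forall>j\<in>C. {i, j} \<in> edges G)"

definition cliques :: "ugraph \<Rightarrow> nat set set" where
  "cliques G = {C. complete_set G C \<and> (\<forall>D. complete_set G D \<and> C \<subseteq> D \<longrightarrow> D = C)}"

definition graph_of :: "nat \<Rightarrow> nat set set \<Rightarrow> ugraph" where
  "graph_of p \<C> = (p, {{i, j} | i j. \<exists>C\<in>\<C>. i \<in> C \<and> j \<in> C})"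


section \<open>Perfect orders and separators\<close>

text \<open>An enumeration of the cliques is a list; positions are counted from 1.\<close>

definition clq :: "nat set list \<Rightarrow> nat \<Rightarrow> nat set" where
  "clq P j = P ! (j - 1)"

definition hist :: "nat set list \<Rightarrow> nat \<Rightarrow> nat set" where
  "hist P j = (\<Union>i\<in>{1..j}. clq P i)"

definition sep :: "nat set list \<Rightarrow> nat \<Rightarrow> nat set" where
  "sep P j = hist P (j - 1) \<inter> clq P j"

definition Ord :: "ugraph \<Rightarrow> nat set list set" where
  "Ord G = {P. distinct P \<and> set P = cliques G \<and>
     (\<forall>j\<in>{2..length P}. \<exists>i\<in>{1..<j}. sep P j \<subseteq> clq P i)}"

definition Jset :: "nat set list \<Rightarrow> nat set \<Rightarrow> nat set" where
  "Jset P S = {j \<in> {2..length P}. sep P j = S}"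

definition separators :: "ugraph \<Rightarrow> nat set set" where
  "separators G = (\<Union>P\<in>Ord G. sep P ` {2..length P})"

text \<open>The multiplicity of a separator is the common value of \<open>card (Jset P S)\<close> over all perfect
  orders \<open>P\<close>; it exists by \<open>sep_mult_eq\<close> below.\<close>

definition sep_mult :: "ugraph \<Rightarrow> nat set \<Rightarrow> nat" where
  "sep_mult G S = (THE n. \<forall>P\<in>Ord G. card (Jset P S) = n)"

lemma finite_verts [simp]: "finite (verts G)"
  by (simp add: verts_def)

lemma cliques_subset: "C \<in> cliques G \<Longrightarrow> C \<subseteq> verts G"
  by (simp add: cliques_def complete_set_def)

lemma clq_in: "P \<in> Ord G \<Longrightarrow> j \<in> {1..length P} \<Longrightarrow> clq P j \<in> cliques G"
  using nth_mem[of "j - 1" P] by (simp add: Ord_def clq_def) linarith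

lemma bij_clq:
  assumes "P \<in> Ord G"
  shows "bij_betw (clq P) {1..length P} (cliques G)"
proof -
  have "bij_betw (\<lambda>j. j - 1) {1..length P} {..<length P}"
    by (rule bij_betwI[where g = Suc]) auto
  moreover have "bij_betw ((!) P) {..<length P} (cliques G)"
    using assms by (intro bij_betw_nth) (auto simp: Ord_def)
  ultimately show ?thesis
    using bij_betw_trans[of "\<lambda>j. j - 1" _ _ "(!) P"] by (simp add: clq_def[abs_def] comp_def)
qed

lemma sep_subset_clq: "sep P j \<subseteq> clq P j"
  by (simp add: sep_def)

lemma count_separators_above:
  assumes P: "P \<in> Ord G" and X: "D \<in> cliques G" "X \<subseteq> D"
  shows "Suc (card {j \<in> {2..length P}. X \<subseteq> sep P j}) = card {C \<in> cliques G. X \<subseteq> C}"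
proof -
  let ?r = "length P"
  let ?A = "{j \<in> {1..?r}. X \<subseteq> clq P j}"
  have surj: "clq P ` {1..?r} = cliques G"
    using bij_clq[OF P] by (rule bij_betw_imp_surj_on)
  have "bij_betw (clq P) ?A {C \<in> cliques G. X \<subseteq> C}"
  proof (rule bij_betw_subset[OF bij_clq[OF P]])
    show "clq P ` ?A = {C \<in> cliques G. X \<subseteq> C}"
      unfolding surj[symmetric] by blast
  qed blast
  then have A: "card ?A = card {C \<in> cliques G. X \<subseteq> C}"
    by (rule bij_betw_same_card)
  have ne: "?A \<noteq> {}"
    using X unfolding surj[symmetric] by blast
  define m where "m = Min ?A"
  have m: "m \<in> ?A" "\<And>j. j \<in> ?A \<Longrightarrow> m \<le> j"
    using ne Min_in[of ?A] Min_le[of ?A] unfolding m_def by simp_all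
  have "{j \<in> {2..?r}. X \<subseteq> sep P j} = ?A - {m}"
  proof (intro equalityI subsetI)
    fix j assume j: "j \<in> {j \<in> {2..?r}. X \<subseteq> sep P j}"
    have "\<exists>i\<in>{1..<j}. sep P j \<subseteq> clq P i"
      using P j unfolding Ord_def by blast
    then obtain i where i: "i \<in> {1..<j}" "sep P j \<subseteq> clq P i" ..
    have "X \<subseteq> clq P i" using i(2) j by blast
    then have "i \<in> ?A" using i(1) j by simp
    then have "m < j" using m(2)[of i] i(1) by simp
    moreover have "X \<subseteq> clq P j" using j sep_subset_clq[of P j] by blast
    ultimately show "j \<in> ?A - {m}" using j by simp
  next
    fix j assume j: "j \<in> ?A - {m}"
    then have mj: "m < j" using m(2)[of j] by force
    then have "m \<in> {1..j - 1}" using m(1) by simp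
    then have "clq P m \<subseteq> hist P (j - 1)"
      unfolding hist_def by blast
    then have "X \<subseteq> sep P j"
      using j m(1) unfolding sep_def by blast
    then show "j \<in> {j \<in> {2..?r}. X \<subseteq> sep P j}"
      using j mj m(1) by simp
  qed
  moreover have "card (?A - {m}) = card ?A - 1"
    using m(1) by (simp add: card_Diff_singleton)
  moreover have "card ?A > 0"
    using ne by (simp add: card_gt_0_iff)
  ultimately show ?thesis using A by simp
qed

lemma sep_subset_verts:
  assumes "P \<in> Ord G" "j \<in> {2..length P}"
  shows "sep P j \<subseteq> verts G"
  using clq_in[OF assms(1), of j] assms(2) cliques_subset[of "clq P j" G] sep_subset_clq[of P j]
  by auto

lemma card_Jset_Ord:
  assumes P: "P \<in> Ord G" and Q: "Q \<in> Ord G"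
  shows "card (Jset P S) = card (Jset Q S)"
proof (induction "card (verts G) - card S" arbitrary: S rule: less_induct)
  case less
  show ?case
  proof (cases "\<exists>D\<in>cliques G. S \<subseteq> D")
    case False
    have "Jset R S = {}" if R: "R \<in> Ord G" for R
    proof -
      have "sep R j \<noteq> S" if "j \<in> {2..length R}" for j
      proof -
        have "clq R j \<in> cliques G"
          using that by (intro clq_in[OF R]) simp
        then show ?thesis
          using False sep_subset_clq[of R j] by blast
      qed
      then show ?thesis by (simp add: Jset_def)
    qed
    then show ?thesis using P Q by simp
  next
    case True
    then obtain D where D: "D \<in> cliques G" "S \<subseteq> D" by auto
    let ?T = "{T. S \<subset> T \<and> T \<subseteq> verts G}"
    have finT: "finite ?T" by (rule finite_subset[of _ "Pow (verts G)"]) auto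
    have split: "card (Jset R S) + (\<Sum>T\<in>?T. card (Jset R T)) =
        card {j \<in> {2..length R}. S \<subseteq> sep R j}" if R: "R \<in> Ord G" for R
    proof -
      have "{j \<in> {2..length R}. S \<subseteq> sep R j} = Jset R S \<union> (\<Union>T\<in>?T. Jset R T)"
        using sep_subset_verts[OF R] by (auto simp: Jset_def)
      also have "card \<dots> = card (Jset R S) + card (\<Union>T\<in>?T. Jset R T)"
        using finT by (intro card_Un_disjoint) (auto simp: Jset_def)
      also have "card (\<Union>T\<in>?T. Jset R T) = (\<Sum>T\<in>?T. card (Jset R T))"
        using finT by (intro card_UN_disjoint) (auto simp: Jset_def)
      finally show ?thesis by simp
    qed
    have "card (Jset P T) = card (Jset Q T)" if "T \<in> ?T" for T
    proof (rule less.hyps)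
      have "card S < card T" "card T \<le> card (verts G)"
        using that finite_subset[of T "verts G"]
        by (simp_all add: psubset_card_mono card_mono)
      then show "card (verts G) - card T < card (verts G) - card S" by simp
    qed
    then have "(\<Sum>T\<in>?T. card (Jset P T)) = (\<Sum>T\<in>?T. card (Jset Q T))"
      by (intro sum.cong) auto
    then show ?thesis
      using split[OF P] split[OF Q] count_separators_above[OF P D] count_separators_above[OF Q D]
      by simp
  qed
qed

lemma sep_mult_eq:
  assumes "P \<in> Ord G"
  shows "sep_mult G S = card (Jset P S)"
proof -
  have "\<forall>Q\<in>Ord G. card (Jset Q S) = card (Jset P S)"
    using card_Jset_Ord assms by blast
  then show ?thesis
    unfolding sep_mult_def using assms by (intro the_equality) (assumption, metis)
qed

lemma separators_eq:
  assumes "P \<in> Ord G"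
  shows "separators G = sep P ` {2..length P}"
proof -
  have eq: "sep Q ` {2..length Q} = {S. card (Jset Q S) \<noteq> 0}" for Q
    by (auto simp: Jset_def card_eq_0_iff)
  have "sep Q ` {2..length Q} = sep P ` {2..length P}" if "Q \<in> Ord G" for Q
    unfolding eq card_Jset_Ord[OF that assms] ..
  then show ?thesis
    unfolding separators_def using assms by blast
qed


section \<open>Matrices and cones\<close>

text \<open>An incomplete symmetric matrix is a function on the set of edges, extensional in the sense
  of \<open>PiE\<close>, with \<open>\<Gamma> {i, j}\<close> being the entry at \<open>(i, j)\<close> and at \<open>(j, i)\<close>. Complete matrices are
  matrices of dimension \<open>p\<close>; since row and column indices of \<open>mat\<close> start at 0, the entry for the
  vertices \<open>i\<close>, \<open>j\<close> is \<open>A $$ (i - 1, j - 1)\<close>.\<close>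

definition block :: "nat set \<Rightarrow> (nat set \<Rightarrow> real) \<Rightarrow> real mat" where
  "block C \<Gamma> = mat (card C) (card C)
     (\<lambda>(i, j). \<Gamma> {sorted_list_of_set C ! i, sorted_list_of_set C ! j})"

definition pos_def :: "nat \<Rightarrow> real mat \<Rightarrow> bool" where
  "pos_def n A \<longleftrightarrow> A \<in> carrier_mat n n \<and> transpose_mat A = A \<and>
     (\<forall>v\<in>carrier_vec n. v \<noteq> 0\<^sub>v n \<longrightarrow> scalar_prod v (A *\<^sub>v v) > 0)"

definition mat_tr :: "real mat \<Rightarrow> real" where
  "mat_tr A = (\<Sum>i<dim_row A. A $$ (i, i))"

definition inv_mat :: "real mat \<Rightarrow> real mat" where
  "inv_mat A = the (mat_inverse A)"

definition P_cone :: "ugraph \<Rightarrow> real mat set" where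
  "P_cone G = {\<Omega>. pos_def (fst G) \<Omega> \<and>
     (\<forall>i\<in>verts G. \<forall>j\<in>verts G. {i, j} \<notin> edges G \<longrightarrow> \<Omega> $$ (i - 1, j - 1) = 0)}"

definition PD_cone :: "ugraph \<Rightarrow> real mat set" where
  "PD_cone G = inv_mat ` P_cone G"

definition Q_cone :: "ugraph \<Rightarrow> (nat set \<Rightarrow> real) set" where
  "Q_cone G = {\<Gamma> \<in> edges G \<rightarrow>\<^sub>E UNIV. \<forall>C\<in>cliques G. pos_def (card C) (block C \<Gamma>)}"

text \<open>For symmetric \<open>A\<close> the choice of the minimum as the row index is immaterial.\<close>

definition edge_part :: "ugraph \<Rightarrow> real mat \<Rightarrow> nat set \<Rightarrow> real" where
  "edge_part G A = (\<lambda>e\<in>edges G. A $$ (Min e - 1, Max e - 1))"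

definition completion :: "ugraph \<Rightarrow> (nat set \<Rightarrow> real) \<Rightarrow> real mat" where
  "completion G \<Gamma> = (THE \<Sigma>. \<Sigma> \<in> PD_cone G \<and> edge_part G \<Sigma> = \<Gamma>)"

text \<open>Elements of the space containing \<open>P_cone\<close> are determined by their entries on the edges.\<close>

definition zero_fill :: "ugraph \<Rightarrow> (nat set \<Rightarrow> real) \<Rightarrow> real mat" where
  "zero_fill G x = block (verts G) (\<lambda>e. if e \<in> edges G then x e else 0)"


section \<open>Markov ratio and measures\<close>

type_synonym shape = "(nat set \<Rightarrow> real) \<times> (nat set \<Rightarrow> real)"

definition shapes :: "ugraph \<Rightarrow> shape set" where
  "shapes G = (cliques G \<rightarrow>\<^sub>E UNIV) \<times> (separators G \<rightarrow>\<^sub>E UNIV)"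

definition markov_ratio ::
    "ugraph \<Rightarrow> (nat set \<Rightarrow> real) \<Rightarrow> (nat set \<Rightarrow> real) \<Rightarrow> (nat set \<Rightarrow> real) \<Rightarrow> real" where
  "markov_ratio G \<alpha> \<beta> \<Gamma> =
     (\<Prod>C\<in>cliques G. det (block C \<Gamma>) powr \<alpha> C) /
     (\<Prod>S\<in>separators G. (det (block S \<Gamma>) powr \<beta> S) ^ sep_mult G S)"

lemma markov_ratio_Ord:
  assumes P: "P \<in> Ord G"
  shows "markov_ratio G \<alpha> \<beta> \<Gamma> =
     (\<Prod>i=1..length P. det (block (clq P i) \<Gamma>) powr \<alpha> (clq P i)) /
     (\<Prod>i=2..length P. det (block (sep P i) \<Gamma>) powr \<beta> (sep P i))"
proof -
  have "(\<Prod>i=1..length P. det (block (clq P i) \<Gamma>) powr \<alpha> (clq P i)) =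
      (\<Prod>C\<in>cliques G. det (block C \<Gamma>) powr \<alpha> C)"
    using bij_clq[OF P] by (rule prod.reindex_bij_betw)
  moreover have "(\<Prod>i=2..length P. det (block (sep P i) \<Gamma>) powr \<beta> (sep P i)) =
      (\<Prod>S\<in>separators G. \<Prod>i\<in>Jset P S. det (block (sep P i) \<Gamma>) powr \<beta> (sep P i))"
    unfolding separators_eq[OF P] Jset_def by (rule prod.image_gen) simp
  moreover have "\<dots> = (\<Prod>S\<in>separators G. (det (block S \<Gamma>) powr \<beta> S) ^ sep_mult G S)"
    unfolding sep_mult_eq[OF P] by (intro prod.cong) (auto simp: Jset_def)
  ultimately show ?thesis
    by (simp add: markov_ratio_def)
qed

text \<open>Lebesgue measure on symmetric matrices supported on the edges, each off-diagonal entry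
  counting as one coordinate.\<close>

definition edge_lebesgue :: "ugraph \<Rightarrow> (nat set \<Rightarrow> real) measure" where
  "edge_lebesgue G = PiM (edges G) (\<lambda>_. lborel)"

definition mu :: "ugraph \<Rightarrow> (nat set \<Rightarrow> real) measure" where
  "mu G = density (restrict_space (edge_lebesgue G) (Q_cone G))
     (\<lambda>\<Gamma>. ennreal (markov_ratio G
        (\<lambda>C. - (real (card C) + 1) / 2) (\<lambda>S. - (real (card S) + 1) / 2) \<Gamma>))"

text \<open>The measure on \<open>P_cone G\<close> is expressed in the coordinates \<open>x\<close> of \<open>zero_fill G x\<close>.\<close>

definition nu :: "ugraph \<Rightarrow> (nat set \<Rightarrow> real) measure" where
  "nu G = density (restrict_space (edge_lebesgue G) {x. zero_fill G x \<in> P_cone G})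
     (\<lambda>x. ennreal (markov_ratio G
        (\<lambda>C. (real (card C) + 1) / 2) (\<lambda>S. (real (card S) + 1) / 2)
        (edge_part G (inv_mat (zero_fill G x)))))"

definition integral_Q ::
    "ugraph \<Rightarrow> (nat set \<Rightarrow> real) \<Rightarrow> (nat set \<Rightarrow> real) \<Rightarrow> (nat set \<Rightarrow> real) \<Rightarrow> ennreal" where
  "integral_Q G \<alpha> \<beta> U = (\<integral>\<^sup>+ \<Gamma>. ennreal
     (exp (- mat_tr (completion G \<Gamma> * inv_mat (completion G U))) * markov_ratio G \<alpha> \<beta> \<Gamma>) \<partial>mu G)"

definition integral_P ::
    "ugraph \<Rightarrow> (nat set \<Rightarrow> real) \<Rightarrow> (nat set \<Rightarrow> real) \<Rightarrow> (nat set \<Rightarrow> real) \<Rightarrow> ennreal" where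
  "integral_P G \<alpha> \<beta> U = (\<integral>\<^sup>+ x. ennreal
     (exp (- mat_tr (zero_fill G x * completion G U)) *
      markov_ratio G \<alpha> \<beta> (edge_part G (inv_mat (zero_fill G x)))) \<partial>nu G)"

definition \<A> :: "ugraph \<Rightarrow> shape set" where
  "\<A> G = {(\<alpha>, \<beta>) \<in> shapes G.
     (\<forall>U\<in>Q_cone G. integral_Q G \<alpha> \<beta> U < \<infinity>) \<and>
     (\<forall>U\<in>Q_cone G. \<forall>U'\<in>Q_cone G.
        integral_Q G \<alpha> \<beta> U / ennreal (markov_ratio G \<alpha> \<beta> U) =
        integral_Q G \<alpha> \<beta> U' / ennreal (markov_ratio G \<alpha> \<beta> U'))}"

definition \<B> :: "ugraph \<Rightarrow> shape set" where
  "\<B> G = {(\<alpha>, \<beta>) \<in> shapes G.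
     (\<forall>U\<in>Q_cone G. integral_P G \<alpha> \<beta> U < \<infinity>) \<and>
     (\<forall>U\<in>Q_cone G. \<forall>U'\<in>Q_cone G.
        integral_P G \<alpha> \<beta> U / ennreal (markov_ratio G \<alpha> \<beta> U) =
        integral_P G \<alpha> \<beta> U' / ennreal (markov_ratio G \<alpha> \<beta> U'))}"


section \<open>The sets attached to a perfect order\<close>

definition A_ord :: "ugraph \<Rightarrow> nat set list \<Rightarrow> shape set" where
  "A_ord G P = {(\<alpha>, \<beta>) \<in> shapes G.
     let r = length P;
         c = (\<lambda>j. real (card (clq P j)));
         s = (\<lambda>j. real (card (sep P j)));
         \<delta>2 = (\<Sum>j\<in>Jset P (sep P 2). \<alpha> (clq P j)) - real (sep_mult G (sep P 2)) * \<beta> (sep P 2)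
     in (\<forall>S\<in>separators G. S \<noteq> sep P 2 \<longrightarrow>
           (\<Sum>j\<in>Jset P S. \<alpha> (clq P j)) - real (sep_mult G S) * \<beta> S = 0) \<and>
        (\<forall>j\<in>{1..r}. \<alpha> (clq P j) - (c j - 1) / 2 > 0) \<and>
        \<alpha> (clq P 1) + \<delta>2 > (s 2 - 1) / 2}"

definition B_ord :: "ugraph \<Rightarrow> nat set list \<Rightarrow> shape set" where
  "B_ord G P = {(\<alpha>, \<beta>) \<in> shapes G.
     let r = length P;
         c = (\<lambda>j. real (card (clq P j)));
         s = (\<lambda>j. real (card (sep P j)));
         \<eta>2 = (\<Sum>j\<in>Jset P (sep P 2). \<alpha> (clq P j) + (c j - s 2) / 2)
                - real (sep_mult G (sep P 2)) * \<beta> (sep P 2)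
     in (\<forall>S\<in>separators G. S \<noteq> sep P 2 \<longrightarrow>
           (\<Sum>j\<in>Jset P S. \<alpha> (clq P j) + (c j - s j) / 2) - real (sep_mult G S) * \<beta> S = 0) \<and>
        (\<forall>j\<in>{2..r}. - \<alpha> (clq P j) - (c j - s j - 1) / 2 > 0) \<and>
        - \<alpha> (clq P 1) - (c 1 - s 2 - 1) / 2 > 0 \<and>
        - \<alpha> (clq P 1) - (c 1 - s 2) / 2 - \<eta>2 > (s 2 - 1) / 2}"

end

theory Submission
  imports "HOL-Probability.Distributions" Defs
begin

text \<open>
  An elimination scheme of a chordal graph removes, one after the other, vertices \<open>v\<close> whose remaining
  neighbours \<open>N\<close> form a complete set. Reversed, it is a perfect DAG with parents \<open>N\<close> of \<open>v\<close>. In the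
  coordinates given by the residual variances \<open>\<sigma>\<^sub>v = \<Sigma>\<^sub>v\<^sub>v - \<Sigma>\<^sub>v\<^sub>N \<Sigma>\<^sub>N\<^sup>-\<^sup>1 \<Sigma>\<^sub>N\<^sub>v\<close> (here \<open>pvar v N\<close>) and the
  regression coefficients of \<open>v\<close> on \<open>N\<close>, both Wishart integrals split into one Gamma and one Gaussian
  integral for each vertex. For exponents \<open>a\<^sub>v > |N| / 2\<close>,
  the integral of \<open>exp (- tr (\<Sigma> U\<^sup>-\<^sup>1)) \<Prod>\<^sub>v \<sigma>\<^sub>v powr a\<^sub>v\<close> against \<open>\<mu>\<^sub>G\<close> is a constant times the same product at
  \<open>U\<close>: the powers of \<open>det \<Sigma>\<^sub>N\<close> coming from the Gaussian integral and from \<open>\<mu>\<^sub>G\<close> cancel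
  (\<open>nn_integral_weight_Q\<close>). On the cone of precision matrices the same holds for \<open>a\<^sub>v < 0\<close> and the product of
  \<open>\<sigma>\<^sub>v powr a\<^sub>v * det \<Sigma>\<^sub>N powr (- 1 / 2)\<close> (\<open>nn_integral_weight_P\<close>). So a shape belongs to \<open>\<A> G\<close> or \<open>\<B> G\<close>
  whenever its Markov ratio is such a product (\<open>mem_A\<close>, \<open>mem_B\<close>).

  As \<open>\<sigma>\<^sub>v\<close> is the quotient of the determinants of \<open>insert v N\<close> and \<open>N\<close>, the product is a Markov ratio
  if the exponents of the determinants of sets that are neither cliques nor separators vanish. In both
  graphs there is a scheme in which every family \<open>insert v N\<close> is a clique or a separator, because two
  separators are nested and the DAG starts with the smaller one: \<open>{2} \<subset> {2, 5}\<close> and \<open>{8} \<subset> {7, 8}\<close>.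
  Then all exponents \<open>a\<^sub>v\<close> are free, and the shapes obtained satisfy a single linear relation, whereas the
  shapes of a perfect order satisfy one relation for each separator other than \<open>S\<^sub>2\<close>. At most one of the
  two nested separators is \<open>S\<^sub>2\<close>; so a shape of the product form that violates the relations of both of
  them, for every clique that could occur in the relation, lies in no \<open>A_ord G P\<close> or \<open>B_ord G P\<close>
  (\<open>not_mem_A_ord\<close>, \<open>not_mem_B_ord\<close>).
\<close>

section \<open>Elimination schemes\<close>

text \<open>A scheme lists the vertices in an order of elimination, each with the neighbours that are
  eliminated after it. Read backwards it is a perfect DAG in which \<open>N\<close> lists the parents of \<open>v\<close>, and
  the head of the list is a leaf. A symmetric matrix is a function \<open>g\<close> of type \<open>nat set \<Rightarrow> real\<close>
  with \<open>g {i, j}\<close> as its entry at \<open>(i, j)\<close>.\<close>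

type_synonym scheme = "(nat \<times> nat list) list"

abbreviation dverts :: "scheme \<Rightarrow> nat set" where
  "dverts L \<equiv> fst ` set L"

definition star :: "nat \<Rightarrow> nat list \<Rightarrow> nat set set" where
  "star v N = insert {v} ((\<lambda>u. {v, u}) ` set N)"

fun dedges :: "scheme \<Rightarrow> nat set set" where
  "dedges [] = {}"
| "dedges ((v, N) # L) = star v N \<union> dedges L"

text \<open>At most two parents suffice for graphs of treewidth two, and then regression coefficients and
  Gaussian integrals have closed forms.\<close>

fun scheme :: "scheme \<Rightarrow> bool" where
  "scheme [] = True"
| "scheme ((v, N) # L) = (scheme L \<and> v \<notin> dverts L \<and> distinct N \<and> length N \<le> 2 \<and>
     set N \<subseteq> dverts L \<and> (\<forall>u\<in>set N. \<forall>w\<in>set N. {u, w} \<in> dedges L))"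

definition complete_in :: "nat set set \<Rightarrow> nat set \<Rightarrow> bool" where
  "complete_in E X \<longleftrightarrow> (\<forall>i\<in>X. \<forall>j\<in>X. {i, j} \<in> E)"

lemma finite_dedges [simp]: "finite (dedges L)"
  by (induction L rule: dedges.induct) (auto simp: star_def)

lemma dedges_subset: "scheme L \<Longrightarrow> e \<in> dedges L \<Longrightarrow> e \<subseteq> dverts L \<and> e \<noteq> {}"
  by (induction L rule: dedges.induct) (auto simp: star_def)

lemma loop_in_dedges: "v \<in> dverts L \<Longrightarrow> {v} \<in> dedges L"
  by (induction L rule: dedges.induct) (auto simp: star_def)

text \<open>The neighbours of \<open>v\<close> in the graph are exactly its parents as long as \<open>v\<close> is a leaf, so a complete
  set either avoids \<open>v\<close> or lies in its family.\<close>

lemma complete_in_scheme_Cons: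
  assumes "scheme ((v, N) # L)" "complete_in (dedges ((v, N) # L)) X"
  shows "X \<subseteq> insert v (set N) \<or> v \<notin> X \<and> complete_in (dedges L) X"
proof (cases "v \<in> X")
  case True
  have "j \<in> insert v (set N)" if "j \<in> X" for j
  proof -
    have "{v, j} \<in> dedges ((v, N) # L)" using True that assms(2) by (auto simp: complete_in_def)
    moreover have "{v, j} \<notin> dedges L" using dedges_subset[of L "{v, j}"] assms(1) by auto
    ultimately show ?thesis by (auto simp: star_def doubleton_eq_iff)
  qed
  then show ?thesis by blast
next
  case False
  then have "{i, j} \<notin> star v N" if "i \<in> X" "j \<in> X" for i j
    using that by (auto simp: star_def doubleton_eq_iff)
  then show ?thesis using False assms(2) by (auto simp: complete_in_def)
qed

lemma complete_in_scheme_subset: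
  assumes "scheme L" "complete_in (dedges L) X" "X \<noteq> {}"
  shows "\<exists>(v, N)\<in>set L. X \<subseteq> insert v (set N)"
  using assms
proof (induction L)
  case Nil
  then show ?case by (auto simp: complete_in_def)
next
  case (Cons a L)
  obtain v N where a: "a = (v, N)" by (cases a)
  from complete_in_scheme_Cons[of v N L X] Cons.prems a
  show ?case
    using Cons.IH Cons.prems a by (auto)
qed

section \<open>Positive definite forms on vertex sets\<close>

definition qform :: "nat set \<Rightarrow> (nat set \<Rightarrow> real) \<Rightarrow> (nat \<Rightarrow> real) \<Rightarrow> real" where
  "qform X g y = (\<Sum>i\<in>X. \<Sum>j\<in>X. g {i, j} * (y i * y j))"

definition pd_on :: "nat set \<Rightarrow> (nat set \<Rightarrow> real) \<Rightarrow> bool" where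
  "pd_on X g \<longleftrightarrow> (\<forall>y. (\<exists>i\<in>X. y i \<noteq> 0) \<longrightarrow> qform X g y > 0)"

lemma pd_onD: "pd_on X g \<Longrightarrow> i \<in> X \<Longrightarrow> y i \<noteq> 0 \<Longrightarrow> qform X g y > 0"
  unfolding pd_on_def by auto

lemma sum_pairs_insert:
  assumes "finite X" "v \<notin> X" and sym: "\<And>i j. f i j = (f j i :: real)"
  shows "(\<Sum>i\<in>insert v X. \<Sum>j\<in>insert v X. f i j) =
    f v v + 2 * (\<Sum>j\<in>X. f v j) + (\<Sum>i\<in>X. \<Sum>j\<in>X. f i j)"
proof -
  have "(\<Sum>i\<in>X. f i v) = (\<Sum>i\<in>X. f v i)" using sym by simp
  then show ?thesis using assms by (simp add: sum.distrib)
qed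

lemma qform_insert:
  assumes "finite X" "v \<notin> X"
  shows "qform (insert v X) g y = g {v} * (y v)\<^sup>2 + 2 * y v * (\<Sum>j\<in>X. g {v, j} * y j) + qform X g y"
proof -
  have "qform (insert v X) g y = g {v, v} * (y v * y v) + 2 * (\<Sum>j\<in>X. g {v, j} * (y v * y j)) + qform X g y"
    unfolding qform_def using assms by (intro sum_pairs_insert) (auto simp: insert_commute)
  also have "(\<Sum>j\<in>X. g {v, j} * (y v * y j)) = y v * (\<Sum>j\<in>X. g {v, j} * y j)"
    by (simp add: sum_distrib_left mult_ac)
  finally show ?thesis by (simp add: power2_eq_square)
qed

lemma qform_cong: "(\<And>i j. i \<in> X \<Longrightarrow> j \<in> X \<Longrightarrow> g {i, j} = h {i, j}) \<Longrightarrow> (\<And>i. i \<in> X \<Longrightarrow> y i = z i) \<Longrightarrow>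
  qform X g y = qform X h z"
  unfolding qform_def by (intro sum.cong) auto

lemma qform_mono_neutral:
  assumes "finite Y" "X \<subseteq> Y" "\<And>i. i \<in> Y - X \<Longrightarrow> y i = 0"
  shows "qform Y g y = qform X g y"
proof -
  have "qform Y g y = (\<Sum>i\<in>Y. \<Sum>j\<in>X. g {i, j} * (y i * y j))"
    unfolding qform_def using assms by (intro sum.cong sum.mono_neutral_right) auto
  also have "\<dots> = qform X g y"
    unfolding qform_def using assms by (intro sum.mono_neutral_right) auto
  finally show ?thesis .
qed

lemma pd_on_subset:
  assumes "pd_on Y g" "finite Y" "X \<subseteq> Y"
  shows "pd_on X g"
  unfolding pd_on_def
proof (intro allI impI)
  fix y :: "nat \<Rightarrow> real" assume y: "\<exists>i\<in>X. y i \<noteq> 0"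
  let ?z = "\<lambda>i. if i \<in> X then y i else 0"
  obtain i where "i \<in> X" "y i \<noteq> 0" using y by blast
  then have "0 < qform Y g ?z" using assms(3) by (intro pd_onD[OF assms(1), of i]) auto
  also have "\<dots> = qform X g ?z" using assms by (intro qform_mono_neutral) auto
  also have "\<dots> = qform X g y" by (intro qform_cong) auto
  finally show "0 < qform X g y" .
qed

section \<open>Regression of a vertex on its parents\<close>

text \<open>With \<open>g\<close> as covariance matrix, \<open>pdet N g\<close> is the determinant of the block of the parents,
  \<open>coef N g v\<close> is the vector of regression coefficients of \<open>v\<close> on \<open>N\<close> (by Cramer's rule), and
  \<open>pvar v N g\<close> is the residual variance, i.e. the Schur complement of that block.\<close>

fun pdet :: "nat list \<Rightarrow> (nat set \<Rightarrow> real) \<Rightarrow> real" where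
  "pdet [] g = 1"
| "pdet [u] g = g {u}"
| "pdet [u, w] g = g {u} * g {w} - (g {u, w})\<^sup>2"
| "pdet _ g = 0"

fun coef :: "nat list \<Rightarrow> (nat set \<Rightarrow> real) \<Rightarrow> nat \<Rightarrow> nat \<Rightarrow> real" where
  "coef [u] g v i = g {v, u} / g {u}"
| "coef [u, w] g v i =
    (if i = u then g {v, u} * g {w} - g {v, w} * g {u, w} else g {v, w} * g {u} - g {v, u} * g {u, w}) /
    (g {u} * g {w} - (g {u, w})\<^sup>2)"
| "coef _ g v i = 0"

definition pvar :: "nat \<Rightarrow> nat list \<Rightarrow> (nat set \<Rightarrow> real) \<Rightarrow> real" where
  "pvar v N g = g {v} - (\<Sum>u\<in>set N. coef N g v u * g {v, u})"

lemma parent_list_cases: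
  assumes "length N \<le> 2" "distinct N"
  obtains "N = []" | u where "N = [u]" | u w where "N = [u, w]" "u \<noteq> w"
proof (cases N)
  case (Cons u M)
  then show ?thesis using assms that by (cases M) auto
qed (use that in auto)

lemma pdet_pos:
  assumes "pd_on (set N) g" "length N \<le> 2" "distinct N"
  shows "pdet N g > 0"
  using assms(2,3)
proof (cases rule: parent_list_cases)
  case (2 u)
  then show ?thesis using assms(1)[unfolded pd_on_def, rule_format, of "\<lambda>_. 1"]
    by (simp add: qform_def)
next
  case (3 u w)
  have p: "g {u} > 0"
    using pd_on_subset[OF assms(1), of "{u}", unfolded pd_on_def, rule_format, of "\<lambda>_. 1"] 3
    by (simp add: qform_def)
  have "0 < qform {u, w} g (\<lambda>i. if i = u then - g {u, w} else g {u})"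
    using 3 p by (intro pd_onD[where i = w]) (use assms(1) in auto)
  also have "\<dots> = g {u} * pdet N g"
    using 3 by (simp add: qform_def insert_commute power2_eq_square algebra_simps)
  finally show ?thesis using p by (simp add: zero_less_mult_iff)
qed simp

lemma coef_normal_eq:
  assumes "pd_on (set N) g" "length N \<le> 2" "distinct N" "j \<in> set N"
  shows "(\<Sum>u\<in>set N. coef N g v u * g {u, j}) = g {v, j}"
  using assms(2,3)
proof (cases rule: parent_list_cases)
  case 1
  then show ?thesis using assms by simp
next
  case (2 u)
  then show ?thesis using assms pdet_pos[OF assms(1-3)] by simp
next
  case (3 u w)
  define p q r s t where "p = g {u}" "q = g {u, w}" "r = g {w}" "s = g {v, u}" "t = g {v, w}"
  note defs = p_q_r_s_t_def[symmetric]
  have D: "p * r - q\<^sup>2 \<noteq> 0" using pdet_pos[OF assms(1-3)] 3 by (simp add: defs)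
  have wu: "g {w, u} = q" by (simp add: defs insert_commute)
  have "(\<Sum>i\<in>set N. coef N g v i * g {i, u}) = (s * r - t * q) / (p * r - q\<^sup>2) * p + (t * p - s * q) / (p * r - q\<^sup>2) * q"
    using 3 wu by (simp add: defs)
  also have "\<dots> = s * (p * r - q\<^sup>2) / (p * r - q\<^sup>2)"
    by (simp add: power2_eq_square algebra_simps flip: add_divide_distrib)
  finally have 1: "(\<Sum>i\<in>set N. coef N g v i * g {i, u}) = s" using D by simp
  have "(\<Sum>i\<in>set N. coef N g v i * g {i, w}) = (s * r - t * q) / (p * r - q\<^sup>2) * q + (t * p - s * q) / (p * r - q\<^sup>2) * r"
    using 3 by (simp add: defs)
  also have "\<dots> = t * (p * r - q\<^sup>2) / (p * r - q\<^sup>2)"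
    by (simp add: power2_eq_square algebra_simps flip: add_divide_distrib)
  finally have 2: "(\<Sum>i\<in>set N. coef N g v i * g {i, w}) = t" using D by simp
  have "j = u \<or> j = w" using 3 assms by auto
  then show ?thesis using 1 2 by (auto simp: defs)
qed

lemma coef_unique:
  assumes pd: "pd_on (set N) g" "length N \<le> 2" "distinct N"
    and b: "\<And>j. j \<in> set N \<Longrightarrow> (\<Sum>u\<in>set N. b u * g {u, j}) = g {v, j}"
    and u: "u \<in> set N"
  shows "b u = coef N g v u"
proof (rule ccontr)
  assume ne: "b u \<noteq> coef N g v u"
  \<comment> \<open>The difference of two solutions is annihilated by the block, so its form vanishes.\<close>
  let ?y = "\<lambda>i. b i - coef N g v i"
  have "0 < qform (set N) g ?y" using u ne by (intro pd_onD[OF pd(1) u]) simp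
  also have "qform (set N) g ?y = (\<Sum>j\<in>set N. \<Sum>i\<in>set N. g {i, j} * (?y i * ?y j))"
    unfolding qform_def by (rule sum.swap)
  also have "\<dots> = (\<Sum>j\<in>set N. ((\<Sum>i\<in>set N. b i * g {i, j}) - (\<Sum>i\<in>set N. coef N g v i * g {i, j})) * ?y j)"
    unfolding sum_subtractf[symmetric] sum_distrib_right by (intro sum.cong refl) (simp add: algebra_simps)
  also have "\<dots> = 0"
    using b coef_normal_eq[OF pd] by simp
  finally show False by simp
qed

text \<open>Completing the square in the parents leaves the residual variance as the coefficient of \<open>(y v)\<^sup>2\<close>;
  this is what makes positivity on a family a condition on one new pivot.\<close>

lemma qform_complete_square:
  assumes pd: "pd_on (set N) g" "length N \<le> 2" "distinct N" and v: "v \<notin> set N"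
  shows "qform (insert v (set N)) g y =
    pvar v N g * (y v)\<^sup>2 + qform (set N) g (\<lambda>u. y u + coef N g v u * y v)"
proof -
  let ?c = "coef N g v"
  have eq: "(\<Sum>j\<in>set N. g {i, j} * ?c j) = g {v, i}" if "i \<in> set N" for i
    using coef_normal_eq[OF pd that, of v] by (simp add: mult_ac insert_commute)
  have "qform (set N) g (\<lambda>u. y u + ?c u * y v) =
     (\<Sum>i\<in>set N. \<Sum>j\<in>set N. g {i, j} * (y i * y j) + y v * (y i * (g {i, j} * ?c j)) +
        y v * (y j * (g {j, i} * ?c i)) + (y v)\<^sup>2 * (?c i * (g {i, j} * ?c j)))"
    unfolding qform_def
    by (intro sum.cong refl) (simp add: algebra_simps power2_eq_square insert_commute)
  also have "\<dots> = qform (set N) g y + y v * (\<Sum>i\<in>set N. y i * (\<Sum>j\<in>set N. g {i, j} * ?c j)) +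
      y v * (\<Sum>i\<in>set N. \<Sum>j\<in>set N. y j * (g {j, i} * ?c i)) +
      (y v)\<^sup>2 * (\<Sum>i\<in>set N. ?c i * (\<Sum>j\<in>set N. g {i, j} * ?c j))"
    by (simp add: sum.distrib qform_def sum_distrib_left)
  also have "(\<Sum>i\<in>set N. \<Sum>j\<in>set N. y j * (g {j, i} * ?c i)) =
      (\<Sum>i\<in>set N. y i * (\<Sum>j\<in>set N. g {i, j} * ?c j))"
    by (subst sum.swap) (simp add: sum_distrib_left)
  finally have "qform (set N) g (\<lambda>u. y u + ?c u * y v) = qform (set N) g y +
      2 * y v * (\<Sum>i\<in>set N. g {v, i} * y i) + (y v)\<^sup>2 * (\<Sum>i\<in>set N. ?c i * g {v, i})"
    using eq by (simp add: mult_ac)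
  then show ?thesis
    using v by (simp add: qform_insert pvar_def algebra_simps)
qed

lemma pd_on_insert_iff:
  assumes "length N \<le> 2" "distinct N" and v: "v \<notin> set N"
  shows "pd_on (insert v (set N)) g \<longleftrightarrow> pd_on (set N) g \<and> pvar v N g > 0"
proof (intro iffI conjI)
  assume pd: "pd_on (insert v (set N)) g"
  show N: "pd_on (set N) g" by (rule pd_on_subset[OF pd]) auto
  let ?y = "\<lambda>u. if u = v then 1 else - coef N g v u"
  have "0 < qform (insert v (set N)) g ?y" by (rule pd_onD[OF pd, of v]) auto
  also have "\<dots> = pvar v N g + qform (set N) g (\<lambda>u. ?y u + coef N g v u * ?y v)"
    by (subst qform_complete_square[OF N assms]) simp
  also have "qform (set N) g (\<lambda>u. ?y u + coef N g v u * ?y v) = qform (set N) g (\<lambda>_. 0)"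
    using v by (intro qform_cong) auto
  finally show "pvar v N g > 0" by (simp add: qform_def)
next
  assume *: "pd_on (set N) g \<and> pvar v N g > 0"
  show "pd_on (insert v (set N)) g"
    unfolding pd_on_def
  proof (intro allI impI)
    fix y :: "nat \<Rightarrow> real" assume y: "\<exists>i\<in>insert v (set N). y i \<noteq> 0"
    let ?z = "\<lambda>u. y u + coef N g v u * y v"
    have z: "qform (set N) g ?z > 0 \<or> (\<forall>u\<in>set N. ?z u = 0)"
      using pd_onD[OF conjunct1[OF *], of _ ?z] by blast
    have "qform (set N) g ?z \<ge> 0"
    proof (cases "\<forall>u\<in>set N. ?z u = 0")
      case True
      then have "qform (set N) g ?z = qform (set N) g (\<lambda>_. 0)" by (intro qform_cong) auto
      then show ?thesis by (simp add: qform_def)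
    qed (use z in auto)
    moreover have "y v \<noteq> 0 \<or> qform (set N) g ?z > 0"
      using z y by auto
    moreover have "pvar v N g * (y v)\<^sup>2 \<ge> 0" "y v \<noteq> 0 \<Longrightarrow> pvar v N g * (y v)\<^sup>2 > 0"
      using * by auto
    ultimately show "0 < qform (insert v (set N)) g y"
      unfolding qform_complete_square[OF conjunct1[OF *] assms] by linarith
  qed
qed

section \<open>The two cones described by pivots\<close>

text \<open>Sylvester's criterion along a scheme: on the covariance side the pivots are the residual
  variances, on the precision side they are the diagonal entries met during Gaussian elimination.\<close>

fun in_Q :: "scheme \<Rightarrow> (nat set \<Rightarrow> real) \<Rightarrow> bool" where
  "in_Q [] g = True"
| "in_Q ((v, N) # L) g = (pvar v N g > 0 \<and> in_Q L g)"

lemma in_Q_iff: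
  assumes "scheme L"
  shows "in_Q L g \<longleftrightarrow> (\<forall>X. complete_in (dedges L) X \<longrightarrow> pd_on X g)"
  using assms
proof (induction L)
  case Nil
  have "X = {}" if "complete_in {} X" for X using that by (auto simp: complete_in_def)
  then show ?case by (auto simp: pd_on_def)
next
  case (Cons a L)
  obtain v N where a: "a = (v, N)" by (cases a)
  have sch: "scheme ((v, N) # L)" using Cons.prems a by simp
  then have N: "length N \<le> 2" "distinct N" "v \<notin> set N" "scheme L" "complete_in (dedges L) (set N)"
    by (auto simp: complete_in_def)
  note IH = Cons.IH[OF N(4)]
  have cfam: "complete_in (dedges ((v, N) # L)) (insert v (set N))"
    using N(5) by (auto simp: complete_in_def star_def insert_commute)
  have cL: "complete_in (dedges ((v, N) # L)) X" if "complete_in (dedges L) X" for X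
    using that by (auto simp: complete_in_def)
  show ?case
    unfolding a
  proof
    assume "in_Q ((v, N) # L) g"
    then have q: "pvar v N g > 0" and L: "\<And>X. complete_in (dedges L) X \<Longrightarrow> pd_on X g"
      using IH by auto
    have "pd_on (insert v (set N)) g"
      using pd_on_insert_iff[OF N(1-3)] q L N(5) by blast
    then show "\<forall>X. complete_in (dedges ((v, N) # L)) X \<longrightarrow> pd_on X g"
      using complete_in_scheme_Cons[OF sch] L pd_on_subset[of "insert v (set N)"] by blast
  next
    assume "\<forall>X. complete_in (dedges ((v, N) # L)) X \<longrightarrow> pd_on X g"
    then show "in_Q ((v, N) # L) g"
      using IH cL cfam pd_on_insert_iff[OF N(1-3)] by auto
  qed
qed

lemma in_Q_pd_on:
  assumes "scheme ((v, N) # L)" "in_Q L g"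
  shows "pd_on (set N) g"
  using in_Q_iff[of L g] assms by (auto simp: complete_in_def)

text \<open>Eliminating \<open>v\<close> from a precision matrix changes only the entries between its parents. They are
  complete, so the Schur complement is again supported on the edges of the remaining scheme (no
  fill-in).\<close>

definition schur :: "nat \<Rightarrow> nat list \<Rightarrow> (nat set \<Rightarrow> real) \<Rightarrow> nat set \<Rightarrow> real" where
  "schur v N x = (\<lambda>e. x e - (if e \<subseteq> set N then x {v, Min e} * x {v, Max e} / x {v} else 0))"

lemma Min_Max_pair: "(f (Min {i, j}) * f (Max {i, j}) :: real) = f i * f j" for i j :: nat
  by (cases "i \<le> j") (auto simp: min_def max_def)

lemma schur_pair: "schur v N x {i, j} = x {i, j} -
    (if i \<in> set N \<and> j \<in> set N then x {v, i} * x {v, j} / x {v} else 0)"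
  unfolding schur_def Min_Max_pair[of "\<lambda>k. x {v, k}"] by simp

fun in_P :: "scheme \<Rightarrow> (nat set \<Rightarrow> real) \<Rightarrow> bool" where
  "in_P [] x = True"
| "in_P ((v, N) # L) x = (x {v} > 0 \<and> in_P L (schur v N x))"

definition fill :: "scheme \<Rightarrow> (nat set \<Rightarrow> real) \<Rightarrow> nat set \<Rightarrow> real" where
  "fill L x = (\<lambda>e. if e \<in> dedges L then x e else 0)"

lemma fill_Cons:
  assumes "scheme ((v, N) # L)"
  shows "fill ((v, N) # L) x {v} = x {v}"
    and "j \<in> dverts L \<Longrightarrow> fill ((v, N) # L) x {v, j} = (if j \<in> set N then x {v, j} else 0)"
    and "i \<in> dverts L \<Longrightarrow> j \<in> dverts L \<Longrightarrow> fill ((v, N) # L) x {i, j} =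
      fill L (schur v N x) {i, j} + (if i \<in> set N \<and> j \<in> set N then x {v, i} * x {v, j} / x {v} else 0)"
proof -
  have *: "scheme L" "v \<notin> dverts L" "set N \<subseteq> dverts L"
    "u \<in> set N \<Longrightarrow> w \<in> set N \<Longrightarrow> {u, w} \<in> dedges L" for u w
    using assms by auto
  show "fill ((v, N) # L) x {v} = x {v}" by (simp add: fill_def star_def)
  show "fill ((v, N) # L) x {v, j} = (if j \<in> set N then x {v, j} else 0)" if "j \<in> dverts L"
  proof -
    have "{v, j} \<notin> dedges L" using dedges_subset[OF *(1), of "{v, j}"] *(2) by auto
    then show ?thesis using *(2) that by (auto simp: fill_def star_def doubleton_eq_iff)
  qed
  show "fill ((v, N) # L) x {i, j} =
      fill L (schur v N x) {i, j} + (if i \<in> set N \<and> j \<in> set N then x {v, i} * x {v, j} / x {v} else 0)"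
    if "i \<in> dverts L" "j \<in> dverts L"
  proof -
    have "{i, j} \<notin> star v N" using *(2) that by (auto simp: star_def doubleton_eq_iff)
    then show ?thesis using *(4)[of i j] by (simp add: fill_def schur_pair)
  qed
qed

definition trace_form :: "nat set \<Rightarrow> (nat set \<Rightarrow> real) \<Rightarrow> (nat set \<Rightarrow> real) \<Rightarrow> real" where
  "trace_form V x g = (\<Sum>i\<in>V. \<Sum>j\<in>V. x {i, j} * g {i, j})"

text \<open>The part of the trace of a product that belongs to the leaf \<open>v\<close>: with \<open>x\<close> as the precision matrix
  it is \<open>x {v}\<close> times the form \<open>g\<close> at the vector \<open>e\<^sub>v + \<Sum>\<^sub>u x {v, u} / x {v} \<cdot> e\<^sub>u\<close>.\<close>

definition leaf_form :: "nat \<Rightarrow> nat list \<Rightarrow> (nat set \<Rightarrow> real) \<Rightarrow> (nat set \<Rightarrow> real) \<Rightarrow> real" where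
  "leaf_form v N x g = x {v} * g {v} + 2 * (\<Sum>u\<in>set N. x {v, u} * g {v, u}) +
     (\<Sum>u\<in>set N. \<Sum>w\<in>set N. x {v, u} * x {v, w} * g {u, w}) / x {v}"

text \<open>\<open>fill L x\<close> for the whole scheme is \<open>x {v}\<close> times a rank one matrix plus the Schur complement, and the
  trace is linear.\<close>

lemma trace_form_Cons:
  assumes sch: "scheme ((v, N) # L)"
  shows "trace_form (dverts ((v, N) # L)) (fill ((v, N) # L) x) g =
    leaf_form v N x g + trace_form (dverts L) (fill L (schur v N x)) g"
proof -
  let ?F = "fill ((v, N) # L) x" let ?V = "dverts L"
  have *: "finite ?V" "v \<notin> ?V" "set N \<subseteq> ?V" using sch by auto
  have "trace_form (dverts ((v, N) # L)) ?F g = ?F {v, v} * g {v, v} + 2 * (\<Sum>j\<in>?V. ?F {v, j} * g {v, j}) + trace_form ?V ?F g"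
    unfolding trace_form_def using * sum_pairs_insert[of ?V v "\<lambda>i j. ?F {i, j} * g {i, j}"]
    by (simp add: insert_commute)
  also have "(\<Sum>j\<in>?V. ?F {v, j} * g {v, j}) = (\<Sum>j\<in>?V. if j \<in> set N then x {v, j} * g {v, j} else 0)"
    using fill_Cons(2)[OF sch] by (intro sum.cong) auto
  also have "\<dots> = (\<Sum>j\<in>set N. x {v, j} * g {v, j})"
    using * by (intro sum.mono_neutral_cong_right) auto
  also have "trace_form ?V ?F g = trace_form ?V (fill L (schur v N x)) g +
      (\<Sum>i\<in>?V. \<Sum>j\<in>?V. if i \<in> set N \<and> j \<in> set N then x {v, i} * x {v, j} * g {i, j} / x {v} else 0)"
    unfolding trace_form_def sum.distrib[symmetric] using fill_Cons(3)[OF sch]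
    by (intro sum.cong refl) (auto simp: algebra_simps)
  also have "(\<Sum>i\<in>?V. \<Sum>j\<in>?V. if i \<in> set N \<and> j \<in> set N then x {v, i} * x {v, j} * g {i, j} / x {v} else 0)
    = (\<Sum>i\<in>set N. \<Sum>j\<in>?V. if j \<in> set N then x {v, i} * x {v, j} * g {i, j} / x {v} else 0)"
    using * by (intro sum.mono_neutral_cong_right) auto
  also have "\<dots> = (\<Sum>i\<in>set N. \<Sum>j\<in>set N. x {v, i} * x {v, j} * g {i, j} / x {v})"
    using * by (intro sum.cong refl sum.mono_neutral_cong_right) auto
  finally show ?thesis
    using fill_Cons(1)[OF sch] by (simp add: leaf_form_def sum_divide_distrib)
qed

lemma qform_trace_form: "qform V x y = trace_form V x (\<lambda>e. y (Min e) * y (Max e))"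
  unfolding qform_def trace_form_def Min_Max_pair ..

lemma qform_fill_Cons:
  assumes sch: "scheme ((v, N) # L)" and "x {v} \<noteq> 0"
  shows "qform (dverts ((v, N) # L)) (fill ((v, N) # L) x) y =
    x {v} * (y v + (\<Sum>u\<in>set N. x {v, u} * y u) / x {v})\<^sup>2 + qform (dverts L) (fill L (schur v N x)) y"
proof -
  have "leaf_form v N x (\<lambda>e. y (Min e) * y (Max e)) = x {v} * (y v)\<^sup>2 + 2 * (\<Sum>u\<in>set N. x {v, u} * (y v * y u)) +
     (\<Sum>u\<in>set N. \<Sum>w\<in>set N. x {v, u} * x {v, w} * (y u * y w)) / x {v}"
    unfolding leaf_form_def Min_Max_pair by (simp add: power2_eq_square)
  also have "(\<Sum>u\<in>set N. x {v, u} * (y v * y u)) = y v * (\<Sum>u\<in>set N. x {v, u} * y u)"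
    by (simp add: sum_distrib_left mult_ac)
  also have "(\<Sum>u\<in>set N. \<Sum>w\<in>set N. x {v, u} * x {v, w} * (y u * y w)) = (\<Sum>u\<in>set N. x {v, u} * y u)\<^sup>2"
    by (simp add: power2_eq_square sum_product mult_ac)
  finally show ?thesis
    using assms(2) unfolding qform_trace_form trace_form_Cons[OF sch]
    by (simp add: power2_eq_square field_simps)
qed

lemma pd_on_fill_iff:
  assumes "scheme L"
  shows "pd_on (dverts L) (fill L x) \<longleftrightarrow> in_P L x"
  using assms
proof (induction L arbitrary: x)
  case Nil
  then show ?case by (simp add: pd_on_def)
next
  case (Cons a L)
  obtain v N where a: "a = (v, N)" by (cases a)
  have sch: "scheme ((v, N) # L)" using Cons.prems a by simp
  then have v: "v \<notin> dverts L" "set N \<subseteq> dverts L" by auto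
  let ?V = "dverts ((v, N) # L)"
  let ?x = "schur v N x"
  have IH: "pd_on (dverts L) (fill L ?x) \<longleftrightarrow> in_P L ?x"
    using Cons sch by auto
  show ?case
    unfolding a
  proof
    assume pd: "pd_on ?V (fill ((v, N) # L) x)"
    have "pd_on {v} (fill ((v, N) # L) x)" by (rule pd_on_subset[OF pd]) auto
    from this[unfolded pd_on_def, rule_format, of "\<lambda>_. 1"]
    have p: "x {v} > 0" by (simp add: qform_def fill_def star_def)
    have "pd_on (dverts L) (fill L ?x)"
      unfolding pd_on_def
    proof (intro allI impI)
      fix y :: "nat \<Rightarrow> real" assume y: "\<exists>i\<in>dverts L. y i \<noteq> 0"
      \<comment> \<open>This value at \<open>v\<close> minimises the form and makes the square vanish.\<close>
      let ?z = "y(v := - (\<Sum>u\<in>set N. x {v, u} * y u) / x {v})"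
      have s: "(\<Sum>u\<in>set N. x {v, u} * ?z u) = (\<Sum>u\<in>set N. x {v, u} * y u)"
        using v by (intro sum.cong) auto
      obtain i where "i \<in> dverts L" "y i \<noteq> 0" using y by blast
      then have "0 < qform ?V (fill ((v, N) # L) x) ?z" using v by (intro pd_onD[OF pd, of i]) auto
      also have "\<dots> = qform (dverts L) (fill L ?x) ?z"
        using p by (subst qform_fill_Cons[OF sch]) (simp_all only: s, simp_all)
      also have "\<dots> = qform (dverts L) (fill L ?x) y"
        using v by (intro qform_cong) auto
      finally show "0 < qform (dverts L) (fill L ?x) y" .
    qed
    then show "in_P ((v, N) # L) x" using IH p by simp
  next
    assume "in_P ((v, N) # L) x"
    then have p: "x {v} > 0" and pd: "pd_on (dverts L) (fill L ?x)" using IH by auto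
    show "pd_on ?V (fill ((v, N) # L) x)"
      unfolding pd_on_def
    proof (intro allI impI)
      fix y :: "nat \<Rightarrow> real" assume y: "\<exists>i\<in>?V. y i \<noteq> 0"
      let ?s = "\<Sum>u\<in>set N. x {v, u} * y u"
      show "0 < qform ?V (fill ((v, N) # L) x) y"
      proof (cases "\<exists>i\<in>dverts L. y i \<noteq> 0")
        case True
        then have "qform (dverts L) (fill L ?x) y > 0" using pd_onD[OF pd] by blast
        moreover have "x {v} * (y v + ?s / x {v})\<^sup>2 \<ge> 0" using p by simp
        ultimately show ?thesis using p by (subst qform_fill_Cons[OF sch]) linarith+
      next
        case False
        then have "y v \<noteq> 0" using y by auto
        moreover have "?s = 0" using False v by (intro sum.neutral) auto
        moreover have "qform (dverts L) (fill L ?x) y = 0"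
          unfolding qform_def using False by (intro sum.neutral ballI) auto
        ultimately show ?thesis using p by (subst qform_fill_Cons[OF sch]) auto
      qed
    qed
  qed
qed

section \<open>Inverse matrices along a scheme\<close>

definition inv_pair :: "nat set \<Rightarrow> (nat set \<Rightarrow> real) \<Rightarrow> (nat set \<Rightarrow> real) \<Rightarrow> bool" where
  "inv_pair V x g \<longleftrightarrow> (\<forall>i\<in>V. \<forall>j\<in>V. (\<Sum>k\<in>V. x {i, k} * g {k, j}) = (if i = j then 1 else 0))"

text \<open>The row of \<open>v\<close> in the identity (precision times covariance = 1) expresses the covariances of
  \<open>v\<close> by those of its parents; substituting it into the other rows shows that the Schur complement
  inverts the covariance matrix of the remaining vertices.\<close>

lemma inv_pair_Cons:
  assumes sch: "scheme ((v, N) # L)" and x: "x {v} \<noteq> 0"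
    and inv: "inv_pair (dverts ((v, N) # L)) (fill ((v, N) # L) x) g"
  shows "inv_pair (dverts L) (fill L (schur v N x)) g"
    and "j \<in> dverts L \<Longrightarrow> g {v, j} = (\<Sum>u\<in>set N. (- x {v, u} / x {v}) * g {u, j})"
    and "g {v} = 1 / x {v} + (\<Sum>u\<in>set N. (- x {v, u} / x {v}) * g {v, u})"
proof -
  let ?F = "fill ((v, N) # L) x" let ?V = "dverts L"
  have *: "finite ?V" "v \<notin> ?V" "set N \<subseteq> ?V" using sch by auto
  have inv': "(\<Sum>k\<in>insert v ?V. ?F {i, k} * g {k, j}) = (if i = j then 1 else 0)"
    if "i \<in> insert v ?V" "j \<in> insert v ?V" for i j
    using inv that unfolding inv_pair_def list.set(2) image_insert fst_conv by blast
  have row: "x {v} * g {v, j} + (\<Sum>u\<in>set N. x {v, u} * g {u, j}) = (if j = v then 1 else 0)"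
    if "j \<in> insert v ?V" for j
  proof -
    have "(\<Sum>k\<in>insert v ?V. ?F {v, k} * g {k, j}) = (if j = v then 1 else 0)"
      using inv'[of v j] that by simp
    moreover have "(\<Sum>k\<in>?V. ?F {v, k} * g {k, j}) = (\<Sum>k\<in>?V. if k \<in> set N then x {v, k} * g {k, j} else 0)"
      using fill_Cons(2)[OF sch] by (intro sum.cong) auto
    moreover have "\<dots> = (\<Sum>k\<in>set N. x {v, k} * g {k, j})"
      using * by (intro sum.mono_neutral_cong_right) auto
    ultimately show ?thesis using * fill_Cons(1)[OF sch] by (simp add: insert_commute)
  qed
  have s: "(\<Sum>u\<in>set N. (- x {v, u} / x {v}) * g {u, j}) = - (\<Sum>u\<in>set N. x {v, u} * g {u, j}) / x {v}" for j
    by (simp add: sum_divide_distrib sum_negf)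
  show col: "g {v, j} = (\<Sum>u\<in>set N. (- x {v, u} / x {v}) * g {u, j})" if "j \<in> ?V" for j
  proof -
    have "x {v} * g {v, j} = - (\<Sum>u\<in>set N. x {v, u} * g {u, j})"
    proof -
      have "j \<noteq> v" using that *(2) by metis
      then show ?thesis using row[of j] that by simp
    qed
    then show ?thesis unfolding s using x by (simp add: field_simps)
  qed
  have "x {v} * g {v} = 1 - (\<Sum>u\<in>set N. x {v, u} * g {u, v})" using row[of v] by simp
  then have "g {v} = 1 / x {v} + (\<Sum>u\<in>set N. (- x {v, u} / x {v}) * g {u, v})"
    unfolding s using x by (simp add: field_simps)
  then show "g {v} = 1 / x {v} + (\<Sum>u\<in>set N. (- x {v, u} / x {v}) * g {v, u})"
    by (simp add: insert_commute)
  show "inv_pair ?V (fill L (schur v N x)) g"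
    unfolding inv_pair_def
  proof (intro ballI)
    fix i j assume ij: "i \<in> ?V" "j \<in> ?V"
    let ?d = "\<lambda>k. if i \<in> set N \<and> k \<in> set N then x {v, i} * x {v, k} / x {v} else 0"
    have Fi: "?F {i, v} = (if i \<in> set N then x {v, i} else 0)"
      using fill_Cons(2)[OF sch ij(1), of x] by (simp add: insert_commute)
    have "(if i = j then 1 else 0) = (\<Sum>k\<in>insert v ?V. ?F {i, k} * g {k, j})"
      using inv'[of i j] ij by simp
    also have "\<dots> = ?F {i, v} * g {v, j} + (\<Sum>k\<in>?V. (fill L (schur v N x) {i, k} + ?d k) * g {k, j})"
      using * fill_Cons(3)[OF sch ij(1)] by (simp cong: sum.cong)
    also have "\<dots> = ?F {i, v} * g {v, j} + (\<Sum>k\<in>?V. ?d k * g {k, j}) + (\<Sum>k\<in>?V. fill L (schur v N x) {i, k} * g {k, j})"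
      by (simp add: distrib_right sum.distrib)
    also have "(\<Sum>k\<in>?V. ?d k * g {k, j}) = (\<Sum>k\<in>set N. ?d k * g {k, j})"
      using * by (intro sum.mono_neutral_right) auto
    also have "?F {i, v} * g {v, j} + (\<Sum>k\<in>set N. ?d k * g {k, j}) = 0"
      unfolding Fi col[OF ij(2)]
      by (simp add: sum_distrib_left sum_negf mult.assoc)
    finally show "(\<Sum>k\<in>?V. fill L (schur v N x) {i, k} * g {k, j}) = (if i = j then 1 else 0)" by simp
  qed
qed

text \<open>The precision matrix rebuilt from the covariances on the edges: the leaf contributes the rank one
  matrix \<open>\<ell> \<ell>\<^sup>T / pvar v N g\<close> with \<open>\<ell> = e\<^sub>v - \<Sum>\<^sub>u coef N g v u \<cdot> e\<^sub>u\<close>. The argument of the last case is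
  an edge \<open>{v, u}\<close> with a parent \<open>u\<close>.\<close>

fun precision :: "scheme \<Rightarrow> (nat set \<Rightarrow> real) \<Rightarrow> nat set \<Rightarrow> real" where
  "precision [] g = (\<lambda>e. 0)"
| "precision ((v, N) # L) g = (\<lambda>e.
     if e \<in> dedges L
     then precision L g e + (if e \<subseteq> set N then coef N g v (Min e) * coef N g v (Max e) / pvar v N g else 0)
     else if e = {v} then 1 / pvar v N g else - coef N g v (Min (e - {v})) / pvar v N g)"

lemma precision_Cons:
  assumes sch: "scheme ((v, N) # L)"
  shows "precision ((v, N) # L) g {v} = 1 / pvar v N g"
    and "u \<in> set N \<Longrightarrow> precision ((v, N) # L) g {v, u} = - coef N g v u / pvar v N g"
    and "pvar v N g \<noteq> 0 \<Longrightarrow> e \<in> dedges L \<Longrightarrow> schur v N (precision ((v, N) # L) g) e = precision L g e"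
proof -
  have sL: "scheme L" and v: "v \<notin> dverts L" and N: "set N \<subseteq> dverts L" using sch by auto
  have no: "{v, w} \<notin> dedges L" for w using dedges_subset[OF sL, of "{v, w}"] v by auto
  show 1: "precision ((v, N) # L) g {v} = 1 / pvar v N g" using no[of v] by simp
  show 2: "precision ((v, N) # L) g {v, u} = - coef N g v u / pvar v N g" if "u \<in> set N" for u
  proof -
    have "u \<noteq> v" using that v N by auto
    then have "{v, u} - {v} = {u}" "{v, u} \<noteq> {v}" by auto
    then show ?thesis using no[of u] by simp
  qed
  show "schur v N (precision ((v, N) # L) g) e = precision L g e" if p: "pvar v N g \<noteq> 0" and e: "e \<in> dedges L"
  proof (cases "e \<subseteq> set N")
    case True
    have "finite e" "e \<noteq> {}" using dedges_subset[OF sL e] finite_subset[OF True] by auto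
    then have "Min e \<in> set N" "Max e \<in> set N" using True by (auto intro: Min_in Max_in)
    then show ?thesis using True p e unfolding schur_def 1 by (simp add: 2 del: precision.simps) (simp add: field_simps)
  next
    case False
    then show ?thesis using e by (simp add: schur_def)
  qed
qed

lemma schur_cong:
  assumes sch: "scheme ((v, N) # L)" and "\<And>e. e \<in> dedges ((v, N) # L) \<Longrightarrow> x e = y e" "e \<in> dedges L"
  shows "schur v N x e = schur v N y e"
proof (cases "e \<subseteq> set N")
  case True
  have "e \<noteq> {}" "finite e"
    using dedges_subset[of L e] assms finite_subset[OF True] by auto
  then have "Min e \<in> set N" "Max e \<in> set N" using True by (auto intro: Min_in Max_in)
  then show ?thesis using assms True by (simp add: schur_def star_def)
qed (use assms in \<open>simp add: schur_def\<close>)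

lemma in_P_cong: "scheme L \<Longrightarrow> (\<And>e. e \<in> dedges L \<Longrightarrow> x e = y e) \<Longrightarrow> in_P L x = in_P L y"
proof (induction L arbitrary: x y)
  case (Cons a L)
  obtain v N where a: "a = (v, N)" by (cases a)
  have sch: "scheme ((v, N) # L)" using Cons.prems a by simp
  have eq: "x e = y e" if "e \<in> dedges ((v, N) # L)" for e using Cons.prems that a by simp
  have "in_P L (schur v N x) = in_P L (schur v N y)"
    using sch schur_cong[OF sch eq] by (intro Cons.IH) auto
  then show ?case using eq[of "{v}"] by (simp add: a star_def)
qed simp

lemma fill_cong: "(\<And>e. e \<in> dedges L \<Longrightarrow> x e = y e) \<Longrightarrow> fill L x = fill L y"
  by (auto simp: fill_def)

lemma in_P_precision: "scheme L \<Longrightarrow> in_Q L g \<Longrightarrow> in_P L (precision L g)"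
proof (induction L)
  case (Cons a L)
  obtain v N where a: "a = (v, N)" by (cases a)
  have sch: "scheme ((v, N) # L)" using Cons.prems a by simp
  have q: "pvar v N g > 0" "in_Q L g" using Cons.prems a by auto
  have "in_P L (schur v N (precision ((v, N) # L) g)) = in_P L (precision L g)"
    using sch precision_Cons(3)[OF sch] q(1) by (intro in_P_cong) auto
  then show ?case using Cons q sch precision_Cons(1)[OF sch, of g] by (simp add: a del: precision.simps)
qed simp

text \<open>The normal equations read off from the row of \<open>v\<close> have only one solution, so the edge entries of
  the inverse determine the precision matrix; this is the uniqueness of the completion.\<close>

lemma inverse_in_Q:
  assumes "scheme L" "in_P L x" "inv_pair (dverts L) (fill L x) g"
  shows "in_Q L g \<and> (\<forall>e\<in>dedges L. x e = precision L g e)"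
  using assms
proof (induction L arbitrary: x)
  case (Cons a L)
  obtain v N where a: "a = (v, N)" by (cases a)
  have sch: "scheme ((v, N) # L)" using Cons.prems a by simp
  then have N: "length N \<le> 2" "distinct N" "set N \<subseteq> dverts L" by auto
  have x: "x {v} > 0" and P: "in_P L (schur v N x)" using Cons.prems a by auto
  note inv = inv_pair_Cons[OF sch _ Cons.prems(3)[unfolded a]]
  have IH: "in_Q L g" "\<And>e. e \<in> dedges L \<Longrightarrow> schur v N x e = precision L g e"
    using Cons.IH[OF _ P inv(1)] sch x by auto
  note pd = in_Q_pd_on[OF sch IH(1)]
  have c: "coef N g v u = - x {v, u} / x {v}" if "u \<in> set N" for u
    using inv(2) x N that by (intro coef_unique[OF pd N(1,2), symmetric]) (auto simp: subset_iff)
  have p: "pvar v N g = 1 / x {v}"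
    unfolding pvar_def using inv(3) x c by simp
  have "x e = precision ((v, N) # L) g e" if "e \<in> dedges ((v, N) # L)" for e
  proof (cases "e \<in> dedges L")
    case True
    then have "schur v N x e = schur v N (precision ((v, N) # L) g) e"
      using IH(2) precision_Cons(3)[OF sch] p x by simp
    moreover have st: "x {v} = precision ((v, N) # L) g {v}"
      "u \<in> set N \<Longrightarrow> x {v, u} = precision ((v, N) # L) g {v, u}" for u
      using precision_Cons(1,2)[OF sch] c p x by (simp_all del: precision.simps)
    moreover have "Min e \<in> set N" "Max e \<in> set N" if "e \<subseteq> set N"
      using that finite_subset[OF that] dedges_subset[of L e] sch True by (auto intro: Min_in Max_in)
    ultimately show ?thesis by (auto simp: schur_def simp del: precision.simps split: if_splits)
  next
    case False
    then have "e = {v} \<or> (\<exists>u\<in>set N. e = {v, u})" using that by (auto simp: star_def)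
    then show ?thesis using precision_Cons(1,2)[OF sch] c p x by (auto simp del: precision.simps)
  qed
  then show ?case using IH p x by (simp add: a)
qed simp

text \<open>Existence of the completion: the inverse of the rebuilt precision matrix agrees with \<open>g\<close> on the
  edges, by induction from the roots of the DAG to the leaves.\<close>

lemma inverse_precision:
  assumes "scheme L" "in_Q L g" "inv_pair (dverts L) (fill L (precision L g)) h" "e \<in> dedges L"
  shows "h e = g e"
  using assms
proof (induction L arbitrary: e)
  case (Cons a L)
  obtain v N where a: "a = (v, N)" by (cases a)
  have sch: "scheme ((v, N) # L)" using Cons.prems a by simp
  then have N: "length N \<le> 2" "distinct N" "set N \<subseteq> dverts L" "complete_in (dedges L) (set N)"
    by (auto simp: complete_in_def)
  have q: "pvar v N g > 0" "in_Q L g" using Cons.prems a by auto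
  let ?x = "precision ((v, N) # L) g"
  have x: "?x {v} \<noteq> 0" using precision_Cons(1)[OF sch, of g] q by (simp del: precision.simps)
  note inv = inv_pair_Cons[OF sch x Cons.prems(3)[unfolded a]]
  have "fill L (schur v N ?x) = fill L (precision L g)"
    using precision_Cons(3)[OF sch] q by (intro fill_cong) auto
  then have IH: "\<And>e. e \<in> dedges L \<Longrightarrow> h e = g e"
    using Cons.IH sch q inv(1) by auto
  note pd = in_Q_pd_on[OF sch q(2)]
  have c: "- ?x {v, u} / ?x {v} = coef N g v u" if "u \<in> set N" for u
    using precision_Cons(1,2)[OF sch] that q by (simp del: precision.simps)
  have 1: "h {v, j} = g {v, j}" if "j \<in> set N" for j
  proof -
    have "h {v, j} = (\<Sum>u\<in>set N. (- ?x {v, u} / ?x {v}) * h {u, j})"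
      using inv(2) that N by blast
    also have "\<dots> = (\<Sum>u\<in>set N. coef N g v u * g {u, j})"
      using c IH N(4) that by (intro sum.cong) (auto simp: complete_in_def)
    also have "\<dots> = g {v, j}" by (rule coef_normal_eq[OF pd N(1,2) that])
    finally show ?thesis .
  qed
  have "h {v} = 1 / ?x {v} + (\<Sum>u\<in>set N. (- ?x {v, u} / ?x {v}) * h {v, u})" by (rule inv(3))
  also have "\<dots> = pvar v N g + (\<Sum>u\<in>set N. coef N g v u * g {v, u})"
    using c 1 precision_Cons(1)[OF sch, of g] by (simp del: precision.simps)
  finally have "h {v} = g {v}" by (simp add: pvar_def)
  then show ?case using Cons.prems(4) 1 IH by (auto simp: a star_def)
qed simp

section \<open>Gamma and Gaussian integrals\<close>

lemma nn_integral_gamma: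
  assumes z: "z > 0" and k: "k > 0" and m: "m \<ge> 0"
  shows "(\<integral>\<^sup>+y. ennreal (if y > 0 then m * exp (- (k * y)) * y powr (z - 1) else 0) \<partial>lborel) =
    ennreal (m * (Gamma z * k powr (- z)))"
proof -
  let ?f = "\<lambda>t. ennreal (indicator {0..} t * t powr (z - 1) / exp t)"
  have "(\<integral>\<^sup>+y. ennreal (if y > 0 then m * exp (- (k * y)) * y powr (z - 1) else 0) \<partial>lborel) =
      (\<integral>\<^sup>+y. ennreal (m * k powr (1 - z)) * ?f (0 + k * y) \<partial>lborel)"
  proof (rule nn_integral_cong)
    fix y :: real
    show "ennreal (if y > 0 then m * exp (- (k * y)) * y powr (z - 1) else 0) =
        ennreal (m * k powr (1 - z)) * ?f (0 + k * y)"
    proof (cases "y > 0")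
      case True
      have "m * exp (- (k * y)) * y powr (z - 1) =
          m * k powr (1 - z) * (indicator {0..} (0 + k * y) * (0 + k * y) powr (z - 1) / exp (0 + k * y))"
        using True k by (simp add: powr_mult exp_minus divide_simps powr_diff)
      moreover have "0 \<le> m * k powr (1 - z)" using m by simp
      ultimately show ?thesis using True by (simp only: if_True ennreal_mult'[symmetric])
    next
      case False
      then have "k * y < 0 \<or> y = 0" using k by (auto simp: mult_less_0_iff)
      then show ?thesis using False by (auto simp: indicator_def not_le)
    qed
  qed
  also have "\<dots> = ennreal (m * k powr (1 - z)) * (\<integral>\<^sup>+y. ?f (0 + k * y) \<partial>lborel)"
    by (intro nn_integral_cmult) measurable
  also have "(\<integral>\<^sup>+y. ?f (0 + k * y) \<partial>lborel) = ennreal (1 / k) * (\<integral>\<^sup>+t. ?f t \<partial>lborel)"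
    using k nn_integral_real_affine[of ?f k 0]
    by (simp add: ennreal_mult'[symmetric] mult.assoc[symmetric])
  also have "(\<integral>\<^sup>+t. ?f t \<partial>lborel) = ennreal (Gamma z)"
    by (rule Gamma_conv_nn_integral_real[OF z, symmetric])
  also have "ennreal (m * k powr (1 - z)) * (ennreal (1 / k) * ennreal (Gamma z)) =
      ennreal (m * (Gamma z * k powr (- z)))"
    using k m Gamma_real_pos[OF z]
    by (simp add: ennreal_mult'[symmetric] powr_diff powr_minus divide_simps)
  finally show ?thesis .
qed

lemma nn_integral_gauss:
  fixes A d c :: real
  assumes A: "A > 0" and m: "m \<ge> 0"
  shows "(\<integral>\<^sup>+x. ennreal (m * exp (- (A * x\<^sup>2 + 2 * d * x + c))) \<partial>lborel) =
    ennreal (m * (sqrt (pi / A) * exp (d\<^sup>2 / A - c)))"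
proof -
  define s where "s = sqrt (1 / (2 * A))"
  have s2: "s\<^sup>2 = 1 / (2 * A)" "s > 0" using A by (simp_all add: s_def)
  have "m * exp (- (A * x\<^sup>2 + 2 * d * x + c)) =
      m * (sqrt (pi / A) * exp (d\<^sup>2 / A - c)) * normal_density (- d / A) s x" for x
  proof -
    have "exp (d\<^sup>2 / A - c) * exp (- (x - (- d / A))\<^sup>2 / (2 * s\<^sup>2)) = exp (- (A * x\<^sup>2 + 2 * d * x + c))"
      unfolding exp_add[symmetric] s2 using A by (simp add: field_simps power2_eq_square)
    moreover have "sqrt (pi / A) * (1 / sqrt (2 * pi * s\<^sup>2)) = 1"
      unfolding s2 using A by simp
    moreover have "m * (sqrt (pi / A) * exp (d\<^sup>2 / A - c)) * normal_density (- d / A) s x =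
        m * (sqrt (pi / A) * (1 / sqrt (2 * pi * s\<^sup>2))) *
          (exp (d\<^sup>2 / A - c) * exp (- (x - (- d / A))\<^sup>2 / (2 * s\<^sup>2)))"
      unfolding normal_density_def by (simp only: mult_ac)
    ultimately show ?thesis by (simp only: mult_1_right)
  qed
  then have "(\<integral>\<^sup>+x. ennreal (m * exp (- (A * x\<^sup>2 + 2 * d * x + c))) \<partial>lborel) =
      (\<integral>\<^sup>+x. ennreal (m * (sqrt (pi / A) * exp (d\<^sup>2 / A - c))) * ennreal (normal_density (- d / A) s x) \<partial>lborel)"
    using A m by (simp only: ennreal_mult'[symmetric] mult_nonneg_nonneg real_sqrt_ge_zero
      divide_nonneg_nonneg pi_ge_zero less_imp_le exp_ge_zero)
  also have "\<dots> = ennreal (m * (sqrt (pi / A) * exp (d\<^sup>2 / A - c))) * (\<integral>\<^sup>+x. ennreal (normal_density (- d / A) s x) \<partial>lborel)"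
    by (intro nn_integral_cmult) measurable
  also have "(\<integral>\<^sup>+x. ennreal (normal_density (- d / A) s x) \<partial>lborel) = 1"
    using s2 by (subst nn_integral_eq_integral) auto
  finally show ?thesis by simp
qed

lemma powr_neg_half: "x > 0 \<Longrightarrow> x powr (- 1 / 2) = inverse (sqrt x)" for x :: real
  using powr_minus[of x "1 / 2"] powr_half_sqrt[of x] by simp

text \<open>The inner integral is a Gaussian integral in \<open>s\<close> whose value is again Gaussian in \<open>t\<close>, with leading
  coefficient \<open>(A * C - B\<^sup>2) / A\<close>.\<close>

lemma nn_integral_gauss2:
  fixes A B C d e c :: real
  assumes A: "A > 0" and D: "A * C - B\<^sup>2 > 0" and m: "m \<ge> 0"
  shows "(\<integral>\<^sup>+t. \<integral>\<^sup>+s. ennreal (m * exp (- (A * s\<^sup>2 + 2 * B * s * t + C * t\<^sup>2 + 2 * d * s + 2 * e * t + c))) \<partial>lborel \<partial>lborel) =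
    ennreal (m * (pi * (A * C - B\<^sup>2) powr (- 1 / 2) *
      exp ((C * d\<^sup>2 - 2 * B * d * e + A * e\<^sup>2) / (A * C - B\<^sup>2) - c)))"
proof -
  let ?D = "A * C - B\<^sup>2"
  have "(\<integral>\<^sup>+s. ennreal (m * exp (- (A * s\<^sup>2 + 2 * B * s * t + C * t\<^sup>2 + 2 * d * s + 2 * e * t + c))) \<partial>lborel) =
      ennreal (m * sqrt (pi / A) * exp (- (?D / A * t\<^sup>2 + 2 * (e - B * d / A) * t + (c - d\<^sup>2 / A))))" for t
  proof -
    have "(\<integral>\<^sup>+s. ennreal (m * exp (- (A * s\<^sup>2 + 2 * B * s * t + C * t\<^sup>2 + 2 * d * s + 2 * e * t + c))) \<partial>lborel) =
      (\<integral>\<^sup>+s. ennreal (m * exp (- (A * s\<^sup>2 + 2 * (B * t + d) * s + (C * t\<^sup>2 + 2 * e * t + c)))) \<partial>lborel)"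
      by (intro nn_integral_cong arg_cong[where f = ennreal] arg_cong2[where f = "(*)"] refl arg_cong[where f = exp])
         (simp add: algebra_simps)
    also have "\<dots> = ennreal (m * (sqrt (pi / A) * exp ((B * t + d)\<^sup>2 / A - (C * t\<^sup>2 + 2 * e * t + c))))"
      by (rule nn_integral_gauss[OF A m])
    also have "(B * t + d)\<^sup>2 / A - (C * t\<^sup>2 + 2 * e * t + c) = - (?D / A * t\<^sup>2 + 2 * (e - B * d / A) * t + (c - d\<^sup>2 / A))"
      using A by (simp add: field_simps power2_eq_square)
    finally show ?thesis by (simp add: mult.assoc)
  qed
  then have "(\<integral>\<^sup>+t. \<integral>\<^sup>+s. ennreal (m * exp (- (A * s\<^sup>2 + 2 * B * s * t + C * t\<^sup>2 + 2 * d * s + 2 * e * t + c))) \<partial>lborel \<partial>lborel) =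
      (\<integral>\<^sup>+t. ennreal (m * sqrt (pi / A) * exp (- (?D / A * t\<^sup>2 + 2 * (e - B * d / A) * t + (c - d\<^sup>2 / A)))) \<partial>lborel)"
    by simp
  also have "\<dots> = ennreal (m * sqrt (pi / A) * (sqrt (pi / (?D / A)) * exp ((e - B * d / A)\<^sup>2 / (?D / A) - (c - d\<^sup>2 / A))))"
    using A D m by (intro nn_integral_gauss) auto
  also have "(e - B * d / A)\<^sup>2 / (?D / A) - (c - d\<^sup>2 / A) = (C * d\<^sup>2 - 2 * B * d * e + A * e\<^sup>2) / ?D - c"
  proof -
    have "(e - B * d / A)\<^sup>2 = (A * e - B * d)\<^sup>2 / A\<^sup>2"
      using A by (simp add: power_divide[symmetric] diff_divide_distrib)
    then have "(e - B * d / A)\<^sup>2 / (?D / A) = (A * e - B * d)\<^sup>2 / (A * ?D)"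
      using A by (simp add: power2_eq_square)
    moreover have "d\<^sup>2 / A = d\<^sup>2 * ?D / (A * ?D)" using A D by simp
    moreover have "(A * e - B * d)\<^sup>2 + d\<^sup>2 * ?D = A * (C * d\<^sup>2 - 2 * B * d * e + A * e\<^sup>2)"
      by (simp add: algebra_simps power2_eq_square)
    ultimately have "(e - B * d / A)\<^sup>2 / (?D / A) + d\<^sup>2 / A = A * (C * d\<^sup>2 - 2 * B * d * e + A * e\<^sup>2) / (A * ?D)"
      by (metis add_divide_distrib)
    then show ?thesis using A by simp
  qed
  also have "m * sqrt (pi / A) * (sqrt (pi / (?D / A)) * X) = m * (sqrt (pi / A) * sqrt (pi / (?D / A)) * X)" for X
    by (simp only: mult.assoc)
  also have "sqrt (pi / A) * sqrt (pi / (?D / A)) = pi * ?D powr (- 1 / 2)"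
  proof -
    have "sqrt (pi / A) * sqrt (pi / (?D / A)) = sqrt (pi\<^sup>2 / ?D)"
      unfolding real_sqrt_mult[symmetric] using A by (simp add: power2_eq_square)
    also have "\<dots> = pi / sqrt ?D" by (simp add: real_sqrt_divide)
    also have "\<dots> = pi * ?D powr (- 1 / 2)" by (simp only: powr_neg_half[OF D] divide_inverse[of pi])
    finally show ?thesis .
  qed
  finally show ?thesis .
qed

lemma nn_integral_translate:
  fixes c :: real
  assumes [measurable]: "f \<in> borel_measurable borel"
  shows "(\<integral>\<^sup>+y. f (y - c) \<partial>lborel) = (\<integral>\<^sup>+y. f y \<partial>lborel)"
  using nn_integral_real_affine[OF assms, of 1 "- c", symmetric] by simp

section \<open>Lebesgue measure on edge functions\<close>

interpretation lb: product_sigma_finite "\<lambda>_. lborel :: real measure" ..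

abbreviation Leb :: "nat set set \<Rightarrow> (nat set \<Rightarrow> real) measure" where
  "Leb I \<equiv> PiM I (\<lambda>_. lborel)"

lemma nn_integral_Leb_translate:
  assumes "finite I" "f \<in> borel_measurable (Leb I)"
  shows "(\<integral>\<^sup>+x. f (\<lambda>e\<in>I. x e + c e) \<partial>Leb I) = (\<integral>\<^sup>+x. f x \<partial>Leb I)"
  using assms
proof (induction I arbitrary: f rule: finite_induct)
  case empty
  then show ?case by (simp add: PiM_empty nn_integral_count_space_finite restrict_def)
next
  case (insert i I)
  note [measurable] = insert.prems
  have [measurable]: "(\<lambda>x. f (\<lambda>e\<in>insert i I. x e + c e)) \<in> borel_measurable (Leb (insert i I))"
    by measurable
  have fm: "(\<lambda>x. f (x(i := y))) \<in> borel_measurable (Leb I)" for y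
    by measurable
  have "(\<integral>\<^sup>+x. f (\<lambda>e\<in>insert i I. x e + c e) \<partial>Leb (insert i I)) =
      (\<integral>\<^sup>+y. \<integral>\<^sup>+x. f (\<lambda>e\<in>insert i I. (x(i := y)) e + c e) \<partial>Leb I \<partial>lborel)"
    using insert.hyps by (intro lb.product_nn_integral_insert_rev) auto
  also have "\<dots> = (\<integral>\<^sup>+y. \<integral>\<^sup>+x. f ((\<lambda>e\<in>I. x e + c e)(i := y + c i)) \<partial>Leb I \<partial>lborel)"
    using insert.hyps by (intro nn_integral_cong arg_cong[where f = f]) (auto simp: restrict_def)
  also have "\<dots> = (\<integral>\<^sup>+y. \<integral>\<^sup>+x. f (x(i := y + c i)) \<partial>Leb I \<partial>lborel)"
    by (intro nn_integral_cong insert.IH[OF fm])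
  also have "\<dots> = (\<integral>\<^sup>+y. \<integral>\<^sup>+x. f (x(i := y)) \<partial>Leb I \<partial>lborel)"
  proof -
    interpret finite_product_sigma_finite "\<lambda>_. lborel :: real measure" I by standard fact
    have "(\<lambda>p. (snd p)(i := fst p)) \<in> measurable (borel \<Otimes>\<^sub>M Leb I) (Leb (insert i I))"
      by (rule measurable_fun_upd[where J = I]) auto
    from measurable_compose[OF this insert.prems]
    have "(\<lambda>(y, x). f (x(i := y))) \<in> borel_measurable (borel \<Otimes>\<^sub>M Leb I)"
      by (simp add: case_prod_beta')
    then have "(\<lambda>y. \<integral>\<^sup>+x. f (x(i := y)) \<partial>Leb I) \<in> borel_measurable borel"
      by (rule borel_measurable_nn_integral)
    from nn_integral_translate[OF this, of "- c i"] show ?thesis by simp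
  qed
  also have "\<dots> = (\<integral>\<^sup>+x. f x \<partial>Leb (insert i I))"
    using insert.hyps by (intro lb.product_nn_integral_insert_rev[symmetric]) auto
  finally show ?case .
qed

lemma nn_integral_Leb_insert2:
  assumes "finite I" "a \<notin> I" "b \<notin> I" "a \<noteq> b"
    and [measurable]: "f \<in> borel_measurable (Leb (insert a (insert b I)))"
  shows "integral\<^sup>N (Leb (insert a (insert b I))) f =
      (\<integral>\<^sup>+x. \<integral>\<^sup>+s. \<integral>\<^sup>+y. f (x(b := s, a := y)) \<partial>lborel \<partial>lborel \<partial>Leb I)" (is ?outer)
    and "integral\<^sup>N (Leb (insert a (insert b I))) f =
      (\<integral>\<^sup>+y. \<integral>\<^sup>+s. \<integral>\<^sup>+x. f (x(b := s, a := y)) \<partial>Leb I \<partial>lborel \<partial>lborel)" (is ?inner)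
proof -
  have "integral\<^sup>N (Leb (insert a (insert b I))) f = (\<integral>\<^sup>+x. \<integral>\<^sup>+y. f (x(a := y)) \<partial>lborel \<partial>Leb (insert b I))"
    using assms(1-4) by (intro lb.product_nn_integral_insert) auto
  also have "\<dots> = (\<integral>\<^sup>+x. \<integral>\<^sup>+s. \<integral>\<^sup>+y. f (x(b := s, a := y)) \<partial>lborel \<partial>lborel \<partial>Leb I)"
    using assms(1-4) by (intro lb.product_nn_integral_insert) auto
  finally show ?outer .
  have "integral\<^sup>N (Leb (insert a (insert b I))) f = (\<integral>\<^sup>+y. \<integral>\<^sup>+x. f (x(a := y)) \<partial>Leb (insert b I) \<partial>lborel)"
    using assms(1-4) by (intro lb.product_nn_integral_insert_rev) auto
  also have "\<dots> = (\<integral>\<^sup>+y. \<integral>\<^sup>+s. \<integral>\<^sup>+x. f (x(b := s, a := y)) \<partial>Leb I \<partial>lborel \<partial>lborel)"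
    using assms(1-4) by (intro nn_integral_cong lb.product_nn_integral_insert_rev) auto
  finally show ?inner .
qed

lemma nn_integral_Leb_insert3:
  assumes "finite I" "a \<notin> I" "b \<notin> I" "c \<notin> I" "a \<noteq> b" "a \<noteq> c" "b \<noteq> c"
    and [measurable]: "f \<in> borel_measurable (Leb (insert a (insert b (insert c I))))"
  shows "integral\<^sup>N (Leb (insert a (insert b (insert c I)))) f =
      (\<integral>\<^sup>+x. \<integral>\<^sup>+t. \<integral>\<^sup>+s. \<integral>\<^sup>+y. f (x(c := t, b := s, a := y)) \<partial>lborel \<partial>lborel \<partial>lborel \<partial>Leb I)" (is ?outer)
    and "integral\<^sup>N (Leb (insert a (insert b (insert c I)))) f =
      (\<integral>\<^sup>+y. \<integral>\<^sup>+s. \<integral>\<^sup>+t. \<integral>\<^sup>+x. f (x(c := t, b := s, a := y)) \<partial>Leb I \<partial>lborel \<partial>lborel \<partial>lborel)" (is ?inner)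
proof -
  have "integral\<^sup>N (Leb (insert a (insert b (insert c I)))) f =
      (\<integral>\<^sup>+x. \<integral>\<^sup>+s. \<integral>\<^sup>+y. f (x(b := s, a := y)) \<partial>lborel \<partial>lborel \<partial>Leb (insert c I))"
    using assms(1-7) by (intro nn_integral_Leb_insert2) auto
  also have "\<dots> = (\<integral>\<^sup>+x. \<integral>\<^sup>+t. \<integral>\<^sup>+s. \<integral>\<^sup>+y. f (x(c := t, b := s, a := y)) \<partial>lborel \<partial>lborel \<partial>lborel \<partial>Leb I)"
    using assms(1-7) by (intro lb.product_nn_integral_insert) auto
  finally show ?outer .
  have "integral\<^sup>N (Leb (insert a (insert b (insert c I)))) f =
      (\<integral>\<^sup>+y. \<integral>\<^sup>+s. \<integral>\<^sup>+x. f (x(b := s, a := y)) \<partial>Leb (insert c I) \<partial>lborel \<partial>lborel)"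
    using assms(1-7) by (intro nn_integral_Leb_insert2) auto
  also have "\<dots> = (\<integral>\<^sup>+y. \<integral>\<^sup>+s. \<integral>\<^sup>+t. \<integral>\<^sup>+x. f (x(c := t, b := s, a := y)) \<partial>Leb I \<partial>lborel \<partial>lborel \<partial>lborel)"
    using assms(1-7) by (intro nn_integral_cong lb.product_nn_integral_insert_rev) auto
  finally show ?inner .
qed

section \<open>The densities as products over the vertices\<close>

text \<open>\<open>weight_Q\<close> and \<open>weight_P\<close> are the integrands of the two Wishart integrals in the coordinates of the
  edges, including the reference measure and the indicator of the cone. The factor of a leaf in
  \<open>weight_Q\<close> involves no other entries than those of its family, while \<open>weight_P\<close> evaluates the
  remaining factors at the Schur complement.\<close>

definition leaf_Q :: "real \<Rightarrow> nat \<Rightarrow> nat list \<Rightarrow> (nat set \<Rightarrow> real) \<Rightarrow> (nat set \<Rightarrow> real) \<Rightarrow> real" where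
  "leaf_Q a v N k g = (if pvar v N g > 0
     then exp (- leaf_form v N k g) * pvar v N g powr (a - real (length N) / 2 - 1) * pdet N g powr (- 1 / 2)
     else 0)"

fun weight_Q :: "(nat \<Rightarrow> real) \<Rightarrow> scheme \<Rightarrow> (nat set \<Rightarrow> real) \<Rightarrow> (nat set \<Rightarrow> real) \<Rightarrow> real" where
  "weight_Q a [] U g = 1"
| "weight_Q a ((v, N) # L) U g = weight_Q a L U g * leaf_Q (a v) v N (precision ((v, N) # L) U) g"

definition leaf_P :: "real \<Rightarrow> nat \<Rightarrow> nat list \<Rightarrow> (nat set \<Rightarrow> real) \<Rightarrow> (nat set \<Rightarrow> real) \<Rightarrow> real" where
  "leaf_P a v N U x = (if x {v} > 0
     then exp (- leaf_form v N x U) * x {v} powr (- a - real (length N) / 2 - 1) else 0)"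

fun weight_P :: "(nat \<Rightarrow> real) \<Rightarrow> scheme \<Rightarrow> (nat set \<Rightarrow> real) \<Rightarrow> (nat set \<Rightarrow> real) \<Rightarrow> real" where
  "weight_P a [] U x = 1"
| "weight_P a ((v, N) # L) U x = weight_P a L U (schur v N x) * leaf_P (a v) v N U x"

lemma leaf_Q_nonneg: "leaf_Q a v N k g \<ge> 0" by (simp add: leaf_Q_def)
lemma leaf_P_nonneg: "leaf_P a v N k g \<ge> 0" by (simp add: leaf_P_def)
lemma weight_Q_nonneg: "weight_Q a L U g \<ge> 0" by (induction L) (auto simp: leaf_Q_nonneg)

section \<open>Integrating out one leaf\<close>

lemma nn_integral_shifted_gamma:
  assumes "z > 0" "k > 0" "m \<ge> 0" "D \<ge> 0"
  shows "(\<integral>\<^sup>+y. ennreal (m * (if y - q > 0 then exp (- (k * y + c)) * (y - q) powr (z - 1) * D else 0)) \<partial>lborel) =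
    ennreal (m * D * (Gamma z * k powr (- z)) * exp (- (k * q + c)))"
proof -
  let ?M = "m * D * exp (- (k * q + c))"
  let ?f = "\<lambda>y. ennreal (if y > 0 then ?M * exp (- (k * y)) * y powr (z - 1) else 0)"
  have "exp (- (k * y + c)) = exp (- (k * q + c)) * exp (- (k * (y - q)))" for y
    unfolding exp_add[symmetric] by (simp add: algebra_simps)
  then have "(\<integral>\<^sup>+y. ennreal (m * (if y - q > 0 then exp (- (k * y + c)) * (y - q) powr (z - 1) * D else 0)) \<partial>lborel) =
    (\<integral>\<^sup>+y. ?f (y - q) \<partial>lborel)"
    by (intro nn_integral_cong) (simp add: mult_ac)
  also have "\<dots> = (\<integral>\<^sup>+y. ?f y \<partial>lborel)"
    by (rule nn_integral_translate) measurable
  also have "\<dots> = ennreal (?M * (Gamma z * k powr (- z)))"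
    using assms by (intro nn_integral_gamma) simp_all
  finally show ?thesis by (simp add: mult_ac)
qed

lemma sqrt_pi_quotient:
  fixes k p :: real
  assumes "k > 0" "p > 0"
  shows "sqrt (pi / (k / p)) = pi powr (1 / 2) * k powr (- 1 / 2) / p powr (- 1 / 2)"
    and "sqrt (pi / (k / p)) = pi powr (1 / 2) * k powr (- 1 / 2) * p powr (1 / 2)"
  unfolding powr_neg_half[OF assms(1)] powr_neg_half[OF assms(2)]
  using assms by (simp_all add: powr_half_sqrt real_sqrt_divide real_sqrt_mult field_simps)

lemma quotient_square_powr:
  fixes k D :: real
  assumes "k > 0" "D > 0"
  shows "(k\<^sup>2 / D) powr (- 1 / 2) = inverse k / D powr (- 1 / 2)"
    and "(D / k\<^sup>2) powr (- 1 / 2) = D powr (- 1 / 2) * k"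
proof -
  have "k\<^sup>2 / D > 0" "D / k\<^sup>2 > 0" using assms by simp_all
  note * = powr_neg_half[OF this(1)] powr_neg_half[OF this(2)] powr_neg_half[OF assms(2)]
  show "(k\<^sup>2 / D) powr (- 1 / 2) = inverse k / D powr (- 1 / 2)"
    "(D / k\<^sup>2) powr (- 1 / 2) = D powr (- 1 / 2) * k"
    unfolding * using assms by (simp_all add: real_sqrt_divide field_simps)
qed

text \<open>One parent with variance \<open>p\<close>; \<open>y\<close> is the variance of the leaf and \<open>s\<close> its covariance with the parent.
  The integral over \<open>y\<close> is a Gamma integral in the residual variance, the one over \<open>s\<close> is Gaussian
  with determinant \<open>k / p\<close>, and its power of \<open>p\<close> cancels the factor \<open>p powr (- 1 / 2)\<close>. The linear
  term \<open>d\<close> disappears because the exponent is a complete square.\<close>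

lemma nn_integral_leaf_Q1:
  assumes a: "a - 1 / 2 > 0" and k: "k > 0" and p: "p > 0" and m: "m \<ge> 0"
  shows "(\<integral>\<^sup>+s. \<integral>\<^sup>+y. ennreal (m * (if y - s\<^sup>2 / p > 0
       then exp (- (k * y + (2 * d * s + d\<^sup>2 * p / k))) * (y - s\<^sup>2 / p) powr (a - 1 / 2 - 1) * p powr (- 1 / 2)
       else 0)) \<partial>lborel \<partial>lborel) =
    ennreal (m * (pi powr (1 / 2) * Gamma (a - 1 / 2) * k powr (- a)))" (is "?lhs = _")
proof -
  let ?G = "Gamma (a - 1 / 2) * k powr (- (a - 1 / 2))"
  have G: "?G \<ge> 0" using Gamma_real_pos[OF a] by simp
  have "?lhs =
    (\<integral>\<^sup>+s. ennreal (m * p powr (- 1 / 2) * ?G * exp (- (k / p * s\<^sup>2 + 2 * d * s + d\<^sup>2 * p / k))) \<partial>lborel)"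
    using a k m by (subst nn_integral_shifted_gamma) (auto simp: add.assoc)
  also have "\<dots> = ennreal (m * p powr (- 1 / 2) * ?G * (sqrt (pi / (k / p)) * exp (d\<^sup>2 / (k / p) - d\<^sup>2 * p / k)))"
    using m G k p by (intro nn_integral_gauss) (auto intro!: mult_nonneg_nonneg)
  also have "exp (d\<^sup>2 / (k / p) - d\<^sup>2 * p / k) = 1" by simp
  also have "sqrt (pi / (k / p)) = pi powr (1 / 2) * k powr (- 1 / 2) / p powr (- 1 / 2)"
    by (rule sqrt_pi_quotient(1)[OF k p])
  also have "k powr (- (a - 1 / 2)) = k powr (- a) / k powr (- 1 / 2)"
    unfolding powr_diff[symmetric] by simp
  finally show ?thesis using k p by (simp add: mult_ac)
qed

text \<open>The same with two parents, whose covariance matrix has the entries \<open>p\<close>, \<open>q\<close>, \<open>r\<close>.\<close>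

lemma nn_integral_leaf_Q2:
  assumes a: "a - 1 > 0" and k: "k > 0" and p: "p > 0" and D: "p * r - q\<^sup>2 > 0" and m: "m \<ge> 0"
  shows "(\<integral>\<^sup>+t. \<integral>\<^sup>+s. \<integral>\<^sup>+y. ennreal (m * (if y - (r * s\<^sup>2 - 2 * q * s * t + p * t\<^sup>2) / (p * r - q\<^sup>2) > 0
       then exp (- (k * y + (2 * d * s + 2 * e * t + (d\<^sup>2 * p + 2 * d * e * q + e\<^sup>2 * r) / k))) *
          (y - (r * s\<^sup>2 - 2 * q * s * t + p * t\<^sup>2) / (p * r - q\<^sup>2)) powr (a - 1 - 1) * (p * r - q\<^sup>2) powr (- 1 / 2)
       else 0)) \<partial>lborel \<partial>lborel \<partial>lborel) =
    ennreal (m * (pi * Gamma (a - 1) * k powr (- a)))" (is "?lhs = _")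
proof -
  let ?D = "p * r - q\<^sup>2"
  let ?G = "Gamma (a - 1) * k powr (- (a - 1))"
  let ?c = "(d\<^sup>2 * p + 2 * d * e * q + e\<^sup>2 * r) / k"
  have G: "?G \<ge> 0" using Gamma_real_pos[OF a] by simp
  have r: "r > 0"
  proof -
    have "p * r > 0" using D zero_le_power2[of q] by linarith
    then show ?thesis using p by (simp add: zero_less_mult_iff)
  qed
  have AC: "(k * r / ?D) * (k * p / ?D) - (- k * q / ?D)\<^sup>2 = k\<^sup>2 / ?D"
  proof -
    have "(k * r / ?D) * (k * p / ?D) - (- k * q / ?D)\<^sup>2 = k\<^sup>2 * ?D / (?D * ?D)"
      by (simp add: power2_eq_square algebra_simps diff_divide_distrib)
    then show ?thesis using D by simp
  qed
  have eq: "m * ?D powr (- 1 / 2) * ?G * exp (- (k * ((r * s\<^sup>2 - 2 * q * s * t + p * t\<^sup>2) / ?D) + (2 * d * s + 2 * e * t + ?c))) =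
      m * ?D powr (- 1 / 2) * ?G *
      exp (- ((k * r / ?D) * s\<^sup>2 + 2 * (- k * q / ?D) * s * t + (k * p / ?D) * t\<^sup>2 + 2 * d * s + 2 * e * t + ?c))" for s t
    by (intro arg_cong2[where f = "(*)"] arg_cong[where f = exp] refl)
       (simp add: diff_divide_distrib add_divide_distrib algebra_simps)
  have "?lhs = (\<integral>\<^sup>+t. \<integral>\<^sup>+s. ennreal (m * ?D powr (- 1 / 2) * ?G *
      exp (- ((k * r / ?D) * s\<^sup>2 + 2 * (- k * q / ?D) * s * t + (k * p / ?D) * t\<^sup>2 + 2 * d * s + 2 * e * t + ?c))) \<partial>lborel \<partial>lborel)"
    using a k m unfolding eq[symmetric] by (subst nn_integral_shifted_gamma) auto
  also have "\<dots> = ennreal (m * ?D powr (- 1 / 2) * ?G * (pi * (k\<^sup>2 / ?D) powr (- 1 / 2) *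
      exp (((k * p / ?D) * d\<^sup>2 - 2 * (- k * q / ?D) * d * e + (k * r / ?D) * e\<^sup>2) / (k\<^sup>2 / ?D) - ?c)))"
    unfolding AC[symmetric] using m G k r D AC by (intro nn_integral_gauss2) (auto intro!: mult_nonneg_nonneg)
  also have "((k * p / ?D) * d\<^sup>2 - 2 * (- k * q / ?D) * d * e + (k * r / ?D) * e\<^sup>2) / (k\<^sup>2 / ?D) = ?c"
  proof -
    have "(k * p / ?D) * d\<^sup>2 - 2 * (- k * q / ?D) * d * e + (k * r / ?D) * e\<^sup>2 =
        k * (d\<^sup>2 * p + 2 * d * e * q + e\<^sup>2 * r) / ?D"
      by (simp add: add_divide_distrib algebra_simps)
    then show ?thesis using k D by (simp add: power2_eq_square)
  qed
  also have "(k\<^sup>2 / ?D) powr (- 1 / 2) = inverse k / ?D powr (- 1 / 2)"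
    by (rule quotient_square_powr(1)[OF k D])
  also have "k powr (- (a - 1)) = k powr (- a) * k"
    using k powr_add[of k "- a" 1] by simp
  also have "m * ?D powr (- 1 / 2) * (Gamma (a - 1) * (k powr (- a) * k)) *
      (pi * (inverse k / ?D powr (- 1 / 2)) * exp (?c - ?c)) = m * (pi * Gamma (a - 1) * k powr (- a))"
    using k D by (simp add: field_simps)
  finally show ?thesis .
qed

text \<open>Here \<open>y\<close> and \<open>s\<close> are precision entries and \<open>h\<close>, \<open>d\<close>, \<open>p\<close> those of the scale matrix. For fixed \<open>y\<close> the
  integral over \<open>s\<close> is Gaussian and turns the rate \<open>h\<close> into the residual variance of the scale matrix,
  which is then the rate of a Gamma integral over \<open>y\<close>.\<close>

lemma nn_integral_leaf_P1:
  assumes a: "- a > 0" and p: "p > 0" and S: "h - d * d / p > 0" and m: "m \<ge> 0"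
  shows "(\<integral>\<^sup>+y. \<integral>\<^sup>+s. ennreal (m * (if y > 0
       then exp (- (y * h + 2 * (s * d) + s * s * p / y)) * y powr (- a - 1 / 2 - 1) else 0)) \<partial>lborel \<partial>lborel) =
    ennreal (m * (pi powr (1 / 2) * Gamma (- a) * (h - d * d / p) powr a * p powr (- 1 / 2)))"
proof -
  let ?f = "\<lambda>y s. ennreal (m * (if y > 0
       then exp (- (y * h + 2 * (s * d) + s * s * p / y)) * y powr (- a - 1 / 2 - 1) else 0))"
  have "(\<integral>\<^sup>+s. ?f y s \<partial>lborel) =
    ennreal (if y > 0 then (m * (pi powr (1 / 2) * p powr (- 1 / 2))) * exp (- ((h - d * d / p) * y)) * y powr (- a - 1) else 0)" for y
  proof (cases "y > 0")
    case True
    have "(\<integral>\<^sup>+s. ?f y s \<partial>lborel) =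
      (\<integral>\<^sup>+s. ennreal ((m * y powr (- a - 1 / 2 - 1)) * exp (- (p / y * s\<^sup>2 + 2 * d * s + y * h))) \<partial>lborel)"
      using True by (intro nn_integral_cong) (simp add: power2_eq_square algebra_simps)
    also have "\<dots> = ennreal ((m * y powr (- a - 1 / 2 - 1)) * (sqrt (pi / (p / y)) * exp (d\<^sup>2 / (p / y) - y * h)))"
      using True m p by (intro nn_integral_gauss) auto
    also have "d\<^sup>2 / (p / y) - y * h = - ((h - d * d / p) * y)"
      using p True by (simp add: power2_eq_square field_simps)
    also have "sqrt (pi / (p / y)) = pi powr (1 / 2) * p powr (- 1 / 2) * y powr (1 / 2)"
      by (rule sqrt_pi_quotient(2)[OF p True])
    finally have *: "(\<integral>\<^sup>+s. ?f y s \<partial>lborel) =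
      ennreal (m * y powr (- a - 1 / 2 - 1) * (pi powr (1 / 2) * p powr (- 1 / 2) * y powr (1 / 2) *
        exp (- ((h - d * d / p) * y))))" .
    have "y powr (- a - 1) = y powr (- a - 1 / 2 - 1) * y powr (1 / 2)"
      unfolding powr_add[symmetric] by (rule arg_cong) simp
    then show ?thesis using True unfolding * by (simp only: if_True mult_ac)
  qed simp
  moreover have "m * (pi powr (1 / 2) * p powr (- 1 / 2)) \<ge> 0" using m by simp
  ultimately show ?thesis using nn_integral_gamma[OF a S, of "m * (pi powr (1 / 2) * p powr (- 1 / 2))"]
    by (simp add: mult_ac)
qed

text \<open>The same with two parents, whose block of the scale matrix has the entries \<open>p\<close>, \<open>q\<close>, \<open>r\<close>.\<close>

lemma nn_integral_leaf_P2:
  assumes a: "- a > 0" and p: "p > 0" and D: "p * r - q\<^sup>2 > 0"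
    and S: "h - (r * d\<^sup>2 - 2 * q * d * e + p * e\<^sup>2) / (p * r - q\<^sup>2) > 0" and m: "m \<ge> 0"
  shows "(\<integral>\<^sup>+y. \<integral>\<^sup>+s. \<integral>\<^sup>+t. ennreal (m * (if y > 0
       then exp (- (y * h + 2 * (s * d + t * e) + (s * s * p + 2 * s * t * q + t * t * r) / y)) *
         y powr (- a - 1 - 1) else 0)) \<partial>lborel \<partial>lborel \<partial>lborel) =
    ennreal (m * (pi * Gamma (- a) * (h - (r * d\<^sup>2 - 2 * q * d * e + p * e\<^sup>2) / (p * r - q\<^sup>2)) powr a *
      (p * r - q\<^sup>2) powr (- 1 / 2)))"
proof -
  let ?f = "\<lambda>y s t. ennreal (m * (if y > 0
       then exp (- (y * h + 2 * (s * d + t * e) + (s * s * p + 2 * s * t * q + t * t * r) / y)) *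
         y powr (- a - 1 - 1) else 0))"
  let ?D = "p * r - q\<^sup>2"
  let ?S = "h - (r * d\<^sup>2 - 2 * q * d * e + p * e\<^sup>2) / ?D"
  have r: "r > 0"
  proof -
    have "p * r > 0" using D zero_le_power2[of q] by linarith
    then show ?thesis using p by (simp add: zero_less_mult_iff)
  qed
  have "(\<integral>\<^sup>+s. \<integral>\<^sup>+t. ?f y s t \<partial>lborel \<partial>lborel) =
    ennreal (if y > 0 then (m * (pi * ?D powr (- 1 / 2))) * exp (- (?S * y)) * y powr (- a - 1) else 0)" for y
  proof (cases "y > 0")
    case True
    have AC: "(r / y) * (p / y) - (q / y)\<^sup>2 = ?D / y\<^sup>2"
      by (simp add: power2_eq_square diff_divide_distrib mult_ac)
    have "(\<integral>\<^sup>+s. \<integral>\<^sup>+t. ?f y s t \<partial>lborel \<partial>lborel) =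
      (\<integral>\<^sup>+s. \<integral>\<^sup>+t. ennreal ((m * y powr (- a - 1 - 1)) * exp (- ((r / y) * t\<^sup>2 + 2 * (q / y) * t * s + (p / y) * s\<^sup>2 +
         2 * e * t + 2 * d * s + y * h))) \<partial>lborel \<partial>lborel)"
      using True by (intro nn_integral_cong) (simp add: power2_eq_square algebra_simps add_divide_distrib)
    also have "\<dots> = ennreal ((m * y powr (- a - 1 - 1)) * (pi * (?D / y\<^sup>2) powr (- 1 / 2) *
        exp (((p / y) * e\<^sup>2 - 2 * (q / y) * e * d + (r / y) * d\<^sup>2) / (?D / y\<^sup>2) - y * h)))"
      unfolding AC[symmetric] using m r D True AC by (intro nn_integral_gauss2) auto
    also have "((p / y) * e\<^sup>2 - 2 * (q / y) * e * d + (r / y) * d\<^sup>2) / (?D / y\<^sup>2) - y * h = - (?S * y)"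
    proof -
      have "(p / y) * e\<^sup>2 - 2 * (q / y) * e * d + (r / y) * d\<^sup>2 = (r * d\<^sup>2 - 2 * q * d * e + p * e\<^sup>2) / y"
        by (simp add: add_divide_distrib diff_divide_distrib algebra_simps)
      then have "((p / y) * e\<^sup>2 - 2 * (q / y) * e * d + (r / y) * d\<^sup>2) / (?D / y\<^sup>2) =
          (r * d\<^sup>2 - 2 * q * d * e + p * e\<^sup>2) / ?D * y"
        using True by (simp add: power2_eq_square)
      then show ?thesis by (simp add: algebra_simps)
    qed
    also have "(?D / y\<^sup>2) powr (- 1 / 2) = ?D powr (- 1 / 2) * y"
      by (rule quotient_square_powr(2)[OF True D])
    finally have *: "(\<integral>\<^sup>+s. \<integral>\<^sup>+t. ?f y s t \<partial>lborel \<partial>lborel) =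
      ennreal (m * y powr (- a - 1 - 1) * (pi * (?D powr (- 1 / 2) * y) * exp (- (?S * y))))" .
    have "y powr (- a - 1 - 1) = y powr (- a - 1) / y"
      using True powr_diff[of y "- a - 1" 1] by simp
    then show ?thesis unfolding * using True by (simp add: mult_ac)
  qed simp
  moreover have "m * (pi * ?D powr (- 1 / 2)) \<ge> 0" using m by simp
  ultimately show ?thesis using nn_integral_gamma[OF a S, of "m * (pi * ?D powr (- 1 / 2))"]
    by (simp add: mult_ac)
qed

section \<open>The Wishart integrals along a scheme\<close>

lemma scheme_Cons_cases [consumes 1, case_names root one two]:
  assumes "scheme ((v, N) # L)"
  obtains "N = []"
  | u where "N = [u]" "u \<noteq> v" "{u} \<in> dedges L"
  | u w where "N = [u, w]" "u \<noteq> v" "w \<noteq> v" "u \<noteq> w" "{u} \<in> dedges L" "{w} \<in> dedges L" "{u, w} \<in> dedges L"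
proof -
  have "length N \<le> 2" "distinct N" using assms by auto
  then show ?thesis
  proof (cases rule: parent_list_cases)
    case (3 u w)
    then show ?thesis using that(3)[of u w] assms loop_in_dedges[of u L] loop_in_dedges[of w L] by auto
  qed (use that assms loop_in_dedges in auto)
qed

lemma measurable_pvar:
  assumes "scheme ((v, N) # L)" "\<And>e. e \<in> dedges ((v, N) # L) \<Longrightarrow> (\<lambda>z. F z e) \<in> borel_measurable M"
  shows "(\<lambda>z. pvar v N (F z)) \<in> borel_measurable M"
    and "(\<lambda>z. pdet N (F z)) \<in> borel_measurable M"
    and "(\<lambda>z. leaf_form v N k (F z)) \<in> borel_measurable M"
    and "(\<lambda>z. leaf_form v N (F z) k) \<in> borel_measurable M"
proof -
  have [measurable]: "(\<lambda>z. F z {v}) \<in> borel_measurable M" using assms(2) by (auto simp: star_def)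
  have "(\<lambda>z. pvar v N (F z)) \<in> borel_measurable M \<and> (\<lambda>z. pdet N (F z)) \<in> borel_measurable M \<and>
    (\<lambda>z. leaf_form v N k (F z)) \<in> borel_measurable M \<and> (\<lambda>z. leaf_form v N (F z) k) \<in> borel_measurable M"
    using assms(1)
  proof (cases rule: scheme_Cons_cases)
    case root
    show ?thesis unfolding root pvar_def leaf_form_def by simp
  next
    case (one u)
    have [measurable]: "(\<lambda>z. F z {v, u}) \<in> borel_measurable M" "(\<lambda>z. F z {u}) \<in> borel_measurable M"
      using assms(2) one by (auto simp: star_def)
    show ?thesis unfolding one pvar_def leaf_form_def by simp
  next
    case (two u w)
    have [measurable]: "(\<lambda>z. F z {v, u}) \<in> borel_measurable M" "(\<lambda>z. F z {u}) \<in> borel_measurable M"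
      "(\<lambda>z. F z {v, w}) \<in> borel_measurable M" "(\<lambda>z. F z {w}) \<in> borel_measurable M"
      "(\<lambda>z. F z {u, w}) \<in> borel_measurable M"
      using assms(2) two by (auto simp: star_def)
    have c: "{w, u} = {u, w}" by blast
    show ?thesis unfolding two(1) pvar_def leaf_form_def using two(4) by (simp add: c)
  qed
  then show "(\<lambda>z. pvar v N (F z)) \<in> borel_measurable M"
    and "(\<lambda>z. pdet N (F z)) \<in> borel_measurable M"
    and "(\<lambda>z. leaf_form v N k (F z)) \<in> borel_measurable M"
    and "(\<lambda>z. leaf_form v N (F z) k) \<in> borel_measurable M" by blast+
qed

lemma measurable_weight_Q:
  assumes "scheme L" "\<And>e. e \<in> dedges L \<Longrightarrow> (\<lambda>z. F z e) \<in> borel_measurable M"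
  shows "(\<lambda>z. weight_Q a L U (F z)) \<in> borel_measurable M"
  using assms
proof (induction L)
  case (Cons x L)
  obtain v N where x: "x = (v, N)" by (cases x)
  note [measurable] = measurable_pvar[OF Cons.prems[unfolded x]]
  have [measurable]: "(\<lambda>z. weight_Q a L U (F z)) \<in> borel_measurable M"
    using Cons x by auto
  show ?case unfolding x weight_Q.simps leaf_Q_def by measurable
qed simp

lemma measurable_schur:
  assumes "scheme ((v, N) # L)" "\<And>e. e \<in> dedges ((v, N) # L) \<Longrightarrow> (\<lambda>z. F z e) \<in> borel_measurable M"
    and e: "e \<in> dedges L"
  shows "(\<lambda>z. schur v N (F z) e) \<in> borel_measurable M"
proof -
  have [measurable]: "(\<lambda>z. F z {v}) \<in> borel_measurable M" "(\<lambda>z. F z e) \<in> borel_measurable M"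
    using assms(2) e by (auto simp: star_def)
  show ?thesis
  proof (cases "e \<subseteq> set N")
    case True
    have "finite e" "e \<noteq> {}" using dedges_subset[of L e] e assms(1) finite_subset[OF True] by auto
    then have "Min e \<in> set N" "Max e \<in> set N" using True by (auto intro: Min_in Max_in)
    then have [measurable]: "(\<lambda>z. F z {v, Min e}) \<in> borel_measurable M" "(\<lambda>z. F z {v, Max e}) \<in> borel_measurable M"
      using assms(2) by (auto simp: star_def)
    show ?thesis using True by (simp add: schur_def)
  qed (simp add: schur_def)
qed

lemma measurable_weight_P:
  assumes "scheme L" "\<And>e. e \<in> dedges L \<Longrightarrow> (\<lambda>z. F z e) \<in> borel_measurable M"
  shows "(\<lambda>z. weight_P a L U (F z)) \<in> borel_measurable M"
  using assms
proof (induction L arbitrary: F)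
  case (Cons x L)
  obtain v N where x: "x = (v, N)" by (cases x)
  note [measurable] = measurable_pvar[OF Cons.prems[unfolded x]]
  have [measurable]: "(\<lambda>z. F z {v}) \<in> borel_measurable M" using Cons.prems x by (auto simp: star_def)
  have [measurable]: "(\<lambda>z. weight_P a L U (schur v N (F z))) \<in> borel_measurable M"
    using Cons.prems x by (intro Cons.IH measurable_schur[of v N L]) auto
  show ?case unfolding x weight_P.simps leaf_P_def by measurable
qed simp

lemma pvar_cong:
  assumes "scheme ((v, N) # L)" "\<And>e. e \<in> dedges ((v, N) # L) \<Longrightarrow> g e = h e"
  shows "pvar v N g = pvar v N h" "pdet N g = pdet N h" "leaf_form v N k g = leaf_form v N k h"
    "leaf_form v N g k = leaf_form v N h k" "coef N g v i = coef N h v i"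
proof -
  have "pvar v N g = pvar v N h \<and> pdet N g = pdet N h \<and> leaf_form v N k g = leaf_form v N k h \<and>
    leaf_form v N g k = leaf_form v N h k \<and> coef N g v i = coef N h v i"
    using assms(1)
  proof (cases rule: scheme_Cons_cases)
    case root
    then show ?thesis using assms(2)[of "{v}"] by (simp add: pvar_def leaf_form_def star_def)
  next
    case (one u)
    then show ?thesis using assms(2)[of "{v}"] assms(2)[of "{u}"] assms(2)[of "{v, u}"]
      by (simp add: pvar_def leaf_form_def star_def)
  next
    case (two u w)
    have c: "{w, u} = {u, w}" by blast
    show ?thesis using two assms(2)[of "{v}"] assms(2)[of "{u}"] assms(2)[of "{v, u}"]
       assms(2)[of "{w}"] assms(2)[of "{v, w}"] assms(2)[of "{u, w}"]
      by (simp add: pvar_def leaf_form_def star_def c)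
  qed
  then show "pvar v N g = pvar v N h" "pdet N g = pdet N h" "leaf_form v N k g = leaf_form v N k h"
    "leaf_form v N g k = leaf_form v N h k" "coef N g v i = coef N h v i" by blast+
qed

lemma weight_Q_cong: "scheme L \<Longrightarrow> (\<And>e. e \<in> dedges L \<Longrightarrow> g e = h e) \<Longrightarrow> weight_Q a L U g = weight_Q a L U h"
proof (induction L)
  case (Cons x L)
  obtain v N where x: "x = (v, N)" by (cases x)
  have "weight_Q a L U g = weight_Q a L U h" using Cons x by auto
  then show ?case unfolding x using pvar_cong(1-3)[OF Cons.prems[unfolded x]]
    by (simp add: leaf_Q_def del: precision.simps)
qed simp

lemma weight_P_cong: "scheme L \<Longrightarrow> (\<And>e. e \<in> dedges L \<Longrightarrow> x e = y e) \<Longrightarrow> weight_P a L U x = weight_P a L U y"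
proof (induction L arbitrary: x y)
  case (Cons p L)
  obtain v N where p: "p = (v, N)" by (cases p)
  have "weight_P a L U (schur v N x) = weight_P a L U (schur v N y)"
    using Cons.prems p by (intro Cons.IH schur_cong[of v N L]) auto
  moreover have "x {v} = y {v}" using Cons.prems p by (auto simp: star_def)
  ultimately show ?case unfolding p using pvar_cong(4)[where k = U, OF Cons.prems[unfolded p]]
    by (simp add: leaf_P_def)
qed simp

lemma weight_Q_pos_in_Q: "weight_Q a L U g \<noteq> 0 \<Longrightarrow> in_Q L g"
  by (induction L rule: dedges.induct) (auto simp: leaf_Q_def split: if_splits)

lemma weight_P_pos_in_P: "weight_P a L U x \<noteq> 0 \<Longrightarrow> in_P L x"
  by (induction L arbitrary: x rule: dedges.induct) (auto simp: leaf_P_def split: if_splits)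

definition const_Q :: "real \<Rightarrow> nat list \<Rightarrow> real" where
  "const_Q a N = pi powr (real (length N) / 2) * Gamma (a - real (length N) / 2)"

definition const_P :: "real \<Rightarrow> nat list \<Rightarrow> real" where
  "const_P a N = pi powr (real (length N) / 2) * Gamma (- a)"

lemma dedges_star_eqs:
  "dedges ((v, []) # L) = insert {v} (dedges L)"
  "dedges ((v, [u]) # L) = insert {v} (insert {v, u} (dedges L))"
  "dedges ((v, [u, w]) # L) = insert {v} (insert {v, u} (insert {v, w} (dedges L)))"
  by (auto simp: star_def)

lemma not_in_dedges: "scheme ((v, N) # L) \<Longrightarrow> {v} \<notin> dedges L \<and> {v, u} \<notin> dedges L"
  using dedges_subset[of L "{v}"] dedges_subset[of L "{v, u}"] by auto

lemma component_measurable: "e \<in> I \<Longrightarrow> (\<lambda>x. x e) \<in> borel_measurable (Leb I)"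
  using measurable_component_singleton[of e I "\<lambda>_. lborel"] by simp

text \<open>Integrating the entries of the leaf first gives a constant that does not depend on the other
  entries: the powers of the parental determinant from the Gaussian integral and from the weight
  cancel. Hence the integral is a product over the vertices.\<close>

theorem nn_integral_weight_Q:
  assumes "scheme L" "in_Q L U" "\<And>v N. (v, N) \<in> set L \<Longrightarrow> a v > real (length N) / 2"
  shows "(\<integral>\<^sup>+g. ennreal (weight_Q a L U g) \<partial>Leb (dedges L)) =
    ennreal (\<Prod>(v, N)\<leftarrow>L. const_Q (a v) N * pvar v N U powr a v)"
  using assms
proof (induction L)
  case Nil
  then show ?case by (simp add: PiM_empty nn_integral_count_space_finite)
next
  case (Cons x L)
  obtain v N where x: "x = (v, N)" by (cases x)
  have sch: "scheme ((v, N) # L)" and sL: "scheme L" using Cons.prems x by auto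
  have q: "pvar v N U > 0" "in_Q L U" and av: "a v - real (length N) / 2 > 0" using Cons.prems x by auto
  note IH = Cons.IH[OF sL q(2) Cons.prems(3)]
  define k where "k = precision ((v, N) # L) U"
  define c where "c = const_Q (a v) N * pvar v N U powr a v"
  have kv: "k {v} > 0" "k {v} powr (- a v) = pvar v N U powr a v"
    using precision_Cons(1)[OF sch, of U] q by (simp_all add: k_def powr_minus powr_divide del: precision.simps)
  have c0: "c \<ge> 0" using Gamma_real_pos[OF av] by (simp add: c_def const_Q_def)
  let ?f = "\<lambda>g. ennreal (weight_Q a L U g * leaf_Q (a v) v N k g)"
  have fm: "?f \<in> borel_measurable (Leb (dedges ((v, N) # L)))"
    using measurable_weight_Q[where a = a and U = U, OF sch component_measurable] by (simp add: k_def)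
  note no = not_in_dedges[OF sch]
  \<comment> \<open>A nonzero weight certifies that the block of the parents is positive definite.\<close>
  have pd: "weight_Q a L U g \<noteq> 0 \<Longrightarrow> pd_on (set N) g" for g
    using in_Q_pd_on[OF sch weight_Q_pos_in_Q] by blast
  have m0: "weight_Q a L U g \<ge> 0" for g by (rule weight_Q_nonneg)
  have "integral\<^sup>N (Leb (dedges ((v, N) # L))) ?f = (\<integral>\<^sup>+g. ennreal (weight_Q a L U g * c) \<partial>Leb (dedges L))"
    using sch
  proof (cases rule: scheme_Cons_cases)
    case root
    have w: "weight_Q a L U (g({v} := y)) = weight_Q a L U g" for g y
      using no by (intro weight_Q_cong[OF sL]) auto
    have "integral\<^sup>N (Leb (dedges ((v, N) # L))) ?f = (\<integral>\<^sup>+g. \<integral>\<^sup>+y. ?f (g({v} := y)) \<partial>lborel \<partial>Leb (dedges L))"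
      using fm no unfolding root dedges_star_eqs by (intro lb.product_nn_integral_insert) auto
    also have "\<dots> = (\<integral>\<^sup>+g. ennreal (weight_Q a L U g * c) \<partial>Leb (dedges L))"
    proof (intro nn_integral_cong)
      fix g
      have "(\<integral>\<^sup>+y. ?f (g({v} := y)) \<partial>lborel) =
        (\<integral>\<^sup>+y. ennreal (weight_Q a L U g * (if y - 0 > 0 then exp (- (k {v} * y + 0)) * (y - 0) powr (a v - 1) * 1 else 0)) \<partial>lborel)"
        unfolding w by (intro nn_integral_cong) (simp add: root leaf_Q_def pvar_def leaf_form_def)
      also have "\<dots> = ennreal (weight_Q a L U g * 1 * (Gamma (a v) * k {v} powr (- a v)) * exp (- (k {v} * 0 + 0)))"
        using av kv m0 by (intro nn_integral_shifted_gamma) (simp_all add: root)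
      finally show "(\<integral>\<^sup>+y. ?f (g({v} := y)) \<partial>lborel) = ennreal (weight_Q a L U g * c)"
        unfolding c_def const_Q_def kv(2)[symmetric] by (simp add: root)
    qed
    finally show ?thesis .
  next
    case (one u)
    have w: "weight_Q a L U (g({v, u} := s, {v} := y)) = weight_Q a L U g" for g s y
      using no by (intro weight_Q_cong[OF sL]) auto
    have "integral\<^sup>N (Leb (dedges ((v, N) # L))) ?f =
        (\<integral>\<^sup>+g. \<integral>\<^sup>+s. \<integral>\<^sup>+y. ?f (g({v, u} := s, {v} := y)) \<partial>lborel \<partial>lborel \<partial>Leb (dedges L))"
      using fm no one(2) unfolding one(1) dedges_star_eqs by (intro nn_integral_Leb_insert2(1)) auto
    also have "\<dots> = (\<integral>\<^sup>+g. ennreal (weight_Q a L U g * c) \<partial>Leb (dedges L))"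
    proof (intro nn_integral_cong)
      fix g
      show "(\<integral>\<^sup>+s. \<integral>\<^sup>+y. ?f (g({v, u} := s, {v} := y)) \<partial>lborel \<partial>lborel) = ennreal (weight_Q a L U g * c)"
      proof (cases "weight_Q a L U g = 0")
        case True
        then show ?thesis unfolding w by simp
      next
        case False
        have p: "g {u} > 0" using pdet_pos[OF pd[OF False]] one by simp
        have ne: "{u} \<noteq> {v}" "{u} \<noteq> {v, u}" "{v, u} \<noteq> {v}" using one(2) by auto
        have leaf: "leaf_Q (a v) v N k (g({v, u} := s, {v} := y)) = (if y - s\<^sup>2 / g {u} > 0
            then exp (- (k {v} * y + (2 * k {v, u} * s + (k {v, u})\<^sup>2 * g {u} / k {v}))) *
              (y - s\<^sup>2 / g {u}) powr (a v - 1 / 2 - 1) * g {u} powr (- 1 / 2) else 0)" for s y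
          using ne by (simp add: one(1) leaf_Q_def pvar_def leaf_form_def power2_eq_square add.assoc mult.assoc)
        show ?thesis
          unfolding w leaf c_def kv(2)[symmetric]
          using nn_integral_leaf_Q1[of "a v" "k {v}" "g {u}" "weight_Q a L U g" "k {v, u}"] av kv p m0
          by (simp add: const_Q_def one(1))
      qed
    qed
    finally show ?thesis .
  next
    case (two u w)
    have w: "weight_Q a L U (g({v, w} := t, {v, u} := s, {v} := y)) = weight_Q a L U g" for g s t y
      using no by (intro weight_Q_cong[OF sL]) auto
    have nv: "{v, u} \<noteq> {v, w}" using two by (auto simp: doubleton_eq_iff)
    have "integral\<^sup>N (Leb (dedges ((v, N) # L))) ?f =
        (\<integral>\<^sup>+g. \<integral>\<^sup>+t. \<integral>\<^sup>+s. \<integral>\<^sup>+y. ?f (g({v, w} := t, {v, u} := s, {v} := y)) \<partial>lborel \<partial>lborel \<partial>lborel \<partial>Leb (dedges L))"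
      using fm no two(2,3) nv unfolding two(1) dedges_star_eqs by (intro nn_integral_Leb_insert3(1)) auto
    also have "\<dots> = (\<integral>\<^sup>+g. ennreal (weight_Q a L U g * c) \<partial>Leb (dedges L))"
    proof (intro nn_integral_cong)
      fix g
      show "(\<integral>\<^sup>+t. \<integral>\<^sup>+s. \<integral>\<^sup>+y. ?f (g({v, w} := t, {v, u} := s, {v} := y)) \<partial>lborel \<partial>lborel \<partial>lborel) =
        ennreal (weight_Q a L U g * c)"
      proof (cases "weight_Q a L U g = 0")
        case True
        then show ?thesis unfolding w by simp
      next
        case False
        have p: "g {u} > 0"
          using pd_on_subset[OF pd[OF False], of "{u}"] two pdet_pos[of "[u]" g] by simp
        have D: "g {u} * g {w} - (g {u, w})\<^sup>2 > 0" using pdet_pos[OF pd[OF False]] two by simp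
        let ?D = "g {u} * g {w} - (g {u, w})\<^sup>2"
        let ?q = "\<lambda>s t. (g {w} * s\<^sup>2 - 2 * g {u, w} * s * t + g {u} * t\<^sup>2) / ?D"
        have ne: "{u} \<noteq> {v}" "{w} \<noteq> {v}" "{u, w} \<noteq> {v}" "{v, u} \<noteq> {v}" "{v, w} \<noteq> {v}"
          "{u} \<noteq> {v, u}" "{w} \<noteq> {v, u}" "{u, w} \<noteq> {v, u}" "{v, w} \<noteq> {v, u}"
          "{u} \<noteq> {v, w}" "{w} \<noteq> {v, w}" "{u, w} \<noteq> {v, w}" "{v, u} \<noteq> {v, w}" "{w, u} = {u, w}"
          using two(2-4) by (auto simp: doubleton_eq_iff)
        have pv: "pvar v N (g({v, w} := t, {v, u} := s, {v} := y)) = y - ?q s t" for s t y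
        proof -
          have "pvar v N (g({v, w} := t, {v, u} := s, {v} := y)) =
            y - ((s * g {w} - t * g {u, w}) / ?D * s + (t * g {u} - s * g {u, w}) / ?D * t)"
            using ne two(4) by (simp add: two(1) pvar_def)
          then show ?thesis
            by (simp add: power2_eq_square algebra_simps flip: add_divide_distrib diff_divide_distrib)
        qed
        have lf: "leaf_form v N k (g({v, w} := t, {v, u} := s, {v} := y)) =
            k {v} * y + (2 * k {v, u} * s + 2 * k {v, w} * t +
              ((k {v, u})\<^sup>2 * g {u} + 2 * k {v, u} * k {v, w} * g {u, w} + (k {v, w})\<^sup>2 * g {w}) / k {v})" for s t y
          using ne two(4) by (simp add: two(1) leaf_form_def power2_eq_square algebra_simps add_divide_distrib)
        have pt: "pdet N (g({v, w} := t, {v, u} := s, {v} := y)) = ?D" for s t y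
          using ne by (simp add: two(1))
        have len: "a v - real (length N) / 2 = a v - 1" "real (length N) / 2 = 1" by (simp_all add: two(1))
        have leaf: "leaf_Q (a v) v N k (g({v, w} := t, {v, u} := s, {v} := y)) = (if y - ?q s t > 0
            then exp (- (k {v} * y + (2 * k {v, u} * s + 2 * k {v, w} * t +
              ((k {v, u})\<^sup>2 * g {u} + 2 * k {v, u} * k {v, w} * g {u, w} + (k {v, w})\<^sup>2 * g {w}) / k {v}))) *
              (y - ?q s t) powr (a v - 1 - 1) * ?D powr (- 1 / 2) else 0)" for s t y
          unfolding leaf_Q_def pv lf pt len ..
        have "a v - 1 > 0" using av len by simp
        from nn_integral_leaf_Q2[OF this kv(1) p D m0]
        show ?thesis
          unfolding w leaf c_def kv(2)[symmetric] const_Q_def len by simp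
      qed
    qed
    finally show ?thesis .
  qed
  also have "\<dots> = (\<integral>\<^sup>+g. ennreal (weight_Q a L U g) * ennreal c \<partial>Leb (dedges L))"
    using c0 m0 by (simp add: ennreal_mult')
  also have "\<dots> = (\<integral>\<^sup>+g. ennreal (weight_Q a L U g) \<partial>Leb (dedges L)) * ennreal c"
    using measurable_weight_Q[where a = a and U = U, OF sL component_measurable] by (intro nn_integral_multc) simp
  also have "\<dots> = ennreal (\<Prod>(v, N)\<leftarrow>L. const_Q (a v) N * pvar v N U powr a v) * ennreal c"
    using IH by simp
  also have "\<dots> = ennreal (c * (\<Prod>(v, N)\<leftarrow>L. const_Q (a v) N * pvar v N U powr a v))"
    unfolding ennreal_mult'[OF c0] by (rule mult.commute)
  finally show ?case by (simp add: x k_def c_def del: precision.simps)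
qed

text \<open>Here the entries of the leaf are integrated last. Once they are fixed, passing to the Schur complement
  is a translation of the remaining entries, so the inner integral is that of the smaller scheme.\<close>

theorem nn_integral_weight_P:
  assumes "scheme L" "in_Q L U" "\<And>v N. (v, N) \<in> set L \<Longrightarrow> a v < 0"
  shows "(\<integral>\<^sup>+x. ennreal (weight_P a L U x) \<partial>Leb (dedges L)) =
    ennreal (\<Prod>(v, N)\<leftarrow>L. const_P (a v) N * pvar v N U powr a v * pdet N U powr (- 1 / 2))"
  using assms
proof (induction L)
  case Nil
  then show ?case by (simp add: PiM_empty nn_integral_count_space_finite)
next
  case (Cons p L)
  obtain v N where p: "p = (v, N)" by (cases p)
  have sch: "scheme ((v, N) # L)" and sL: "scheme L" using Cons.prems p by auto
  have q: "pvar v N U > 0" "in_Q L U" and av: "- a v > 0" using Cons.prems p by auto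
  define c where "c = const_P (a v) N * pvar v N U powr a v * pdet N U powr (- 1 / 2)"
  have c0: "c \<ge> 0" using Gamma_real_pos[OF av] by (simp add: c_def const_P_def)
  define R where "R = (\<Prod>(v, N)\<leftarrow>L. const_P (a v) N * pvar v N U powr a v * pdet N U powr (- 1 / 2))"
  have IH: "(\<integral>\<^sup>+x. ennreal (weight_P a L U x) \<partial>Leb (dedges L)) = ennreal R"
    unfolding R_def by (rule Cons.IH[OF sL q(2)]) (use Cons.prems(3) in auto)
  have R0: "R \<ge> 0"
    unfolding R_def using Cons.prems(3)
    by (intro prod_list_nonneg) (force simp: const_P_def p intro!: mult_nonneg_nonneg less_imp_le[OF Gamma_real_pos])
  let ?f = "\<lambda>x. ennreal (weight_P a L U (schur v N x) * leaf_P (a v) v N U x)"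
  have fm: "?f \<in> borel_measurable (Leb (dedges ((v, N) # L)))"
    using measurable_weight_P[where a = a and U = U, OF sch component_measurable] by simp
  note no = not_in_dedges[OF sch]
  note pd = in_Q_pd_on[OF sch q(2)]
  \<comment> \<open>\<open>T\<close> inserts the fixed entries of the leaf; \<open>d\<close> below is the resulting translation.\<close>
  have inner: "(\<integral>\<^sup>+x. ennreal (weight_P a L U (schur v N (T x)) * l) \<partial>Leb (dedges L)) = ennreal (R * l)"
    if l: "l \<ge> 0" and T1: "\<And>x e. e \<in> dedges L \<Longrightarrow> T x e = x e" and T2: "\<And>x e. e \<in> star v N \<Longrightarrow> T x e = T (\<lambda>_. 0) e" for T l
  proof -
    define d where "d e = schur v N (T (\<lambda>_. 0)) e" for e
    have m: "(\<lambda>x. ennreal (weight_P a L U x)) \<in> borel_measurable (Leb (dedges L))"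
      using measurable_weight_P[where a = a and U = U, OF sL component_measurable] by simp
    have el: "schur v N (T x) e = x e + d e" if e: "e \<in> dedges L" for x e
    proof (cases "e \<subseteq> set N")
      case True
      have "finite e" "e \<noteq> {}" using dedges_subset[of L e] e sL finite_subset[OF True] by auto
      then have "Min e \<in> set N" "Max e \<in> set N" using True by (auto intro: Min_in Max_in)
      then have "{v, Min e} \<in> star v N" "{v, Max e} \<in> star v N" "{v} \<in> star v N" by (auto simp: star_def)
      note * = T2[OF this(1), of x] T2[OF this(2), of x] T2[OF this(3), of x]
      show ?thesis using True T1[OF e] by (simp add: d_def schur_def *)
    next
      case False
      then show ?thesis using T1[OF e] by (simp add: d_def schur_def)
    qed
    have "weight_P a L U (schur v N (T x)) = weight_P a L U (\<lambda>e\<in>dedges L. x e + d e)" for x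
      using el by (intro weight_P_cong[OF sL]) auto
    then have "(\<integral>\<^sup>+x. ennreal (weight_P a L U (schur v N (T x)) * l) \<partial>Leb (dedges L)) =
       (\<integral>\<^sup>+x. ennreal (weight_P a L U (\<lambda>e\<in>dedges L. x e + d e) * l) \<partial>Leb (dedges L))" by simp
    also have "\<dots> = (\<integral>\<^sup>+x. ennreal (weight_P a L U x * l) \<partial>Leb (dedges L))"
      using m l nn_integral_Leb_translate[of "dedges L" "\<lambda>x. ennreal (weight_P a L U x * l)" d]
      by (simp add: ennreal_mult'')
    also have "\<dots> = (\<integral>\<^sup>+x. ennreal (weight_P a L U x) \<partial>Leb (dedges L)) * ennreal l"
      using m l by (simp add: ennreal_mult'' nn_integral_multc)
    also have "\<dots> = ennreal R * ennreal l" using IH by simp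
    also have "\<dots> = ennreal (R * l)" using l by (simp add: ennreal_mult'')
    finally show ?thesis .
  qed
  have "integral\<^sup>N (Leb (dedges ((v, N) # L))) ?f = ennreal (R * c)"
    using sch
  proof (cases rule: scheme_Cons_cases)
    case root
    have l: "leaf_P (a v) v N U (x({v} := y)) = (if y - 0 > 0 then exp (- (U {v} * y + 0)) * (y - 0) powr (- a v - 1) * 1 else 0)" for x y
      by (simp add: root leaf_P_def leaf_form_def mult.commute)
    have "integral\<^sup>N (Leb (dedges ((v, N) # L))) ?f = (\<integral>\<^sup>+y. \<integral>\<^sup>+x. ?f (x({v} := y)) \<partial>Leb (dedges L) \<partial>lborel)"
      using fm no unfolding root dedges_star_eqs by (intro lb.product_nn_integral_insert_rev) auto
    also have "\<dots> = (\<integral>\<^sup>+y. ennreal (R * (if y - 0 > 0 then exp (- (U {v} * y + 0)) * (y - 0) powr (- a v - 1) * 1 else 0)) \<partial>lborel)"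
      unfolding l using no by (intro nn_integral_cong inner) (auto simp: star_def root)
    also have "\<dots> = ennreal (R * 1 * (Gamma (- a v) * U {v} powr (- (- a v))) * exp (- (U {v} * 0 + 0)))"
      using q av R0 by (intro nn_integral_shifted_gamma) (simp_all add: root pvar_def)
    finally show ?thesis by (simp add: c_def const_P_def root pvar_def)
  next
    case (one u)
    have pu: "U {u} > 0" using pdet_pos[OF pd] one by simp
    have pv: "pvar v N U = U {v} - U {v, u} * U {v, u} / U {u}" by (simp add: pvar_def one)
    have ne: "{v, u} \<noteq> {v}" using one(2) by auto
    have l: "leaf_P (a v) v N U (x({v, u} := s, {v} := y)) = (if y > 0
       then exp (- (y * U {v} + 2 * (s * U {v, u}) + s * s * U {u} / y)) * y powr (- a v - 1 / 2 - 1) else 0)" for x s y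
      using ne by (simp add: one(1) leaf_P_def leaf_form_def)
    have "integral\<^sup>N (Leb (dedges ((v, N) # L))) ?f =
        (\<integral>\<^sup>+y. \<integral>\<^sup>+s. \<integral>\<^sup>+x. ?f (x({v, u} := s, {v} := y)) \<partial>Leb (dedges L) \<partial>lborel \<partial>lborel)"
      using fm no one(2) unfolding one(1) dedges_star_eqs by (intro nn_integral_Leb_insert2(2)) auto
    also have "\<dots> = (\<integral>\<^sup>+y. \<integral>\<^sup>+s. ennreal (R * (if y > 0
       then exp (- (y * U {v} + 2 * (s * U {v, u}) + s * s * U {u} / y)) * y powr (- a v - 1 / 2 - 1) else 0)) \<partial>lborel \<partial>lborel)"
      unfolding l using no by (intro nn_integral_cong inner) (auto simp: star_def one(1))
    also have "\<dots> = ennreal (R * (pi powr (1 / 2) * Gamma (- a v) *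
        (U {v} - U {v, u} * U {v, u} / U {u}) powr a v * U {u} powr (- 1 / 2)))"
      using av pu q(1)[unfolded pv] R0 by (rule nn_integral_leaf_P1)
    finally show ?thesis unfolding c_def pv const_P_def by (simp add: one(1))
  next
    case (two u w)
    have pu: "U {u} > 0" using pd_on_subset[OF pd, of "{u}"] two pdet_pos[of "[u]" U] by simp
    let ?D = "U {u} * U {w} - (U {u, w})\<^sup>2"
    have D: "?D > 0" using pdet_pos[OF pd] two by simp
    have pv: "pvar v N U = U {v} - (U {w} * (U {v, u})\<^sup>2 - 2 * U {u, w} * U {v, u} * U {v, w} + U {u} * (U {v, w})\<^sup>2) / ?D"
    proof -
      have "pvar v N U = U {v} - ((U {v, u} * U {w} - U {v, w} * U {u, w}) / ?D * U {v, u} +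
          (U {v, w} * U {u} - U {v, u} * U {u, w}) / ?D * U {v, w})"
        using two(4) by (simp add: two(1) pvar_def)
      then show ?thesis
        by (simp add: power2_eq_square algebra_simps flip: add_divide_distrib diff_divide_distrib)
    qed
    have ne: "{v, u} \<noteq> {v}" "{v, w} \<noteq> {v}" "{v, u} \<noteq> {v, w}" "{v, w} \<noteq> {v, u}" "{w, u} = {u, w}"
      using two(2-4) by (auto simp: doubleton_eq_iff)
    have l: "leaf_P (a v) v N U (x({v, w} := t, {v, u} := s, {v} := y)) = (if y > 0
       then exp (- (y * U {v} + 2 * (s * U {v, u} + t * U {v, w}) +
           (s * s * U {u} + 2 * s * t * U {u, w} + t * t * U {w}) / y)) * y powr (- a v - 1 - 1) else 0)" for x s t y
      using ne two(4) by (simp add: two(1) leaf_P_def leaf_form_def algebra_simps)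
    have "integral\<^sup>N (Leb (dedges ((v, N) # L))) ?f =
        (\<integral>\<^sup>+y. \<integral>\<^sup>+s. \<integral>\<^sup>+t. \<integral>\<^sup>+x. ?f (x({v, w} := t, {v, u} := s, {v} := y)) \<partial>Leb (dedges L) \<partial>lborel \<partial>lborel \<partial>lborel)"
      using fm no ne unfolding two(1) dedges_star_eqs by (intro nn_integral_Leb_insert3(2)) auto
    also have "\<dots> = (\<integral>\<^sup>+y. \<integral>\<^sup>+s. \<integral>\<^sup>+t. ennreal (R * (if y > 0
       then exp (- (y * U {v} + 2 * (s * U {v, u} + t * U {v, w}) +
           (s * s * U {u} + 2 * s * t * U {u, w} + t * t * U {w}) / y)) * y powr (- a v - 1 - 1) else 0)) \<partial>lborel \<partial>lborel \<partial>lborel)"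
      unfolding l using no by (intro nn_integral_cong inner) (auto simp: star_def two(1))
    also have "\<dots> = ennreal (R * (pi * Gamma (- a v) *
        (U {v} - (U {w} * (U {v, u})\<^sup>2 - 2 * U {u, w} * U {v, u} * U {v, w} + U {u} * (U {v, w})\<^sup>2) / ?D) powr a v *
        ?D powr (- 1 / 2)))"
      using av pu D q(1)[unfolded pv] R0 by (rule nn_integral_leaf_P2)
    finally show ?thesis unfolding c_def pv const_P_def by (simp add: two(1))
  qed
  then show ?case by (simp add: p c_def R_def mult.commute)
qed

section \<open>Weights in terms of the covariance matrix\<close>

lemma in_Q_cong:
  "scheme L \<Longrightarrow> (\<And>e. e \<in> dedges L \<Longrightarrow> g e = h e) \<Longrightarrow> in_Q L g = in_Q L h"
proof (induction L)
  case (Cons x L)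
  obtain v N where x: "x = (v, N)" by (cases x)
  have "in_Q L g = in_Q L h" using Cons x by auto
  then show ?case unfolding x using pvar_cong(1)[OF Cons.prems[unfolded x]] by simp
qed simp

lemma precision_cong:
  "scheme L \<Longrightarrow> (\<And>e. e \<in> dedges L \<Longrightarrow> g e = h e) \<Longrightarrow> precision L g e = precision L h e"
proof (induction L arbitrary: e)
  case (Cons x L)
  obtain v N where x: "x = (v, N)" by (cases x)
  have "precision L g e = precision L h e" for e using Cons x by auto
  then show ?case unfolding x using pvar_cong(1,5)[OF Cons.prems[unfolded x]] by simp
qed simp

lemma weight_Q_eq:
  assumes "scheme L" "in_Q L U" "in_Q L g"
  shows "weight_Q a L U g = exp (- trace_form (dverts L) (fill L (precision L U)) g) *
    (\<Prod>(v, N)\<leftarrow>L. pvar v N g powr (a v - real (length N) / 2 - 1) * pdet N g powr (- 1 / 2))"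
  using assms
proof (induction L)
  case Nil
  then show ?case by (simp add: trace_form_def)
next
  case (Cons x L)
  obtain v N where x: "x = (v, N)" by (cases x)
  have sch: "scheme ((v, N) # L)" using Cons.prems x by simp
  have q: "in_Q L U" "in_Q L g" "pvar v N U \<noteq> 0" "pvar v N g > 0" using Cons.prems x by auto
  have "fill L (schur v N (precision ((v, N) # L) U)) = fill L (precision L U)"
    using precision_Cons(3)[OF sch q(3)] by (intro fill_cong) auto
  then have "exp (- trace_form (dverts ((v, N) # L)) (fill ((v, N) # L) (precision ((v, N) # L) U)) g) =
      exp (- leaf_form v N (precision ((v, N) # L) U) g) * exp (- trace_form (dverts L) (fill L (precision L U)) g)"
    unfolding trace_form_Cons[OF sch] by (simp add: exp_add[symmetric] del: precision.simps)
  then show ?case using Cons.IH q sch unfolding x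
    by (simp add: leaf_Q_def del: precision.simps)
qed

lemma weight_P_eq:
  assumes "scheme L" "in_P L x" "in_Q L g" "\<And>e. e \<in> dedges L \<Longrightarrow> x e = precision L g e"
  shows "weight_P a L U x = exp (- trace_form (dverts L) (fill L x) U) *
    (\<Prod>(v, N)\<leftarrow>L. pvar v N g powr (a v + real (length N) / 2 + 1))"
  using assms
proof (induction L arbitrary: x)
  case Nil
  then show ?case by (simp add: trace_form_def)
next
  case (Cons p L)
  obtain v N where p: "p = (v, N)" by (cases p)
  have sch: "scheme ((v, N) # L)" using Cons.prems p by simp
  have q: "in_Q L g" "pvar v N g > 0" "x {v} > 0" "in_P L (schur v N x)" using Cons.prems p by auto
  have xr: "\<And>e. e \<in> dedges ((v, N) # L) \<Longrightarrow> x e = precision ((v, N) # L) g e" using Cons.prems(4) p by blast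
  have xv: "x {v} = 1 / pvar v N g"
    using xr[of "{v}"] precision_Cons(1)[OF sch, of g] by (simp add: star_def del: precision.simps)
  have "schur v N x e = precision L g e" if "e \<in> dedges L" for e
    using schur_cong[OF sch xr that] precision_Cons(3)[OF sch _ that, of g] q by simp
  then have IH: "weight_P a L U (schur v N x) = exp (- trace_form (dverts L) (fill L (schur v N x)) U) *
    (\<Prod>(v, N)\<leftarrow>L. pvar v N g powr (a v + real (length N) / 2 + 1))"
    using Cons.IH q sch by simp
  have "exp (- trace_form (dverts ((v, N) # L)) (fill ((v, N) # L) x) U) =
      exp (- leaf_form v N x U) * exp (- trace_form (dverts L) (fill L (schur v N x)) U)"
    unfolding trace_form_Cons[OF sch] by (simp add: exp_add[symmetric])
  moreover have "x {v} powr (- a v - real (length N) / 2 - 1) = pvar v N g powr (a v + real (length N) / 2 + 1)"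
  proof -
    have "(1 / y) powr (- c) = y powr c" if "y > 0" for y c :: real
      using that by (simp add: powr_divide powr_minus)
    moreover have "- a v - real (length N) / 2 - 1 = - (a v + real (length N) / 2 + 1)" by simp
    ultimately show ?thesis using q(2) unfolding xv by (simp only:)
  qed
  ultimately show ?case using IH q unfolding p by (simp add: leaf_P_def)
qed

text \<open>The edge entries of the inverse as an explicit function of the precision entries. It exists for the
  sake of measurability: the Markov ratio on the cone of precision matrices is evaluated at these
  entries.\<close>

fun covariance :: "scheme \<Rightarrow> (nat set \<Rightarrow> real) \<Rightarrow> nat set \<Rightarrow> real" where
  "covariance [] x = (\<lambda>e. 0)"
| "covariance ((v, N) # L) x = (\<lambda>e.
     if e \<in> dedges L then covariance L (schur v N x) e
     else if e = {v} then 1 / x {v} + (\<Sum>u\<in>set N. (- x {v, u} / x {v}) *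
       (\<Sum>w\<in>set N. (- x {v, w} / x {v}) * covariance L (schur v N x) {w, u}))
     else (\<Sum>w\<in>set N. (- x {v, w} / x {v}) * covariance L (schur v N x) {w, Min (e - {v})}))"

lemma covariance_eq:
  assumes "scheme L" "in_P L x" "inv_pair (dverts L) (fill L x) g" "e \<in> dedges L"
  shows "covariance L x e = g e"
  using assms
proof (induction L arbitrary: x e)
  case (Cons p L)
  obtain v N where p: "p = (v, N)" by (cases p)
  have sch: "scheme ((v, N) # L)" using Cons.prems p by simp
  then have N: "set N \<subseteq> dverts L" "complete_in (dedges L) (set N)" "v \<notin> dverts L" by (auto simp: complete_in_def)
  have q: "x {v} > 0" "in_P L (schur v N x)" using Cons.prems p by auto
  note inv = inv_pair_Cons[OF sch _ Cons.prems(3)[unfolded p]]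
  have IH: "covariance L (schur v N x) e = g e" if "e \<in> dedges L" for e
    using Cons.IH[OF _ q(2) inv(1) that] sch q by simp
  have s: "(\<Sum>w\<in>set N. (- x {v, w} / x {v}) * covariance L (schur v N x) {w, u}) = g {v, u}" if "u \<in> set N" for u
  proof -
    have "(\<Sum>w\<in>set N. (- x {v, w} / x {v}) * covariance L (schur v N x) {w, u}) =
        (\<Sum>w\<in>set N. (- x {v, w} / x {v}) * g {w, u})"
      using IH N(2) that by (intro sum.cong) (auto simp: complete_in_def)
    moreover have "x {v} \<noteq> 0" "u \<in> dverts L" using q that N(1) by (simp, blast)
    ultimately show ?thesis using inv(2) by simp
  qed
  note no = not_in_dedges[OF sch]
  consider "e \<in> dedges L" | "e = {v}" | u where "u \<in> set N" "e = {v, u}"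
    using Cons.prems(4) p by (auto simp: star_def)
  then show ?case
  proof cases
    case 1
    then show ?thesis using IH p by simp
  next
    case 2
    have "covariance ((v, N) # L) x {v} = 1 / x {v} + (\<Sum>u\<in>set N. (- x {v, u} / x {v}) * g {v, u})"
      using no s by (simp cong: sum.cong)
    then show ?thesis using 2 p inv(3) q by simp
  next
    case (3 u)
    then have "u \<noteq> v" using N by auto
    then have "{v, u} - {v} = {u}" "{v, u} \<noteq> {v}" by auto
    then have "covariance ((v, N) # L) x {v, u} = (\<Sum>w\<in>set N. (- x {v, w} / x {v}) * covariance L (schur v N x) {w, u})"
      using no by simp
    then show ?thesis using s 3 p by simp
  qed
qed simp

lemma measurable_covariance:
  assumes "scheme L" "\<And>e. e \<in> dedges L \<Longrightarrow> (\<lambda>z. F z e) \<in> borel_measurable M" "e \<in> dedges L"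
  shows "(\<lambda>z. covariance L (F z) e) \<in> borel_measurable M"
  using assms
proof (induction L arbitrary: F e)
  case (Cons p L)
  obtain v N where p: "p = (v, N)" by (cases p)
  have sch: "scheme ((v, N) # L)" using Cons.prems p by simp
  then have N: "complete_in (dedges L) (set N)" "v \<notin> set N" by (auto simp: complete_in_def)
  have st: "(\<lambda>z. F z e) \<in> borel_measurable M" if "e \<in> star v N" for e using Cons.prems p that by auto
  have [measurable]: "(\<lambda>z. F z {v}) \<in> borel_measurable M" by (rule st) (simp add: star_def)
  have vu [measurable]: "(\<lambda>z. F z {v, u}) \<in> borel_measurable M" if "u \<in> set N" for u
    by (rule st) (use that in \<open>simp add: star_def\<close>)
  have IH: "(\<lambda>z. covariance L (schur v N (F z)) e) \<in> borel_measurable M" if "e \<in> dedges L" for e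
    using sch Cons.prems that p by (intro Cons.IH measurable_schur[of v N L]) auto
  have IH2 [measurable]: "(\<lambda>z. covariance L (schur v N (F z)) {w, u}) \<in> borel_measurable M" if "w \<in> set N" "u \<in> set N" for w u
    using that N by (intro IH) (auto simp: complete_in_def)
  have S: "(\<lambda>z. (\<Sum>w\<in>set N. (- F z {v, w} / F z {v}) * covariance L (schur v N (F z)) {w, u})) \<in> borel_measurable M"
    if "u \<in> set N" for u
    using that by (intro borel_measurable_sum borel_measurable_times borel_measurable_divide borel_measurable_uminus vu IH2) auto
  note no = not_in_dedges[OF sch]
  consider "e \<in> dedges L" | "e = {v}" | u where "u \<in> set N" "e = {v, u}"
    using Cons.prems(3) p by (auto simp: star_def)
  then show ?case
  proof cases
    case 1
    then show ?thesis using IH p by simp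
  next
    case 2
    have "(\<lambda>z. 1 / F z {v} + (\<Sum>u\<in>set N. (- F z {v, u} / F z {v}) *
       (\<Sum>w\<in>set N. (- F z {v, w} / F z {v}) * covariance L (schur v N (F z)) {w, u}))) \<in> borel_measurable M"
      by (intro borel_measurable_add borel_measurable_sum borel_measurable_times borel_measurable_divide
          borel_measurable_uminus vu S borel_measurable_const) auto
    then show ?thesis using 2 p no by simp
  next
    case (3 u)
    then have "u \<noteq> v" using N by auto
    then have "{v, u} - {v} = {u}" "{v, u} \<noteq> {v}" by auto
    then show ?thesis using 3 p no S by simp
  qed
qed simp

lemma scheme_suffix:
  assumes "scheme L" "(v, N) \<in> set L"
  obtains L' where "scheme ((v, N) # L')" "dedges ((v, N) # L') \<subseteq> dedges L"
  using assms
proof (induction L arbitrary: thesis)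
  case (Cons p L)
  obtain w M where p: "p = (w, M)" by (cases p)
  show ?case
  proof (cases "(v, N) = p")
    case True
    then show ?thesis using Cons.prems(1)[of L] Cons.prems(2) by auto
  next
    case False
    then obtain L' where "scheme ((v, N) # L')" "dedges ((v, N) # L') \<subseteq> dedges L"
      using Cons.IH[of thesis] Cons.prems p by (auto intro: Cons.IH)
    then show ?thesis using p by (intro Cons.prems(1)[of L']) auto
  qed
qed simp

lemma measurable_prod_list:
  fixes f :: "'a \<Rightarrow> 'b \<Rightarrow> real"
  assumes "\<And>p. p \<in> set L \<Longrightarrow> (\<lambda>z. f p z) \<in> borel_measurable M"
  shows "(\<lambda>z. \<Prod>p\<leftarrow>L. f p z) \<in> borel_measurable M"
  using assms by (induction L) auto

lemma prod_list_pos: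
  fixes f :: "'a \<Rightarrow> real"
  assumes "\<And>p. p \<in> set L \<Longrightarrow> f p > 0"
  shows "(\<Prod>p\<leftarrow>L. f p) > 0"
  using assms by (induction L) auto

lemma measurable_prod_pvar:
  assumes "scheme L" "\<And>e. e \<in> dedges L \<Longrightarrow> (\<lambda>z. F z e) \<in> borel_measurable M"
  shows "(\<lambda>z. \<Prod>(v, N)\<leftarrow>L. pvar v N (F z) powr a v N * pdet N (F z) powr b) \<in> borel_measurable M"
proof -
  have "(\<lambda>z. case p of (v, N) \<Rightarrow> pvar v N (F z) powr a v N * pdet N (F z) powr b) \<in> borel_measurable M"
    if p: "p \<in> set L" for p
  proof -
    obtain v N where vN: "p = (v, N)" by (cases p)
    obtain L' where L': "scheme ((v, N) # L')" "dedges ((v, N) # L') \<subseteq> dedges L"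
      using scheme_suffix[OF assms(1)] p vN by blast
    have [measurable]: "(\<lambda>z. pvar v N (F z)) \<in> borel_measurable M" "(\<lambda>z. pdet N (F z)) \<in> borel_measurable M"
      using measurable_pvar(1,2)[OF L'(1), of F M] assms(2) L'(2) by auto
    show ?thesis unfolding vN prod.case by measurable
  qed
  then show ?thesis by (rule measurable_prod_list)
qed

lemma in_Q_pvar_pos:
  assumes "scheme L" "in_Q L g" "(v, N) \<in> set L"
  shows "pvar v N g > 0" "pdet N g > 0"
proof -
  have "pvar v N g > 0 \<and> pdet N g > 0"
    using assms
  proof (induction L)
    case (Cons p L)
    show ?case
    proof (cases "(v, N) = p")
      case True
      then have sch: "scheme ((v, N) # L)" "in_Q L g" "pvar v N g > 0" using Cons.prems by auto
      from pdet_pos[OF in_Q_pd_on[OF sch(1,2)]] sch show ?thesis by simp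
    next
      case False
      then show ?thesis using Cons by (cases p) auto
    qed
  qed simp
  then show "pvar v N g > 0" "pdet N g > 0" by blast+
qed

lemma measurable_in_Q:
  assumes "scheme L" "\<And>e. e \<in> dedges L \<Longrightarrow> (\<lambda>z. F z e) \<in> borel_measurable M"
  shows "Measurable.pred M (\<lambda>z. in_Q L (F z))"
  using assms
proof (induction L)
  case (Cons p L)
  obtain v N where p: "p = (v, N)" by (cases p)
  have [measurable]: "(\<lambda>z. pvar v N (F z)) \<in> borel_measurable M"
    using measurable_pvar(1)[OF Cons.prems[unfolded p]] .
  have [measurable]: "Measurable.pred M (\<lambda>z. in_Q L (F z))" using Cons p by auto
  show ?case unfolding p in_Q.simps by measurable
qed simp

lemma measurable_in_P:
  assumes "scheme L" "\<And>e. e \<in> dedges L \<Longrightarrow> (\<lambda>z. F z e) \<in> borel_measurable M"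
  shows "Measurable.pred M (\<lambda>z. in_P L (F z))"
  using assms
proof (induction L arbitrary: F)
  case (Cons p L)
  obtain v N where p: "p = (v, N)" by (cases p)
  have [measurable]: "(\<lambda>z. F z {v}) \<in> borel_measurable M"
    using Cons.prems p by (auto simp: star_def)
  have [measurable]: "Measurable.pred M (\<lambda>z. in_P L (schur v N (F z)))"
    using Cons.prems p by (intro Cons.IH measurable_schur[of v N L]) auto
  show ?case unfolding p in_P.simps by measurable
qed simp

section \<open>From edge functions to matrices\<close>

lemma pos_def_block:
  assumes "finite C"
  shows "pos_def (card C) (block C g) \<longleftrightarrow> pd_on C g"
proof -
  let ?n = "card C" let ?xs = "sorted_list_of_set C"
  have len: "length ?xs = ?n" by simp
  have bij: "bij_betw (\<lambda>i. ?xs ! i) {..<?n} C"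
    using assms by (intro bij_betw_nth) auto
  have carr: "block C g \<in> carrier_mat ?n ?n" by (simp add: block_def)
  have sym: "transpose_mat (block C g) = block C g"
    by (rule eq_matI) (auto simp: block_def insert_commute)
  have key: "scalar_prod v (block C g *\<^sub>v v) = qform C g y"
    if v: "v \<in> carrier_vec ?n" and y: "\<And>i. i < ?n \<Longrightarrow> y (?xs ! i) = v $ i" for v y
  proof -
    have "qform C g y = (\<Sum>i<?n. \<Sum>j<?n. g {?xs ! i, ?xs ! j} * (y (?xs ! i) * y (?xs ! j)))"
      unfolding qform_def sum.reindex_bij_betw[OF bij, symmetric] ..
    also have "\<dots> = (\<Sum>i<?n. \<Sum>j<?n. g {?xs ! i, ?xs ! j} * (v $ i * v $ j))"
      using y by (intro sum.cong refl) auto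
    also have "\<dots> = (\<Sum>i<?n. v $ i * (\<Sum>j<?n. g {?xs ! i, ?xs ! j} * v $ j))"
      by (simp add: sum_distrib_left mult_ac)
    also have "\<dots> = scalar_prod v (block C g *\<^sub>v v)"
      using v by (simp add: scalar_prod_def block_def lessThan_atLeast0)
    finally show ?thesis ..
  qed
  show ?thesis
  proof
    assume pd: "pos_def ?n (block C g)"
    show "pd_on C g"
      unfolding pd_on_def
    proof (intro allI impI)
      fix y :: "nat \<Rightarrow> real" assume "\<exists>i\<in>C. y i \<noteq> 0"
      then obtain c where c: "c \<in> C" "y c \<noteq> 0" by blast
      then have "c \<in> (\<lambda>i. ?xs ! i) ` {..<?n}" using bij_betw_imp_surj_on[OF bij] by blast
      then obtain i where i: "i < ?n" "?xs ! i = c" by blast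
      let ?v = "vec ?n (\<lambda>i. y (?xs ! i))"
      have "?v \<noteq> 0\<^sub>v ?n" using i c by (metis index_vec index_zero_vec(1))
      then have "scalar_prod ?v (block C g *\<^sub>v ?v) > 0" using pd unfolding pos_def_def by simp
      then show "0 < qform C g y" by (subst (asm) key[where y = y]) auto
    qed
  next
    assume pd: "pd_on C g"
    show "pos_def ?n (block C g)"
      unfolding pos_def_def
    proof (intro conjI carr sym ballI impI)
      fix v :: "real vec" assume v: "v \<in> carrier_vec ?n" "v \<noteq> 0\<^sub>v ?n"
      then have "\<exists>i<?n. v $ i \<noteq> 0" by (metis carrier_vecD eq_vecI index_zero_vec)
      then obtain i where i: "i < ?n" "v $ i \<noteq> 0" by blast
      let ?y = "\<lambda>k. v $ (the_inv_into {..<?n} (\<lambda>i. ?xs ! i) k)"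
      have y: "?y (?xs ! i) = v $ i" if "i < ?n" for i
        using the_inv_into_f_f[of "\<lambda>i. ?xs ! i" "{..<?n}" i] bij that by (simp add: bij_betw_def)
      have "?xs ! i \<in> C" using bij i by (auto simp: bij_betw_def)
      then have "qform C g ?y > 0" using y[OF i(1)] i(2) by (intro pd_onD[OF pd, of "?xs ! i"]) auto
      then show "0 < scalar_prod v (block C g *\<^sub>v v)" using key[OF v(1) y] by simp
    qed
  qed
qed

lemma inv_mat_eqI:
  assumes A: "A \<in> carrier_mat n n" and B: "B \<in> carrier_mat n n" and AB: "A * B = 1\<^sub>m n" "B * A = 1\<^sub>m n"
  shows "inv_mat A = B"
proof -
  have "A \<in> Units (ring_mat TYPE(real) n ())"
    using assms by (auto simp: Units_def ring_mat_def)
  then have "mat_inverse A \<noteq> None" using mat_inverse(1)[OF A, where b = "()"] by blast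
  then obtain C where C: "mat_inverse A = Some C" by blast
  then have "A * C = 1\<^sub>m n" "C \<in> carrier_mat n n" using mat_inverse(2)[OF A] by auto
  then have "B = B * (A * C)" using B by simp
  also have "\<dots> = (B * A) * C" using A B \<open>C \<in> _\<close> by (simp add: assoc_mult_mat[of _ n n _ n _ n])
  also have "\<dots> = C" using AB \<open>C \<in> _\<close> by simp
  finally show ?thesis using C by (simp add: inv_mat_def)
qed

lemma pos_def_inv_mat:
  assumes "pos_def n A"
  shows "inv_mat A \<in> carrier_mat n n" "A * inv_mat A = 1\<^sub>m n" "inv_mat A * A = 1\<^sub>m n"
    "transpose_mat (inv_mat A) = inv_mat A" "inv_mat (inv_mat A) = A"
proof -
  have A: "A \<in> carrier_mat n n" "transpose_mat A = A" using assms by (auto simp: pos_def_def)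
  have "det A \<noteq> 0"
  proof
    assume "det A = 0"
    then obtain v where v: "v \<in> carrier_vec n" "v \<noteq> 0\<^sub>v n" "A *\<^sub>v v = 0\<^sub>v n"
      using det_0_iff_vec_prod_zero_field[OF A(1)] by auto
    then have "0 < scalar_prod v (0\<^sub>v n)" using assms unfolding pos_def_def by metis
    then show False using v by simp
  qed
  then have "A \<in> Units (ring_mat TYPE(real) n ())" by (rule det_non_zero_imp_unit[OF A(1)])
  then have "mat_inverse A \<noteq> None" using mat_inverse(1)[OF A(1), where b = "()"] by blast
  then obtain B where B: "mat_inverse A = Some B" by blast
  have Bp: "A * B = 1\<^sub>m n" "B * A = 1\<^sub>m n" "B \<in> carrier_mat n n" using mat_inverse(2)[OF A(1) B] by auto
  have eq: "inv_mat A = B" using B by (simp add: inv_mat_def)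
  show "inv_mat A \<in> carrier_mat n n" "A * inv_mat A = 1\<^sub>m n" "inv_mat A * A = 1\<^sub>m n"
    using eq Bp by auto
  show "inv_mat (inv_mat A) = A" unfolding eq by (rule inv_mat_eqI[OF Bp(3) A(1) Bp(2,1)])
  have "transpose_mat B * A = 1\<^sub>m n"
    using transpose_mult[OF A(1) Bp(3)] A Bp(1) by simp
  moreover have "A * transpose_mat B = 1\<^sub>m n"
    using transpose_mult[OF Bp(3) A(1)] A Bp(2) by simp
  ultimately have "inv_mat A = transpose_mat B"
    using A(1) Bp(3) by (intro inv_mat_eqI) auto
  then show "transpose_mat (inv_mat A) = inv_mat A" using eq by simp
qed

definition entry :: "real mat \<Rightarrow> nat set \<Rightarrow> real" where
  "entry A e = A $$ (Min e - 1, Max e - 1)"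

lemma entry_pair:
  assumes "A \<in> carrier_mat n n" "transpose_mat A = A" "i \<in> {1..n}" "j \<in> {1..n}"
  shows "entry A {i, j} = A $$ (i - 1, j - 1)"
proof -
  have "A $$ (j - 1, i - 1) = A $$ (i - 1, j - 1)"
    using assms index_transpose_mat(1)[of "j - 1" A "i - 1"] by auto
  then show ?thesis by (cases "i \<le> j") (simp_all add: entry_def min_def max_def)
qed

text \<open>The integrals over both cones have this shape, with \<open>f\<close> and \<open>d'\<close> known only on the cone \<open>X\<close>; the
  measurable functions \<open>d\<close> and \<open>w\<close> represent them on the whole space.\<close>

lemma nn_integral_density_restrict:
  fixes d d' f w :: "'a \<Rightarrow> real"
  assumes [measurable]: "d \<in> borel_measurable M" "w \<in> borel_measurable M"
    and X: "X \<inter> space M \<in> sets M"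
    and pos: "\<And>x. x \<in> X \<Longrightarrow> x \<in> space M \<Longrightarrow> d x > 0"
    and d': "\<And>x. x \<in> X \<Longrightarrow> x \<in> space M \<Longrightarrow> d' x = d x"
    and w: "\<And>x. x \<in> X \<Longrightarrow> x \<in> space M \<Longrightarrow> w x = f x * d x"
    and outside: "\<And>x. x \<in> space M \<Longrightarrow> x \<notin> X \<Longrightarrow> w x = 0"
  shows "(\<integral>\<^sup>+x. ennreal (f x) \<partial>density (restrict_space M X) (\<lambda>x. ennreal (d' x))) = (\<integral>\<^sup>+x. ennreal (w x) \<partial>M)"
proof -
  let ?R = "restrict_space M X"
  have sp: "x \<in> X" "x \<in> space M" if "x \<in> space ?R" for x using that by (auto simp: space_restrict_space)
  have d [measurable]: "(\<lambda>x. ennreal (d x)) \<in> borel_measurable ?R" by (rule measurable_restrict_space1) measurable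
  have wd: "(\<lambda>x. ennreal (w x / d x)) \<in> borel_measurable ?R" by (rule measurable_restrict_space1) measurable
  have eq: "ennreal (d' x) = ennreal (d x)" if "x \<in> space ?R" for x using d'[OF sp[OF that]] by simp
  have "density ?R (\<lambda>x. ennreal (d' x)) = density ?R (\<lambda>x. ennreal (d x))"
    by (rule density_cong) (use d measurable_cong[THEN iffD2, OF eq d] eq in auto)
  moreover have "f x = w x / d x" if "x \<in> space ?R" for x
    using w[OF sp[OF that]] pos[OF sp[OF that]] by simp
  ultimately have "(\<integral>\<^sup>+x. ennreal (f x) \<partial>density ?R (\<lambda>x. ennreal (d' x))) =
      (\<integral>\<^sup>+x. ennreal (w x / d x) \<partial>density ?R (\<lambda>x. ennreal (d x)))"
    by (auto intro!: nn_integral_cong)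
  also have "\<dots> = (\<integral>\<^sup>+x. ennreal (d x) * ennreal (w x / d x) \<partial>?R)"
    by (rule nn_integral_density[OF d wd])
  also have "\<dots> = (\<integral>\<^sup>+x. ennreal (w x) \<partial>?R)"
  proof (rule nn_integral_cong)
    fix x assume "x \<in> space ?R"
    then have "d x > 0" using pos sp by blast
    then show "ennreal (d x) * ennreal (w x / d x) = ennreal (w x)"
      by (simp add: ennreal_mult'[symmetric])
  qed
  also have "\<dots> = (\<integral>\<^sup>+x. ennreal (w x) * indicator X x \<partial>M)"
    by (rule nn_integral_restrict_space[OF X])
  also have "\<dots> = (\<integral>\<^sup>+x. ennreal (w x) \<partial>M)"
    using outside by (intro nn_integral_cong) (auto simp: indicator_def)
  finally show ?thesis .
qed

locale elimination_scheme =
  fixes G :: ugraph and L :: scheme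
  assumes scheme: "scheme L" and dverts: "dverts L = verts G" and dedges: "dedges L = edges G"
begin

abbreviation p where "p \<equiv> fst G"

lemma card_verts: "card (verts G) = p"
  by (simp add: verts_def)

lemma zero_fill_eq: "zero_fill G x = block (verts G) (fill L x)"
  by (simp add: zero_fill_def fill_def dedges)

lemma zero_fill_carrier: "zero_fill G x \<in> carrier_mat p p"
  by (simp add: zero_fill_def block_def card_verts)

lemma zero_fill_index:
  assumes "i \<in> verts G" "j \<in> verts G"
  shows "zero_fill G x $$ (i - 1, j - 1) = fill L x {i, j}"
proof -
  have "sorted_list_of_set {1..p} = [1..<Suc p]" by (simp add: atLeastLessThanSuc_atLeastAtMost[symmetric] del: upt_Suc)
  then have "sorted_list_of_set (verts G) ! (i - 1) = i" if "i \<in> verts G" for i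
    using that by (auto simp: verts_def simp del: upt_Suc)
  moreover have "i - 1 < p" "j - 1 < p" using assms by (auto simp: verts_def)
  ultimately show ?thesis unfolding zero_fill_eq block_def card_verts using assms by simp
qed

lemma zero_fill_cong: "(\<And>e. e \<in> dedges L \<Longrightarrow> x e = y e) \<Longrightarrow> zero_fill G x = zero_fill G y"
  unfolding zero_fill_eq using fill_cong[of L x y] by simp

lemma pos_def_zero_fill: "pos_def p (zero_fill G x) \<longleftrightarrow> in_P L x"
  using pos_def_block[of "verts G" "fill L x"] pd_on_fill_iff[OF scheme]
  by (simp add: zero_fill_eq card_verts dverts)

lemma zero_fill_P_cone: "zero_fill G x \<in> P_cone G \<longleftrightarrow> in_P L x"
  using pos_def_zero_fill zero_fill_index dedges by (auto simp: P_cone_def fill_def)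

lemma P_coneE:
  assumes "A \<in> P_cone G"
  shows "A = zero_fill G (entry A)"
proof -
  have A: "A \<in> carrier_mat p p" "transpose_mat A = A" using assms by (auto simp: P_cone_def pos_def_def)
  show ?thesis
  proof (rule eq_matI)
    fix i j assume "i < dim_row (zero_fill G (entry A))" "j < dim_col (zero_fill G (entry A))"
    then have ij: "Suc i \<in> verts G" "Suc j \<in> verts G"
      using zero_fill_carrier[of "entry A"] by (auto simp: verts_def)
    have "A $$ (i, j) = entry A {Suc i, Suc j}"
      using entry_pair[OF A, of "Suc i" "Suc j"] ij by (simp add: verts_def)
    moreover have "{Suc i, Suc j} \<notin> dedges L \<Longrightarrow> A $$ (i, j) = 0"
      using assms ij dedges by (force simp: P_cone_def)
    ultimately show "A $$ (i, j) = zero_fill G (entry A) $$ (i, j)"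
      using zero_fill_index[OF ij, of "entry A"] by (simp add: fill_def)
  qed (use A zero_fill_carrier[of "entry A"] in auto)
qed

lemma edge_part_eq: "edge_part G A = restrict (entry A) (dedges L)"
  by (simp add: edge_part_def entry_def[abs_def] dedges)

lemma mult_index:
  assumes A: "A \<in> carrier_mat p p" and B: "B \<in> carrier_mat p p" and ij: "i \<in> verts G" "j \<in> verts G"
  shows "(A * B) $$ (i - 1, j - 1) = (\<Sum>k\<in>verts G. A $$ (i - 1, k - 1) * B $$ (k - 1, j - 1))"
proof -
  have "(A * B) $$ (i - 1, j - 1) = (\<Sum>k\<in>{0..<p}. A $$ (i - 1, k) * B $$ (k, j - 1))"
    using A B ij by (auto simp: verts_def scalar_prod_def)
  also have "\<dots> = (\<Sum>k\<in>verts G. A $$ (i - 1, k - 1) * B $$ (k - 1, j - 1))"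
    by (rule sum.reindex_bij_witness[where i = "\<lambda>k. k - 1" and j = Suc]) (auto simp: verts_def)
  finally show ?thesis .
qed

lemma inv_pair_inv_mat:
  assumes "in_P L x"
  shows "inv_pair (dverts L) (fill L x) (entry (inv_mat (zero_fill G x)))"
proof -
  let ?A = "zero_fill G x"
  have pd: "pos_def p ?A" using pos_def_zero_fill assms by simp
  note I = pos_def_inv_mat[OF pd]
  show ?thesis
    unfolding inv_pair_def dverts
  proof (intro ballI)
    fix i j assume ij: "i \<in> verts G" "j \<in> verts G"
    have "(\<Sum>k\<in>verts G. fill L x {i, k} * entry (inv_mat ?A) {k, j}) =
        (\<Sum>k\<in>verts G. ?A $$ (i - 1, k - 1) * inv_mat ?A $$ (k - 1, j - 1))"
    proof (intro sum.cong refl)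
      fix k assume k: "k \<in> verts G"
      show "fill L x {i, k} * entry (inv_mat ?A) {k, j} = ?A $$ (i - 1, k - 1) * inv_mat ?A $$ (k - 1, j - 1)"
        unfolding zero_fill_index[OF ij(1) k] using entry_pair[OF I(1,4), of k j] ij k by (simp add: verts_def)
    qed
    also have "\<dots> = (?A * inv_mat ?A) $$ (i - 1, j - 1)"
      by (rule mult_index[OF zero_fill_carrier I(1) ij, symmetric])
    also have "\<dots> = (if i = j then 1 else 0)"
      unfolding I(2) using ij by (auto simp: verts_def)
    finally show "(\<Sum>k\<in>verts G. fill L x {i, k} * entry (inv_mat ?A) {k, j}) = (if i = j then 1 else 0)" .
  qed
qed

lemma mat_tr_zero_fill:
  assumes S: "S \<in> carrier_mat p p" "transpose_mat S = S"
  shows "mat_tr (zero_fill G x * S) = trace_form (verts G) (fill L x) (entry S)"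
    and "mat_tr (S * zero_fill G x) = trace_form (verts G) (fill L x) (entry S)"
proof -
  have tr: "mat_tr A = (\<Sum>i\<in>verts G. A $$ (i - 1, i - 1))" if "A \<in> carrier_mat p p" for A
    unfolding mat_tr_def using that
    by (intro sum.reindex_bij_witness[where i = "\<lambda>k. k - 1" and j = Suc]) (auto simp: verts_def)
  note Z = zero_fill_carrier[of x]
  have "mat_tr (zero_fill G x * S) = (\<Sum>i\<in>verts G. \<Sum>k\<in>verts G. zero_fill G x $$ (i - 1, k - 1) * S $$ (k - 1, i - 1))"
    using tr[of "zero_fill G x * S"] mult_index[OF Z S(1)] Z S(1) by simp
  also have "\<dots> = trace_form (verts G) (fill L x) (entry S)"
    unfolding trace_form_def
  proof (intro sum.cong refl)
    fix i k assume ik: "i \<in> verts G" "k \<in> verts G"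
    show "zero_fill G x $$ (i - 1, k - 1) * S $$ (k - 1, i - 1) = fill L x {i, k} * entry S {i, k}"
      unfolding zero_fill_index[OF ik] using entry_pair[OF S, of k i] ik by (simp add: verts_def insert_commute)
  qed
  finally show "mat_tr (zero_fill G x * S) = trace_form (verts G) (fill L x) (entry S)" .
  have "mat_tr (S * zero_fill G x) = (\<Sum>i\<in>verts G. \<Sum>k\<in>verts G. S $$ (i - 1, k - 1) * zero_fill G x $$ (k - 1, i - 1))"
    using tr[of "S * zero_fill G x"] mult_index[OF S(1) Z] Z S(1) by simp
  also have "\<dots> = trace_form (verts G) (fill L x) (entry S)"
    unfolding trace_form_def
  proof (intro sum.cong refl)
    fix i k assume ik: "i \<in> verts G" "k \<in> verts G"
    show "S $$ (i - 1, k - 1) * zero_fill G x $$ (k - 1, i - 1) = fill L x {i, k} * entry S {i, k}"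
      unfolding zero_fill_index[OF ik(2,1)] using entry_pair[OF S, of i k] ik by (simp add: verts_def insert_commute)
  qed
  finally show "mat_tr (S * zero_fill G x) = trace_form (verts G) (fill L x) (entry S)" .
qed

lemma trace_form_cong: "(\<And>e. e \<in> dedges L \<Longrightarrow> g e = h e) \<Longrightarrow> trace_form V (fill L x) g = trace_form V (fill L x) h"
  unfolding trace_form_def by (intro sum.cong refl) (simp add: fill_def)

lemma complete_set_iff: "complete_set G C \<longleftrightarrow> complete_in (dedges L) C"
proof -
  have "C \<subseteq> verts G" if "complete_in (dedges L) C"
  proof
    fix i assume "i \<in> C"
    then have "{i, i} \<in> dedges L" using that unfolding complete_in_def by blast
    then show "i \<in> verts G" using dedges_subset[OF scheme, of "{i, i}"] dverts by auto
  qed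
  then show ?thesis by (auto simp: complete_set_def complete_in_def dedges)
qed

text \<open>Every complete set extends to a clique, so positivity on the cliques is positivity on all complete
  sets.\<close>

lemma Q_cone_eq: "Q_cone G = {g \<in> extensional (dedges L). in_Q L g}"
proof -
  have sub: "\<exists>D\<in>cliques G. C \<subseteq> D" if C: "complete_set G C" for C
  proof -
    have "finite {D. complete_set G D}"
      by (rule finite_subset[of _ "Pow (verts G)"]) (auto simp: complete_set_def)
    from finite_has_maximal2[OF this, of C] C obtain D
      where "complete_set G D" "C \<subseteq> D" "\<forall>E. complete_set G E \<longrightarrow> D \<subseteq> E \<longrightarrow> D = E" by auto
    then show ?thesis by (auto simp: cliques_def)
  qed
  have fin: "finite D" if "D \<in> cliques G" for D
    using that finite_subset[of D "verts G"] by (auto simp: cliques_def complete_set_def)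
  have "(\<forall>C\<in>cliques G. pos_def (card C) (block C g)) \<longleftrightarrow> in_Q L g" for g
  proof -
    have "(\<forall>C\<in>cliques G. pos_def (card C) (block C g)) \<longleftrightarrow> (\<forall>C\<in>cliques G. pd_on C g)"
      using pos_def_block fin by blast
    also have "\<dots> \<longleftrightarrow> (\<forall>C. complete_set G C \<longrightarrow> pd_on C g)"
      using sub fin pd_on_subset by (metis (no_types, lifting) cliques_def mem_Collect_eq)
    also have "\<dots> \<longleftrightarrow> in_Q L g" using in_Q_iff[OF scheme] complete_set_iff by simp
    finally show ?thesis .
  qed
  then show ?thesis by (auto simp: Q_cone_def PiE_def dedges)
qed

lemma edge_part_inverse:
  assumes "in_P L x"
  defines "g \<equiv> edge_part G (inv_mat (zero_fill G x))"
  shows "in_Q L g" "\<And>e. e \<in> dedges L \<Longrightarrow> x e = precision L g e" "\<And>e. e \<in> dedges L \<Longrightarrow> covariance L x e = g e"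
proof -
  let ?h = "entry (inv_mat (zero_fill G x))"
  have gh: "g e = ?h e" if "e \<in> dedges L" for e using that by (simp add: g_def edge_part_eq)
  note inv = inv_pair_inv_mat[OF assms(1)]
  note * = inverse_in_Q[OF scheme assms(1) inv]
  show "in_Q L g" using * in_Q_cong[OF scheme, of g ?h] gh by simp
  show "x e = precision L g e" if "e \<in> dedges L" for e
    using * precision_cong[OF scheme, of g ?h e] gh that by simp
  show "covariance L x e = g e" if "e \<in> dedges L" for e
    using covariance_eq[OF scheme assms(1) inv that] gh[OF that] by simp
qed

text \<open>A candidate from \<open>PD_cone G\<close> is the inverse of a matrix in \<open>P_cone G\<close>, which is determined by the
  edge entries of that candidate through \<open>precision\<close>.\<close>

lemma completion_eq:
  assumes "g \<in> Q_cone G"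
  shows "completion G g = inv_mat (zero_fill G (precision L g))"
proof -
  let ?x = "precision L g"
  have g: "g \<in> extensional (dedges L)" "in_Q L g" using assms by (auto simp: Q_cone_eq)
  have P: "in_P L ?x" by (rule in_P_precision[OF scheme g(2)])
  have "edge_part G (inv_mat (zero_fill G ?x)) = g"
  proof
    fix e
    show "edge_part G (inv_mat (zero_fill G ?x)) e = g e"
      using inverse_precision[OF scheme g(2) inv_pair_inv_mat[OF P]] g(1)
      by (cases "e \<in> dedges L") (simp_all add: edge_part_eq extensional_def)
  qed
  moreover have "S = inv_mat (zero_fill G ?x)" if "S \<in> PD_cone G" "edge_part G S = g" for S
  proof -
    obtain A where A: "A \<in> P_cone G" "S = inv_mat A" using \<open>S \<in> PD_cone G\<close> by (auto simp: PD_cone_def)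
    have Az: "A = zero_fill G (entry A)" by (rule P_coneE[OF A(1)])
    then have "in_P L (entry A)" using zero_fill_P_cone A(1) by metis
    from edge_part_inverse(2)[OF this] have "entry A e = precision L g e" if "e \<in> dedges L" for e
      using that A(2) Az \<open>edge_part G S = g\<close> by metis
    then have "zero_fill G (entry A) = zero_fill G ?x" by (rule zero_fill_cong)
    then show ?thesis using A(2) Az by simp
  qed
  moreover have "inv_mat (zero_fill G ?x) \<in> PD_cone G"
    using P zero_fill_P_cone by (auto simp: PD_cone_def)
  ultimately show ?thesis unfolding completion_def by (intro the_equality) blast+
qed

lemma completion_props:
  assumes "g \<in> Q_cone G"
  shows "completion G g \<in> carrier_mat p p" "transpose_mat (completion G g) = completion G g"
    "inv_mat (completion G g) = zero_fill G (precision L g)"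
    "\<And>e. e \<in> dedges L \<Longrightarrow> entry (completion G g) e = g e"
proof -
  have g: "in_Q L g" using assms by (auto simp: Q_cone_eq)
  have P: "in_P L (precision L g)" by (rule in_P_precision[OF scheme g])
  then have pd: "pos_def p (zero_fill G (precision L g))" using pos_def_zero_fill by simp
  note I = pos_def_inv_mat[OF pd]
  show "completion G g \<in> carrier_mat p p" "transpose_mat (completion G g) = completion G g"
    "inv_mat (completion G g) = zero_fill G (precision L g)"
    unfolding completion_eq[OF assms] by (rule I)+
  show "\<And>e. e \<in> dedges L \<Longrightarrow> entry (completion G g) e = g e"
    unfolding completion_eq[OF assms] by (rule inverse_precision[OF scheme g inv_pair_inv_mat[OF P]])
qed

lemma mult_inverse_pair:
  fixes A B q r :: real
  assumes "q * r = 1"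
  shows "A * B = (A * q) * (B * r)"
proof -
  have "(A * q) * (B * r) = A * B * (q * r)" by (simp only: mult_ac)
  then show ?thesis using assms by simp
qed

lemma space_Leb: "space (Leb I) = extensional I"
  by (auto simp: space_PiM PiE_def)

lemma prod_pvar_pos: "in_Q L g \<Longrightarrow> (\<Prod>(v, N)\<leftarrow>L. pvar v N g powr a v N * pdet N g powr b) > 0"
  using in_Q_pvar_pos[OF scheme, of g] by (intro prod_list_pos) force

lemma prod_list_mult: "(\<Prod>(v, N)\<leftarrow>M. f v N * h v N) = (\<Prod>(v, N)\<leftarrow>M. f v N) * (\<Prod>(v, N)\<leftarrow>M. h v N)"
  for f h :: "nat \<Rightarrow> nat list \<Rightarrow> real"
  by (induction M) (auto simp: mult_ac)

text \<open>If the Markov ratio is a product of powers of residual variances, then so is the value of the integral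
  at \<open>U\<close>, with the same exponents. The condition \<open>M\<close> is the telescoping form of the density of
  \<open>\<mu>\<^sub>G\<close> along the scheme, and \<open>a v > |N| / 2\<close> is the convergence of the Gamma integrals.\<close>

theorem mem_A:
  assumes sh: "(\<alpha>, \<beta>) \<in> shapes G"
    and H: "\<And>g. in_Q L g \<Longrightarrow> markov_ratio G \<alpha> \<beta> g = (\<Prod>(v, N)\<leftarrow>L. pvar v N g powr a v)"
    and M: "\<And>g. in_Q L g \<Longrightarrow> markov_ratio G (\<lambda>C. - (real (card C) + 1) / 2) (\<lambda>S. - (real (card S) + 1) / 2) g =
      (\<Prod>(v, N)\<leftarrow>L. pvar v N g powr (- real (length N) / 2 - 1) * pdet N g powr (- 1 / 2))"
    and a: "\<And>v N. (v, N) \<in> set L \<Longrightarrow> a v > real (length N) / 2"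
  shows "(\<alpha>, \<beta>) \<in> \<A> G"
proof -
  define C where "C = (\<Prod>(v, N)\<leftarrow>L. const_Q (a v) N)"
  have C0: "C > 0" unfolding C_def using a
    by (intro prod_list_pos) (force simp: const_Q_def intro!: mult_pos_pos Gamma_real_pos)
  let ?d = "\<lambda>g. \<Prod>(v, N)\<leftarrow>L. pvar v N g powr (- real (length N) / 2 - 1) * pdet N g powr (- 1 / 2)"
  have dpos: "?d g > 0" if "in_Q L g" for g using prod_pvar_pos[OF that] .
  have dm: "?d \<in> borel_measurable (Leb (dedges L))"
    by (rule measurable_prod_pvar[OF scheme component_measurable])
  have Qs: "Q_cone G \<inter> space (Leb (dedges L)) \<in> sets (Leb (dedges L))"
  proof -
    have "{g \<in> space (Leb (dedges L)). in_Q L g} \<in> sets (Leb (dedges L))"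
      using measurable_in_Q[OF scheme component_measurable, of "\<lambda>e. e"] by measurable
    moreover have "{g \<in> space (Leb (dedges L)). in_Q L g} = Q_cone G \<inter> space (Leb (dedges L))"
      unfolding space_Leb Q_cone_eq by auto
    ultimately show ?thesis by simp
  qed
  have main: "integral_Q G \<alpha> \<beta> U = ennreal (C * markov_ratio G \<alpha> \<beta> U)" if U: "U \<in> Q_cone G" for U
  proof -
    have UQ: "in_Q L U" using U by (simp add: Q_cone_eq)
    have wm: "weight_Q a L U \<in> borel_measurable (Leb (dedges L))"
      using measurable_weight_Q[where a = a and U = U, OF scheme component_measurable] by simp
    have f: "weight_Q a L U g = exp (- mat_tr (completion G g * inv_mat (completion G U))) * markov_ratio G \<alpha> \<beta> g * ?d g"
      if g: "g \<in> Q_cone G" for g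
    proof -
      have gQ: "in_Q L g" using g by (simp add: Q_cone_eq)
      have "mat_tr (completion G g * inv_mat (completion G U)) = trace_form (verts G) (fill L (precision L U)) (entry (completion G g))"
        unfolding completion_props(3)[OF U] by (rule mat_tr_zero_fill(2)[OF completion_props(1,2)[OF g]])
      also have "\<dots> = trace_form (verts G) (fill L (precision L U)) g"
        by (rule trace_form_cong) (rule completion_props(4)[OF g])
      finally have tr: "mat_tr (completion G g * inv_mat (completion G U)) = trace_form (verts G) (fill L (precision L U)) g" .
      have "(\<Prod>(v, N)\<leftarrow>L. pvar v N g powr (a v - real (length N) / 2 - 1) * pdet N g powr (- 1 / 2)) =
          (\<Prod>(v, N)\<leftarrow>L. pvar v N g powr a v * (pvar v N g powr (- real (length N) / 2 - 1) * pdet N g powr (- 1 / 2)))"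
      proof (intro arg_cong[where f = prod_list] map_cong refl, clarify)
        fix v N
        show "pvar v N g powr (a v - real (length N) / 2 - 1) * pdet N g powr (- 1 / 2) =
           pvar v N g powr a v * (pvar v N g powr (- real (length N) / 2 - 1) * pdet N g powr (- 1 / 2))"
          by (simp add: powr_add[symmetric] mult.assoc[symmetric] algebra_simps)
      qed
      also have "\<dots> = markov_ratio G \<alpha> \<beta> g * ?d g" unfolding prod_list_mult H[OF gQ] ..
      finally show ?thesis
        using weight_Q_eq[OF scheme UQ gQ] by (simp add: dverts tr mult.assoc)
    qed
    have "integral_Q G \<alpha> \<beta> U = (\<integral>\<^sup>+g. ennreal (exp (- mat_tr (completion G g * inv_mat (completion G U))) * markov_ratio G \<alpha> \<beta> g)
        \<partial>density (restrict_space (Leb (dedges L)) (Q_cone G)) (\<lambda>g. ennreal (markov_ratio G (\<lambda>C. - (real (card C) + 1) / 2) (\<lambda>S. - (real (card S) + 1) / 2) g)))"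
      by (simp add: integral_Q_def mu_def edge_lebesgue_def dedges)
    also have "\<dots> = (\<integral>\<^sup>+g. ennreal (weight_Q a L U g) \<partial>Leb (dedges L))"
    proof (rule nn_integral_density_restrict[OF dm wm Qs])
      fix g assume g: "g \<in> Q_cone G"
      then have gQ: "in_Q L g" by (simp add: Q_cone_eq)
      show "?d g > 0" by (rule dpos[OF gQ])
      show "markov_ratio G (\<lambda>C. - (real (card C) + 1) / 2) (\<lambda>S. - (real (card S) + 1) / 2) g = ?d g"
        by (rule M[OF gQ])
      show "weight_Q a L U g = exp (- mat_tr (completion G g * inv_mat (completion G U))) * markov_ratio G \<alpha> \<beta> g * ?d g"
        by (rule f[OF g])
    next
      fix g assume "g \<in> space (Leb (dedges L))" "g \<notin> Q_cone G"
      then show "weight_Q a L U g = 0" using weight_Q_pos_in_Q[of a L U g] by (auto simp: space_Leb Q_cone_eq)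
    qed
    also have "\<dots> = ennreal (\<Prod>(v, N)\<leftarrow>L. const_Q (a v) N * pvar v N U powr a v)"
      by (rule nn_integral_weight_Q[OF scheme UQ]) (rule a)
    also have "\<dots> = ennreal (C * markov_ratio G \<alpha> \<beta> U)"
      unfolding C_def H[OF UQ] prod_list_mult ..
    finally show ?thesis .
  qed
  have Hpos: "markov_ratio G \<alpha> \<beta> U > 0" if "U \<in> Q_cone G" for U
  proof -
    have UQ: "in_Q L U" using that by (simp add: Q_cone_eq)
    show ?thesis unfolding H[OF UQ] using in_Q_pvar_pos[OF scheme UQ] by (intro prod_list_pos) force
  qed
  have "integral_Q G \<alpha> \<beta> U / ennreal (markov_ratio G \<alpha> \<beta> U) = ennreal C" if "U \<in> Q_cone G" for U
    unfolding main[OF that] using Hpos[OF that] C0 by (simp add: divide_ennreal)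
  then show ?thesis using sh main by (auto simp: \<A>_def)
qed

text \<open>In contrast to the previous theorem the Markov ratio carries the factors \<open>pdet N g powr (- 1 / 2)\<close>, which
  are the determinants left by the Gaussian integrals over the precision entries.\<close>

theorem mem_B:
  assumes sh: "(\<alpha>, \<beta>) \<in> shapes G"
    and H: "\<And>g. in_Q L g \<Longrightarrow> markov_ratio G \<alpha> \<beta> g = (\<Prod>(v, N)\<leftarrow>L. pvar v N g powr a v * pdet N g powr (- 1 / 2))"
    and M: "\<And>g. in_Q L g \<Longrightarrow> markov_ratio G (\<lambda>C. (real (card C) + 1) / 2) (\<lambda>S. (real (card S) + 1) / 2) g =
      (\<Prod>(v, N)\<leftarrow>L. pvar v N g powr (real (length N) / 2 + 1) * pdet N g powr (1 / 2))"
    and a: "\<And>v N. (v, N) \<in> set L \<Longrightarrow> a v < 0"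
  shows "(\<alpha>, \<beta>) \<in> \<B> G"
proof -
  define C where "C = (\<Prod>(v, N)\<leftarrow>L. const_P (a v) N)"
  have C0: "C > 0" unfolding C_def using a
    by (intro prod_list_pos) (force simp: const_P_def intro!: mult_pos_pos Gamma_real_pos)
  let ?d = "\<lambda>g. \<Prod>(v, N)\<leftarrow>L. pvar v N g powr (real (length N) / 2 + 1) * pdet N g powr (1 / 2)"
  let ?D = "\<lambda>x. ?d (covariance L x)"
  let ?g = "\<lambda>x. edge_part G (inv_mat (zero_fill G x))"
  let ?P = "{x. zero_fill G x \<in> P_cone G}"
  have dpos: "?d g > 0" if "in_Q L g" for g using prod_pvar_pos[OF that] .
  have P: "x \<in> ?P \<longleftrightarrow> in_P L x" for x using zero_fill_P_cone by simp
  have Dm: "?D \<in> borel_measurable (Leb (dedges L))"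
    by (intro measurable_prod_pvar[OF scheme] measurable_covariance[OF scheme] component_measurable)
  have Ps: "?P \<inter> space (Leb (dedges L)) \<in> sets (Leb (dedges L))"
  proof -
    have "{x \<in> space (Leb (dedges L)). in_P L x} \<in> sets (Leb (dedges L))"
      using measurable_in_P[OF scheme component_measurable, of "\<lambda>e. e"] by measurable
    moreover have "{x \<in> space (Leb (dedges L)). in_P L x} = ?P \<inter> space (Leb (dedges L))"
      using P by auto
    ultimately show ?thesis by simp
  qed
  have Dg: "?D x = ?d (?g x)" if x: "in_P L x" for x
  proof (intro arg_cong[where f = prod_list] map_cong refl)
    fix p assume p: "p \<in> set L"
    obtain v N where vN: "p = (v, N)" by (cases p)
    obtain L' where L': "scheme ((v, N) # L')" "dedges ((v, N) # L') \<subseteq> dedges L"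
      using scheme_suffix[OF scheme] p vN by blast
    have eqs: "covariance L x e = ?g x e" if "e \<in> dedges ((v, N) # L')" for e
      using edge_part_inverse(3)[OF x] L'(2) that by blast
    have "pvar v N (covariance L x) = pvar v N (?g x)"
      by (rule pvar_cong(1)[OF L'(1)]) (rule eqs)
    moreover have "pdet N (covariance L x) = pdet N (?g x)"
      by (rule pvar_cong(2)[OF L'(1)]) (rule eqs)
    ultimately show "(case p of (v, N) \<Rightarrow> pvar v N (covariance L x) powr (real (length N) / 2 + 1) * pdet N (covariance L x) powr (1 / 2)) =
       (case p of (v, N) \<Rightarrow> pvar v N (?g x) powr (real (length N) / 2 + 1) * pdet N (?g x) powr (1 / 2))"
      by (simp add: vN)
  qed
  have Dpos: "?D x > 0" if "in_P L x" for x
    unfolding Dg[OF that] by (rule dpos[OF edge_part_inverse(1)[OF that]])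
  have main: "integral_P G \<alpha> \<beta> U = ennreal (C * markov_ratio G \<alpha> \<beta> U)" if U: "U \<in> Q_cone G" for U
  proof -
    have UQ: "in_Q L U" using U by (simp add: Q_cone_eq)
    have wm: "weight_P a L U \<in> borel_measurable (Leb (dedges L))"
      using measurable_weight_P[where a = a and U = U, OF scheme component_measurable] by simp
    have f: "weight_P a L U x = exp (- mat_tr (zero_fill G x * completion G U)) * markov_ratio G \<alpha> \<beta> (?g x) * ?D x"
      if x: "in_P L x" for x
    proof -
      note gQ = edge_part_inverse(1)[OF x]
      have "mat_tr (zero_fill G x * completion G U) = trace_form (verts G) (fill L x) (entry (completion G U))"
        by (rule mat_tr_zero_fill(1)[OF completion_props(1,2)[OF U]])
      also have "\<dots> = trace_form (verts G) (fill L x) U"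
        by (rule trace_form_cong) (rule completion_props(4)[OF U])
      finally have tr: "mat_tr (zero_fill G x * completion G U) = trace_form (verts G) (fill L x) U" .
      have "(\<Prod>(v, N)\<leftarrow>L. pvar v N (?g x) powr (a v + real (length N) / 2 + 1)) =
          (\<Prod>(v, N)\<leftarrow>L. (pvar v N (?g x) powr a v * pdet N (?g x) powr (- 1 / 2)) *
            (pvar v N (?g x) powr (real (length N) / 2 + 1) * pdet N (?g x) powr (1 / 2)))"
      proof (intro arg_cong[where f = prod_list] map_cong refl, clarify)
        fix v N assume "(v, N) \<in> set L"
        then have "pdet N (?g x) > 0" using in_Q_pvar_pos[OF scheme gQ] by blast
        then have inv: "pdet N (?g x) powr (- 1 / 2) * pdet N (?g x) powr (1 / 2) = 1"
          by (simp flip: powr_add)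
        have split: "pvar v N (?g x) powr (a v + real (length N) / 2 + 1) =
            pvar v N (?g x) powr a v * pvar v N (?g x) powr (real (length N) / 2 + 1)"
          by (simp add: powr_add[symmetric] add.assoc)
        show "pvar v N (?g x) powr (a v + real (length N) / 2 + 1) =
          (pvar v N (?g x) powr a v * pdet N (?g x) powr (- 1 / 2)) *
            (pvar v N (?g x) powr (real (length N) / 2 + 1) * pdet N (?g x) powr (1 / 2))"
          unfolding split by (rule mult_inverse_pair[OF inv])
      qed
      also have "\<dots> = markov_ratio G \<alpha> \<beta> (?g x) * ?d (?g x)" unfolding prod_list_mult H[OF gQ] by simp
      finally show ?thesis
        using weight_P_eq[OF scheme x gQ edge_part_inverse(2)[OF x]] Dg[OF x] by (simp add: dverts tr mult.assoc)
    qed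
    have "integral_P G \<alpha> \<beta> U = (\<integral>\<^sup>+x. ennreal (exp (- mat_tr (zero_fill G x * completion G U)) * markov_ratio G \<alpha> \<beta> (?g x))
        \<partial>density (restrict_space (Leb (dedges L)) ?P) (\<lambda>x. ennreal (markov_ratio G (\<lambda>C. (real (card C) + 1) / 2) (\<lambda>S. (real (card S) + 1) / 2) (?g x))))"
      by (simp add: integral_P_def nu_def edge_lebesgue_def dedges)
    also have "\<dots> = (\<integral>\<^sup>+x. ennreal (weight_P a L U x) \<partial>Leb (dedges L))"
    proof (rule nn_integral_density_restrict[OF Dm wm Ps])
      fix x assume "x \<in> ?P"
      then have x: "in_P L x" using P by blast
      show "?D x > 0" by (rule Dpos[OF x])
      show "markov_ratio G (\<lambda>C. (real (card C) + 1) / 2) (\<lambda>S. (real (card S) + 1) / 2) (?g x) = ?D x"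
        using M[OF edge_part_inverse(1)[OF x]] Dg[OF x] by simp
      show "weight_P a L U x = exp (- mat_tr (zero_fill G x * completion G U)) * markov_ratio G \<alpha> \<beta> (?g x) * ?D x"
        by (rule f[OF x])
    next
      fix x assume "x \<notin> ?P"
      then show "weight_P a L U x = 0" using P weight_P_pos_in_P[of a L U x] by blast
    qed
    also have "\<dots> = ennreal (\<Prod>(v, N)\<leftarrow>L. const_P (a v) N * pvar v N U powr a v * pdet N U powr (- 1 / 2))"
      by (rule nn_integral_weight_P[OF scheme UQ]) (rule a)
    also have "\<dots> = ennreal (C * markov_ratio G \<alpha> \<beta> U)"
      unfolding C_def H[OF UQ] mult.assoc prod_list_mult ..
    finally show ?thesis .
  qed
  have Hpos: "markov_ratio G \<alpha> \<beta> U > 0" if "U \<in> Q_cone G" for U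
    using prod_pvar_pos[of U "\<lambda>v N. a v" "- 1 / 2"] H[of U] that by (simp add: Q_cone_eq)
  have "integral_P G \<alpha> \<beta> U / ennreal (markov_ratio G \<alpha> \<beta> U) = ennreal C" if "U \<in> Q_cone G" for U
    unfolding main[OF that] using Hpos[OF that] C0 by (simp add: divide_ennreal)
  then show ?thesis using sh main by (auto simp: \<B>_def)
qed

end

section \<open>Graphs with an elimination scheme\<close>

lemma (in elimination_scheme) is_graph: "is_graph G"
proof -
  have "e \<in> {{i, j} | i j. i \<in> verts G \<and> j \<in> verts G}" if e: "e \<in> dedges L" for e
  proof -
    have sub: "e \<subseteq> verts G" using dedges_subset[OF scheme e] dverts by simp
    have "\<exists>i j. e = {i, j}" using e
      by (induction L rule: dedges.induct) (auto simp: star_def)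
    then show ?thesis using sub by blast
  qed
  moreover have "{i} \<in> dedges L" if "i \<in> verts G" for i
    using loop_in_dedges[of i L] that dverts by simp
  ultimately show ?thesis unfolding is_graph_def dedges[symmetric] by blast
qed

lemma mod_less_double: "m < 2 * n \<Longrightarrow> m mod n = (if m < n then m else m - n)" for m n :: nat
  using le_mod_geq[of n m] by (cases "m < n") simp_all

text \<open>The two neighbours on the cycle of its first eliminated vertex are parents of that vertex, hence
  adjacent.\<close>

lemma scheme_chord:
  assumes "scheme L" "distinct vs" "4 \<le> length vs" "set vs \<subseteq> dverts L"
    and "\<And>k. k < length vs \<Longrightarrow> {vs ! k, vs ! ((k + 1) mod length vs)} \<in> dedges L"
  shows "\<exists>k<length vs. \<exists>l<length vs. k \<noteq> l \<and> l \<noteq> (k + 1) mod length vs \<and>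
    k \<noteq> (l + 1) mod length vs \<and> {vs ! k, vs ! l} \<in> dedges L"
  using assms
proof (induction L)
  case Nil
  then show ?case by auto
next
  case (Cons p L)
  obtain v N where p: "p = (v, N)" by (cases p)
  have sch: "scheme ((v, N) # L)" using Cons.prems p by simp
  let ?n = "length vs"
  have rest: "{a, b} \<in> dedges L" if "{a, b} \<in> dedges ((v, N) # L)" "a \<noteq> v" "b \<noteq> v" for a b
    using that by (auto simp: star_def doubleton_eq_iff)
  show ?case
  proof (cases "v \<in> set vs")
    case False
    then have nv: "vs ! k \<noteq> v" if "k < ?n" for k using that nth_mem by metis
    have lt: "(k + 1) mod ?n < ?n" for k
      using Cons.prems(3) by (intro mod_less_divisor) linarith
    have "{vs ! k, vs ! ((k + 1) mod ?n)} \<in> dedges L" if "k < ?n" for k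
      using Cons.prems(5)[OF that] nv[OF that] nv[OF lt] p by (intro rest) auto
    moreover have "set vs \<subseteq> dverts L" using Cons.prems(4) False p by auto
    ultimately have "\<exists>k<?n. \<exists>l<?n. k \<noteq> l \<and> l \<noteq> (k + 1) mod ?n \<and> k \<noteq> (l + 1) mod ?n \<and> {vs ! k, vs ! l} \<in> dedges L"
      using Cons.IH Cons.prems sch by auto
    then show ?thesis by (auto simp: p)
  next
    case True
    then obtain k where k: "k < ?n" "vs ! k = v" by (auto simp: in_set_conv_nth)
    \<comment> \<open>\<open>l\<close> and \<open>m\<close> are the successor and the predecessor of \<open>k\<close> on the cycle.\<close>
    define l where "l = (if k + 1 < ?n then k + 1 else 0)"
    define m where "m = (if k = 0 then ?n - 1 else k - 1)"
    have lm: "l < ?n" "m < ?n" "l \<noteq> k" "m \<noteq> k" "l \<noteq> m" "(k + 1) mod ?n = l" "(m + 1) mod ?n = k"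
      "(l + 1) mod ?n \<noteq> m"
      using k Cons.prems(3) by (auto simp: l_def m_def mod_less_double)
    have nbr: "w \<in> set N" if "{v, w} \<in> dedges ((v, N) # L)" "w \<noteq> v" for w
      using that not_in_dedges[OF sch] by (auto simp: star_def doubleton_eq_iff)
    have "vs ! l \<noteq> v" "vs ! m \<noteq> v" using k lm Cons.prems(2) nth_eq_iff_index_eq by metis+
    moreover have "{v, vs ! l} \<in> dedges ((v, N) # L)" using Cons.prems(5)[OF k(1)] lm k p by simp
    moreover have "{v, vs ! m} \<in> dedges ((v, N) # L)"
      using Cons.prems(5)[OF lm(2)] lm k p by (simp add: insert_commute)
    ultimately have "vs ! l \<in> set N" "vs ! m \<in> set N" using nbr by blast+
    then have "{vs ! l, vs ! m} \<in> dedges (p # L)" using sch p by auto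
    moreover have "m \<noteq> (l + 1) mod ?n" "l \<noteq> (m + 1) mod ?n" using lm by auto
    ultimately show ?thesis using lm by blast
  qed
qed

lemma (in elimination_scheme) decomposable: "decomposable G"
  unfolding decomposable_def is_cycle_def has_chord_def dedges[symmetric] dverts[symmetric]
proof (intro allI impI, elim conjE)
  fix vs
  assume vs: "distinct vs" "4 \<le> length vs" "set vs \<subseteq> dverts L"
    and edge: "\<forall>k<length vs. {vs ! k, vs ! ((k + 1) mod length vs)} \<in> dedges L"
  show "\<exists>k<length vs. \<exists>l<length vs. k \<noteq> l \<and> l \<noteq> (k + 1) mod length vs \<and>
    k \<noteq> (l + 1) mod length vs \<and> {vs ! k, vs ! l} \<in> dedges L"
    by (rule scheme_chord[OF scheme vs edge[rule_format]])
qed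

text \<open>By elimination every complete set lies in a family \<open>insert v (set N)\<close>; so the cliques are the members
  of the given antichain as soon as these are complete and contain all families.\<close>

lemma graph_of_scheme:
  assumes L: "scheme L" "dverts L = {1..p}"
    and families: "\<And>v N. (v, N) \<in> set L \<Longrightarrow> \<exists>C\<in>\<C>. insert v (set N) \<subseteq> C"
    and complete: "\<And>C. C \<in> \<C> \<Longrightarrow> complete_in (dedges L) C"
    and antichain: "\<And>C D. C \<in> \<C> \<Longrightarrow> D \<in> \<C> \<Longrightarrow> C \<subseteq> D \<Longrightarrow> C = D"
    and "\<C> \<noteq> {}" 
  shows "elimination_scheme (graph_of p \<C>) L" "cliques (graph_of p \<C>) = \<C>"
proof -
  have E: "edges (graph_of p \<C>) = {{i, j} | i j. \<exists>C\<in>\<C>. i \<in> C \<and> j \<in> C}"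
    by (simp add: edges_def graph_of_def)
  have "dedges M \<subseteq> edges (graph_of p \<C>)" if "set M \<subseteq> set L" for M
    using that
  proof (induction M)
    case (Cons q M)
    obtain v N where q: "q = (v, N)" by (cases q)
    have "(v, N) \<in> set L" using Cons.prems q by simp
    from families[OF this] obtain C where C: "C \<in> \<C>" "insert v (set N) \<subseteq> C" by blast
    have "{v, u} \<in> edges (graph_of p \<C>)" if "u \<in> insert v (set N)" for u
      using C that unfolding E by blast
    then have "star v N \<subseteq> edges (graph_of p \<C>)" unfolding star_def by force
    then show ?case using Cons q by auto
  qed simp
  moreover have "edges (graph_of p \<C>) \<subseteq> dedges L"
    using complete unfolding E complete_in_def by blast
  ultimately show es: "elimination_scheme (graph_of p \<C>) L"
    using L by unfold_locales (auto simp: verts_def graph_of_def)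
  interpret elimination_scheme "graph_of p \<C>" L by (rule es)
  have sub: "\<exists>D\<in>\<C>. X \<subseteq> D" if X: "complete_in (dedges L) X" for X
  proof (cases "X = {}")
    case True
    then show ?thesis using \<open>\<C> \<noteq> {}\<close> by blast
  next
    case False
    then obtain v N where "(v, N) \<in> set L" "X \<subseteq> insert v (set N)"
      using complete_in_scheme_subset[OF L(1) X] by auto
    then show ?thesis using families by (meson order_trans)
  qed
  show "cliques (graph_of p \<C>) = \<C>"
    unfolding cliques_def complete_set_iff
  proof (intro equalityI subsetI)
    fix C assume "C \<in> {C. complete_in (dedges L) C \<and> (\<forall>D. complete_in (dedges L) D \<and> C \<subseteq> D \<longrightarrow> D = C)}"
    then show "C \<in> \<C>" using sub complete by blast
  next
    fix C assume C: "C \<in> \<C>"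
    have "D = C" if D: "complete_in (dedges L) D" "C \<subseteq> D" for D
    proof -
      obtain D' where D': "D' \<in> \<C>" "D \<subseteq> D'" using sub D(1) by blast
      then have "C = D'" using antichain[OF C D'(1)] D(2) by blast
      then show ?thesis using D' D(2) by blast
    qed
    then show "C \<in> {C. complete_in (dedges L) C \<and> (\<forall>D. complete_in (dedges L) D \<and> C \<subseteq> D \<longrightarrow> D = C)}"
      using complete[OF C] by blast
  qed
qed

lemma not_homogeneousI:
  assumes "{i, j, a, b} \<subseteq> verts G" "i \<noteq> j" "a \<noteq> i" "a \<noteq> j" "b \<noteq> i" "b \<noteq> j"
    and "{i, j} \<in> edges G" "{i, a} \<in> edges G" "{j, b} \<in> edges G" "{j, a} \<notin> edges G" "{i, b} \<notin> edges G"
  shows "\<not> homogeneous G"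
proof
  assume "homogeneous G"
  moreover have "i \<in> verts G" "j \<in> ne G i" using assms by (auto simp: ne_def)
  ultimately have "ne G j \<union> {j} \<subseteq> ne G i \<union> {i} \<or> ne G i \<union> {i} \<subseteq> ne G j \<union> {j}"
    unfolding homogeneous_def by blast
  moreover have "a \<in> ne G i" "a \<notin> ne G j \<union> {j}" "b \<in> ne G j" "b \<notin> ne G i \<union> {i}"
    using assms by (auto simp: ne_def)
  ultimately show False by blast
qed

section \<open>Separators that violate the linear constraints\<close>

lemma hist_take: "n \<le> length P \<Longrightarrow> hist P n = \<Union>(set (take n P))"
proof -
  assume "n \<le> length P"
  then have "set (take n P) = (!) P ` {..<n}" by (simp add: nth_image lessThan_atLeast0)
  moreover have "{..<n} = (\<lambda>i. i - 1) ` {1..n}"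
    by (auto intro!: image_eqI[where x = "Suc _"])
  ultimately show ?thesis by (simp add: hist_def clq_def image_image)
qed

lemma sep_take: "1 \<le> j \<Longrightarrow> j \<le> length P \<Longrightarrow> sep P j = \<Union>(set (take (j - 1) P)) \<inter> P ! (j - 1)"
  by (simp add: sep_def clq_def hist_take)

lemma simple_separator:
  assumes Q: "Q \<in> Ord G" and 1: "sep_mult G S = 1"
  obtains j where "Jset Q S = {j}" "sep Q j = S" "clq Q j \<in> cliques G" "S \<subseteq> clq Q j"
proof -
  have "card (Jset Q S) = 1" using sep_mult_eq[OF Q] 1 by simp
  then obtain j where j: "Jset Q S = {j}" by (auto simp: card_1_singleton_iff)
  then have "j \<in> {2..length Q}" "sep Q j = S" by (auto simp: Jset_def)
  moreover from this(1) have "clq Q j \<in> cliques G" by (intro clq_in[OF Q]) simp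
  ultimately show ?thesis using that[of j] j sep_subset_clq[of Q j] by blast
qed

text \<open>A perfect order exempts only \<open>S\<^sub>2\<close> from the linear constraint, so one of two distinct separators
  \<open>S\<close>, \<open>T\<close> is constrained. If that one is simple, then its constraint equates its \<open>\<beta>\<close> with \<open>\<alpha>\<close> at
  some clique containing it.\<close>

lemma not_mem_A_ord:
  assumes S: "S \<in> separators G" "T \<in> separators G" "S \<noteq> T" "sep_mult G S = 1" "sep_mult G T = 1"
    and ne: "\<And>C. C \<in> cliques G \<Longrightarrow> S \<subseteq> C \<Longrightarrow> \<alpha> C \<noteq> \<beta> S" "\<And>C. C \<in> cliques G \<Longrightarrow> T \<subseteq> C \<Longrightarrow> \<alpha> C \<noteq> \<beta> T"
  shows "(\<alpha>, \<beta>) \<notin> (\<Union>P\<in>Ord G. A_ord G P)"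
proof
  assume "(\<alpha>, \<beta>) \<in> (\<Union>P\<in>Ord G. A_ord G P)"
  then obtain Q where Q: "Q \<in> Ord G" "(\<alpha>, \<beta>) \<in> A_ord G Q" by blast
  have a: "R = sep Q 2" if R: "R \<in> separators G" "sep_mult G R = 1" and ne: "\<And>C. C \<in> cliques G \<Longrightarrow> R \<subseteq> C \<Longrightarrow> \<alpha> C \<noteq> \<beta> R" for R
  proof (rule ccontr)
    assume "R \<noteq> sep Q 2"
    then have "(\<Sum>j\<in>Jset Q R. \<alpha> (clq Q j)) - real (sep_mult G R) * \<beta> R = 0"
      using Q(2) R(1) unfolding A_ord_def Let_def by blast
    moreover obtain j where j: "Jset Q R = {j}" "sep Q j = R" "clq Q j \<in> cliques G" "R \<subseteq> clq Q j"
      by (rule simple_separator[OF Q(1) R(2)])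
    ultimately show False using ne[OF j(3,4)] R(2) j(1) by simp
  qed
  have "S = sep Q 2" by (rule a[OF S(1,4) ne(1)])
  moreover have "T = sep Q 2" by (rule a[OF S(2,5) ne(2)])
  ultimately show False using S(3) by simp
qed

text \<open>The same argument for the shifted constraints.\<close>

lemma not_mem_B_ord:
  assumes S: "S \<in> separators G" "T \<in> separators G" "S \<noteq> T" "sep_mult G S = 1" "sep_mult G T = 1"
    and ne: "\<And>C. C \<in> cliques G \<Longrightarrow> S \<subseteq> C \<Longrightarrow> \<alpha> C + (real (card C) - real (card S)) / 2 \<noteq> \<beta> S"
      "\<And>C. C \<in> cliques G \<Longrightarrow> T \<subseteq> C \<Longrightarrow> \<alpha> C + (real (card C) - real (card T)) / 2 \<noteq> \<beta> T"
  shows "(\<alpha>, \<beta>) \<notin> (\<Union>P\<in>Ord G. B_ord G P)"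
proof
  assume "(\<alpha>, \<beta>) \<in> (\<Union>P\<in>Ord G. B_ord G P)"
  then obtain Q where Q: "Q \<in> Ord G" "(\<alpha>, \<beta>) \<in> B_ord G Q" by blast
  have a: "R = sep Q 2" if R: "R \<in> separators G" "sep_mult G R = 1"
    and ne: "\<And>C. C \<in> cliques G \<Longrightarrow> R \<subseteq> C \<Longrightarrow> \<alpha> C + (real (card C) - real (card R)) / 2 \<noteq> \<beta> R" for R
  proof (rule ccontr)
    assume "R \<noteq> sep Q 2"
    then have "(\<Sum>j\<in>Jset Q R. \<alpha> (clq Q j) + (real (card (clq Q j)) - real (card (sep Q j))) / 2)
        - real (sep_mult G R) * \<beta> R = 0"
      using Q(2) R(1) unfolding B_ord_def Let_def by blast
    moreover obtain j where j: "Jset Q R = {j}" "sep Q j = R" "clq Q j \<in> cliques G" "R \<subseteq> clq Q j"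
      by (rule simple_separator[OF Q(1) R(2)])
    ultimately show False using ne[OF j(3,4)] R(2) j(1,2) by simp
  qed
  have "S = sep Q 2" by (rule a[OF S(1,4) ne(1)])
  moreover have "T = sep Q 2" by (rule a[OF S(2,5) ne(2)])
  ultimately show False using S(3) by simp
qed

section \<open>Determinants of clique blocks\<close>

lemma det_mat_2:
  assumes A: "A \<in> carrier_mat 2 2"
  shows "det A = A $$ (0, 0) * A $$ (1, 1) - A $$ (0, 1) * A $$ (1, 0)"
proof -
  have 1: "det (mat_delete A 0 0) = A $$ (1, 1)" "det (mat_delete A 0 1) = A $$ (1, 0)"
    using A by (simp_all add: mat_delete_def det_single)
  have "det A = (\<Sum>j<2. A $$ (0, j) * cofactor A 0 j)"
    by (rule laplace_expansion_row[OF A]) simp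
  also have "\<dots> = A $$ (0, 0) * A $$ (1, 1) - A $$ (0, 1) * A $$ (1, 0)"
    using 1 by (simp add: cofactor_def lessThan_Suc numeral_2_eq_2)
  finally show ?thesis .
qed

lemma det_mat_3:
  assumes A: "A \<in> carrier_mat 3 3"
  shows "det A = A $$ (0, 0) * (A $$ (1, 1) * A $$ (2, 2) - A $$ (1, 2) * A $$ (2, 1))
    - A $$ (0, 1) * (A $$ (1, 0) * A $$ (2, 2) - A $$ (1, 2) * A $$ (2, 0))
    + A $$ (0, 2) * (A $$ (1, 0) * A $$ (2, 1) - A $$ (1, 1) * A $$ (2, 0))"
proof -
  have c: "mat_delete A 0 j \<in> carrier_mat 2 2" for j
    using mat_delete_carrier[of A 3 3 0 j] A by simp
  have m: "det (mat_delete A 0 0) = A $$ (1, 1) * A $$ (2, 2) - A $$ (1, 2) * A $$ (2, 1)"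
    "det (mat_delete A 0 1) = A $$ (1, 0) * A $$ (2, 2) - A $$ (1, 2) * A $$ (2, 0)"
    "det (mat_delete A 0 2) = A $$ (1, 0) * A $$ (2, 1) - A $$ (1, 1) * A $$ (2, 0)"
    unfolding det_mat_2[OF c] using A by (simp_all add: mat_delete_def numeral_2_eq_2)
  have "det A = (\<Sum>j<3. A $$ (0, j) * cofactor A 0 j)"
    by (rule laplace_expansion_row[OF A]) simp
  also have "{..<3} = {0, 1, 2::nat}" by auto
  also have "(\<Sum>j\<in>{0, 1, 2}. A $$ (0, j) * cofactor A 0 j) =
     A $$ (0, 0) * det (mat_delete A 0 0) - A $$ (0, 1) * det (mat_delete A 0 1) + A $$ (0, 2) * det (mat_delete A 0 2)"
    by (simp add: cofactor_def)
  finally show ?thesis unfolding m .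
qed

lemma det_block_1: "det (block {u} g) = g {u}"
  by (subst det_single) (simp_all add: block_def)

lemma det_block_2:
  assumes "u \<noteq> w"
  shows "det (block {u, w} g) = g {u} * g {w} - (g {u, w})\<^sup>2"
proof -
  have *: "det (block {u, w} g) = g {u} * g {w} - (g {u, w})\<^sup>2" if "u < w" for u w
  proof -
    have "sorted_list_of_set {u, w} = [u, w]"
      using that by (intro sorted_list_of_set_unique[THEN iffD1]) auto
    moreover have "card {u, w} = 2" using that by simp
    ultimately show ?thesis
      by (subst det_mat_2) (auto simp: block_def power2_eq_square insert_commute)
  qed
  show ?thesis using *[of u w] *[of w u] assms by (cases "u < w") (auto simp: insert_commute mult.commute)
qed

lemma det_block_3:
  assumes "u \<noteq> v" "u \<noteq> w" "v \<noteq> w"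
  shows "det (block {v, u, w} g) = g {v} * (g {u} * g {w} - (g {u, w})\<^sup>2) - (g {v, u})\<^sup>2 * g {w}
    + 2 * g {v, u} * g {v, w} * g {u, w} - (g {v, w})\<^sup>2 * g {u}"
proof -
  define D where "D a b c = g {a} * (g {b} * g {c} - (g {b, c})\<^sup>2) - (g {a, b})\<^sup>2 * g {c}
    + 2 * g {a, b} * g {a, c} * g {b, c} - (g {a, c})\<^sup>2 * g {b}" for a b c
  have sym: "D a b c = D b a c" "D a b c = D a c b" for a b c
    by (simp_all add: D_def insert_commute algebra_simps)
  have *: "det (block {a, b, c} g) = D a b c" if "a < b" "b < c" for a b c
  proof -
    have "sorted_list_of_set {a, b, c} = [a, b, c]"
      using that by (intro sorted_list_of_set_unique[THEN iffD1]) auto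
    moreover have "card {a, b, c} = 3" using that by simp
    ultimately have b: "block {a, b, c} g = mat 3 3 (\<lambda>(i, j). g {[a, b, c] ! i, [a, b, c] ! j})"
      by (simp add: block_def)
    have c: "{b, a} = {a, b}" "{c, a} = {a, c}" "{c, b} = {b, c}" by auto
    show ?thesis unfolding b D_def
      by (subst det_mat_3) (simp_all add: numeral_2_eq_2 c power2_eq_square algebra_simps)
  qed
  have "{v, u, w} = {u, v, w}" "{v, u, w} = {v, w, u}" "{v, u, w} = {u, w, v}" "{v, u, w} = {w, u, v}" "{v, u, w} = {w, v, u}"
    by auto
  then have "det (block {v, u, w} g) = D v u w"
    using *[of u v w] *[of v u w] *[of v w u] *[of u w v] *[of w u v] *[of w v u] sym assms
    by (metis linorder_neqE_nat)
  then show ?thesis by (simp add: D_def)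
qed

lemma det_block_family:
  assumes "length N \<le> 2" "distinct N" "v \<notin> set N" "pdet N g \<noteq> 0"
  shows "det (block (insert v (set N)) g) = pvar v N g * pdet N g"
  using assms(1,2)
proof (cases rule: parent_list_cases)
  case 1
  then show ?thesis by (simp add: det_block_1 pvar_def)
next
  case (2 u)
  then show ?thesis using assms by (simp add: det_block_2 pvar_def field_simps power2_eq_square)
next
  case (3 u w)
  let ?D = "g {u} * g {w} - (g {u, w})\<^sup>2"
  have D: "?D \<noteq> 0" using assms(4) 3 by simp
  have "pvar v N g * ?D = g {v} * ?D - ((g {v, u} * g {w} - g {v, w} * g {u, w}) / ?D * ?D * g {v, u}
       + (g {v, w} * g {u} - g {v, u} * g {u, w}) / ?D * ?D * g {v, w})"
    using 3 by (simp add: pvar_def algebra_simps)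
  also have "\<dots> = g {v} * ?D - ((g {v, u} * g {w} - g {v, w} * g {u, w}) * g {v, u}
       + (g {v, w} * g {u} - g {v, u} * g {u, w}) * g {v, w})"
    using D by simp
  also have "\<dots> = det (block {v, u, w} g)"
    using 3 assms(3) by (subst det_block_3) (auto simp: power2_eq_square algebra_simps)
  finally show ?thesis using 3 by simp
qed

lemma det_block_set:
  assumes "length N \<le> 2" "distinct N" "N \<noteq> []"
  shows "pdet N g = det (block (set N) g)"
  using assms(1,2)
proof (cases rule: parent_list_cases)
  case (3 u w)
  then show ?thesis by (simp add: det_block_2)
qed (use assms in \<open>auto simp: det_block_1\<close>)

section \<open>The graph on six vertices\<close>

abbreviation (input) cliques6 :: "nat set set" where
  "cliques6 \<equiv> {{2,3,5}, {2,4,5}, {4,6}, {1,2}}"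

abbreviation (input) "graph6 \<equiv> graph_of 6 cliques6"

text \<open>The DAG starts with 2 and then 5, so that both nested separators \<open>{2}\<close> and \<open>{2, 5}\<close> are families.
  Every family and every nonempty parent set is a clique or a separator.\<close>

definition scheme6 :: scheme where
  "scheme6 = [(1, [2]), (3, [2, 5]), (6, [4]), (4, [2, 5]), (5, [2]), (2, [])]"

definition order6 :: "nat set list" where
  "order6 = [{2,3,5}, {2,4,5}, {4,6}, {1,2}]"

lemma scheme6: "scheme scheme6" "dverts scheme6 = {1..6}"
proof -
  have "{1..6} = {1, 2, 3, 4, 5, 6::nat}" by auto
  then show "dverts scheme6 = {1..6}" unfolding scheme6_def by auto
  show "scheme scheme6" unfolding scheme6_def by (simp add: star_def doubleton_eq_iff)
qed

lemma scheme6_graph: "elimination_scheme graph6 scheme6" "cliques graph6 = cliques6"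
proof -
  have c: "complete_in (dedges scheme6) C" if "C \<in> cliques6" for C
    using that unfolding insert_iff empty_iff
    by (elim disjE FalseE) (simp_all add: complete_in_def scheme6_def star_def doubleton_eq_iff)
  have f: "\<exists>C\<in>cliques6. insert v (set N) \<subseteq> C" if "(v, N) \<in> set scheme6" for v N
    using that unfolding scheme6_def by (simp, elim disjE conjE; simp)
  have a: "C = D" if "C \<in> cliques6" "D \<in> cliques6" "C \<subseteq> D" for C D
    using that(1,2) unfolding insert_iff empty_iff
    by (elim disjE FalseE) (use that(3) in simp_all)
  show "elimination_scheme graph6 scheme6" "cliques graph6 = cliques6"
    by (rule graph_of_scheme[OF scheme6 f c a]; simp)+
qed

interpretation G6: elimination_scheme graph6 scheme6 by (rule scheme6_graph)

lemma sep6: "sep order6 2 = {2,5}" "sep order6 3 = {4}" "sep order6 4 = {2}"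
  by (auto simp: sep_take order6_def numeral_eq_Suc)

lemma order6: "order6 \<in> Ord graph6"
proof -
  have "\<exists>i\<in>{1..<j}. sep order6 j \<subseteq> clq order6 i" if "j \<in> {2..4}" for j
  proof -
    have "j = 2 \<or> j = 3 \<or> j = 4" using that by auto
    then show ?thesis
    proof (elim disjE)
      assume "j = 2" then show ?thesis using sep6 by (intro bexI[of _ 1]) (auto simp: order6_def clq_def)
    next
      assume "j = 3" then show ?thesis using sep6 by (intro bexI[of _ 2]) (auto simp: order6_def clq_def)
    next
      assume "j = 4" then show ?thesis using sep6 by (intro bexI[of _ 1]) (auto simp: order6_def clq_def)
    qed
  qed
  moreover have "distinct order6" "set order6 = cliques graph6" "length order6 = 4"
    unfolding scheme6_graph(2) by (auto simp: order6_def set_eq_subset)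
  ultimately show ?thesis by (simp add: Ord_def)
qed

lemma separators6: "separators graph6 = {{2,5}, {4}, {2}}"
  and sep_mult6: "sep_mult graph6 {2} = 1" "sep_mult graph6 {2,5} = 1"
proof -
  have l: "{2..length order6} = {2, 3, 4}" by (auto simp: order6_def)
  show "separators graph6 = {{2,5}, {4}, {2}}"
    unfolding separators_eq[OF order6] l using sep6 by simp
  have "Jset order6 {2} = {4}" "Jset order6 {2,5} = {2}"
    unfolding Jset_def l using sep6 by auto
  then show "sep_mult graph6 {2} = 1" "sep_mult graph6 {2,5} = 1"
    unfolding sep_mult_eq[OF order6] by simp_all
qed

lemma markov_ratio6:
  "markov_ratio graph6 \<alpha> \<beta> g =
     (det (block {2,3,5} g) powr \<alpha> {2,3,5} * det (block {2,4,5} g) powr \<alpha> {2,4,5} *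
       det (block {4,6} g) powr \<alpha> {4,6} * det (block {1,2} g) powr \<alpha> {1,2}) /
     (det (block {2,5} g) powr \<beta> {2,5} * det (block {4} g) powr \<beta> {4} * det (block {2} g) powr \<beta> {2})"
proof -
  have l: "{1..length order6} = {1, 2, 3, 4}" "{2..length order6} = {2, 3, 4}" by (auto simp: order6_def)
  have c: "clq order6 1 = {2,3,5}" "clq order6 2 = {2,4,5}" "clq order6 3 = {4,6}" "clq order6 4 = {1,2}"
    by (simp_all add: clq_def order6_def)
  show ?thesis
    unfolding markov_ratio_Ord[OF order6] l using c sep6 by (simp add: mult.assoc)
qed

lemma det_blocks6:
  assumes "in_Q scheme6 g"
  shows "det (block {2,3,5} g) = pvar 3 [2,5] g * (pvar 5 [2] g * pvar 2 [] g)"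
    "det (block {2,4,5} g) = pvar 4 [2,5] g * (pvar 5 [2] g * pvar 2 [] g)"
    "det (block {4,6} g) = pvar 6 [4] g * pdet [4] g"
    "det (block {1,2} g) = pvar 1 [2] g * pvar 2 [] g"
    "det (block {2,5} g) = pvar 5 [2] g * pvar 2 [] g"
    "det (block {4} g) = pdet [4] g" "det (block {2} g) = pvar 2 [] g"
    "pdet [2,5] g = pvar 5 [2] g * pvar 2 [] g" "pdet [2] g = pvar 2 [] g"
    "pvar 3 [2,5] g > 0" "pvar 4 [2,5] g > 0" "pvar 6 [4] g > 0" "pvar 1 [2] g > 0" "pvar 5 [2] g > 0"
    "pvar 2 [] g > 0" "pdet [4] g > 0"
proof -
  note pos = in_Q_pvar_pos[OF scheme6(1) assms]
  show p: "pvar 3 [2,5] g > 0" "pvar 4 [2,5] g > 0" "pvar 6 [4] g > 0" "pvar 1 [2] g > 0" "pvar 5 [2] g > 0"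
    "pvar 2 [] g > 0" by (rule pos(1), simp add: scheme6_def)+
  show p4: "pdet [4] g > 0" by (rule pos(2)[of 6], simp add: scheme6_def)
  have p25: "pdet [2,5] g > 0" by (rule pos(2)[of 3], simp add: scheme6_def)
  show b2: "det (block {2} g) = pvar 2 [] g" "pdet [2] g = pvar 2 [] g" by (simp_all add: det_block_1 pvar_def)
  show "det (block {4} g) = pdet [4] g" by (simp add: det_block_1)
  have s: "{2,5} = insert 5 (set [2::nat])" "{1,2} = insert 1 (set [2::nat])" "{4,6} = insert 6 (set [4::nat])"
    "{2,3,5} = insert 3 (set [2,5::nat])" "{2,4,5} = insert 4 (set [2,5::nat])" by auto
  show b25: "det (block {2,5} g) = pvar 5 [2] g * pvar 2 [] g" "det (block {1,2} g) = pvar 1 [2] g * pvar 2 [] g"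
    unfolding s b2(2)[symmetric] using p(6) b2(2) by (intro det_block_family; simp)+
  show "det (block {4,6} g) = pvar 6 [4] g * pdet [4] g"
    unfolding s using det_block_family[of "[4]" 6 g] p4 by simp
  show p2: "pdet [2,5] g = pvar 5 [2] g * pvar 2 [] g"
    unfolding b25(1)[symmetric] using det_block_set[of "[2,5]" g] by simp
  show "det (block {2,3,5} g) = pvar 3 [2,5] g * (pvar 5 [2] g * pvar 2 [] g)"
    "det (block {2,4,5} g) = pvar 4 [2,5] g * (pvar 5 [2] g * pvar 2 [] g)"
    unfolding s p2[symmetric] using p25 by (intro det_block_family; simp)+
qed

text \<open>These are the shapes for which the Markov ratio is the product of \<open>pvar v N g powr a v\<close> and
  \<open>pdet N g powr (- 1 / 2)\<close> with \<open>a v = - 1\<close> for \<open>v \<noteq> 2\<close> and \<open>a 2 = - 2\<close>. With \<open>a 2 = - 1\<close> as well,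
  \<open>\<beta> {2}\<close> would be 0, which is the value that the constraint prescribes for the clique \<open>{2, 3, 5}\<close>.\<close>

definition alpha6 :: "nat set \<Rightarrow> real" where
  "alpha6 = (\<lambda>C\<in>cliques6. - 1)"

definition beta6 :: "nat set \<Rightarrow> real" where
  "beta6 = (\<lambda>S\<in>{{2,5}, {4}, {2}}. if S = {2,5} then 0 else if S = {4} then - 1 / 2 else 1)"

lemma beta6: "beta6 {2,5} = 0" "beta6 {4} = - 1 / 2" "beta6 {2} = 1"
  by (simp_all add: beta6_def)

lemma exp_powr: "exp x powr a = exp (x * a)" for x a :: real
  by (simp add: powr_def mult.commute)

text \<open>The Markov ratio in terms of the residual variances \<open>p1\<close>, ..., \<open>p6\<close> and the variance \<open>q\<close> of vertex 4.\<close>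

lemma powr_identity6:
  fixes p1 p2 p3 p4 p5 p6 q :: real
  assumes "p1 > 0" "p2 > 0" "p3 > 0" "p4 > 0" "p5 > 0" "p6 > 0" "q > 0"
  shows "((p3 * (p5 * p2)) powr - 1 * (p4 * (p5 * p2)) powr - 1 * (p6 * q) powr - 1 * (p1 * p2) powr - 1) /
    ((p5 * p2) powr 0 * q powr (- 1 / 2) * p2 powr 1) =
    (p1 powr - 1 * p2 powr (- 1 / 2)) * ((p3 powr - 1 * (p5 * p2) powr (- 1 / 2)) * ((p6 powr - 1 * q powr (- 1 / 2)) *
     ((p4 powr - 1 * (p5 * p2) powr (- 1 / 2)) * ((p5 powr - 1 * p2 powr (- 1 / 2)) * p2 powr - 2))))"
proof -
  obtain x1 x2 x3 x4 x5 x6 y where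
    e: "p1 = exp x1" "p2 = exp x2" "p3 = exp x3" "p4 = exp x4" "p5 = exp x5" "p6 = exp x6" "q = exp y"
    using assms by (metis exp_ln)
  then show ?thesis
    by (simp only: exp_add[symmetric] exp_diff[symmetric] exp_powr) (rule arg_cong[where f = exp], simp add: field_simps)
qed

lemma powr_identity_mu6:
  fixes p1 p2 p3 p4 p5 p6 q :: real
  assumes "p1 > 0" "p2 > 0" "p3 > 0" "p4 > 0" "p5 > 0" "p6 > 0" "q > 0"
  shows "((p3 * (p5 * p2)) powr 2 * (p4 * (p5 * p2)) powr 2 * (p6 * q) powr (3 / 2) * (p1 * p2) powr (3 / 2)) /
    ((p5 * p2) powr (3 / 2) * q powr 1 * p2 powr 1) =
    (p1 powr (3 / 2) * p2 powr (1 / 2)) * ((p3 powr 2 * (p5 * p2) powr (1 / 2)) * ((p6 powr (3 / 2) * q powr (1 / 2)) *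
     ((p4 powr 2 * (p5 * p2) powr (1 / 2)) * ((p5 powr (3 / 2) * p2 powr (1 / 2)) * p2 powr 1))))"
proof -
  obtain x1 x2 x3 x4 x5 x6 y where
    e: "p1 = exp x1" "p2 = exp x2" "p3 = exp x3" "p4 = exp x4" "p5 = exp x5" "p6 = exp x6" "q = exp y"
    using assms by (metis exp_ln)
  then show ?thesis
    by (simp only: exp_add[symmetric] exp_diff[symmetric] exp_powr) (rule arg_cong[where f = exp], simp add: field_simps)
qed

lemma mem_B6: "(alpha6, beta6) \<in> \<B> graph6"
proof (rule G6.mem_B[where a = "\<lambda>v. if v = 2 then - 2 else - 1"])
  show "(alpha6, beta6) \<in> shapes graph6"
    unfolding shapes_def scheme6_graph(2) separators6 alpha6_def beta6_def by auto
  show "markov_ratio graph6 alpha6 beta6 g = (\<Prod>(v, N)\<leftarrow>scheme6. pvar v N g powr (if v = 2 then - 2 else - 1) * pdet N g powr (- 1 / 2))"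
    if "in_Q scheme6 g" for g
    using powr_identity6[OF det_blocks6(13,15,10,11,14,12,16)[OF that]] det_blocks6(8,9)[OF that]
    unfolding markov_ratio6 det_blocks6(1-7)[OF that] by (simp add: scheme6_def alpha6_def beta6 del: pdet.simps(2,3))
  show "markov_ratio graph6 (\<lambda>C. (real (card C) + 1) / 2) (\<lambda>S. (real (card S) + 1) / 2) g =
      (\<Prod>(v, N)\<leftarrow>scheme6. pvar v N g powr (real (length N) / 2 + 1) * pdet N g powr (1 / 2))"
    if "in_Q scheme6 g" for g
    using powr_identity_mu6[OF det_blocks6(13,15,10,11,14,12,16)[OF that]] det_blocks6(8,9)[OF that]
    unfolding markov_ratio6 det_blocks6(1-7)[OF that] by (simp add: scheme6_def del: pdet.simps(2,3))
qed auto

lemma not_mem_B_ord6: "(alpha6, beta6) \<notin> (\<Union>P\<in>Ord graph6. B_ord graph6 P)"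
proof (rule not_mem_B_ord[of "{2}" _ "{2,5}"])
  show "alpha6 C + (real (card C) - real (card {2::nat})) / 2 \<noteq> beta6 {2}" if "C \<in> cliques graph6" "{2} \<subseteq> C" for C
    using that unfolding scheme6_graph(2) by (auto simp: alpha6_def beta6)
  show "alpha6 C + (real (card C) - real (card {2, 5::nat})) / 2 \<noteq> beta6 {2,5}" if "C \<in> cliques graph6" "{2, 5} \<subseteq> C" for C
    using that(1) unfolding scheme6_graph(2) insert_iff empty_iff
    by (elim disjE FalseE) (use that(2) in \<open>simp_all add: alpha6_def beta6\<close>)
qed (use separators6 sep_mult6 in auto)

lemma not_homogeneous6: "\<not> homogeneous graph6"
  by (rule not_homogeneousI[of 4 2 6 1], unfold G6.dedges[symmetric] G6.dverts[symmetric])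
     (simp_all add: scheme6_def star_def doubleton_eq_iff)

section \<open>The graph on eight vertices\<close>

abbreviation (input) cliques8 :: "nat set set" where
  "cliques8 \<equiv> {{4,7,8}, {3,7,8}, {6,8}, {2,5,6}, {1,5,6}}"

abbreviation (input) "graph8 \<equiv> graph_of 8 cliques8"

text \<open>The DAG starts with 8, 7 and reaches 6, 5 afterwards. Both nested separators \<open>{8}\<close> and \<open>{7, 8}\<close> are
  families, and every family and every nonempty parent set is a clique or a separator.\<close>

definition scheme8 :: scheme where
  "scheme8 = [(1, [5, 6]), (2, [5, 6]), (3, [7, 8]), (4, [7, 8]), (5, [6]), (6, [8]), (7, [8]), (8, [])]"

definition order8 :: "nat set list" where
  "order8 = [{4,7,8}, {3,7,8}, {6,8}, {2,5,6}, {1,5,6}]"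

lemma scheme8: "scheme scheme8" "dverts scheme8 = {1..8}"
proof -
  have "{1..8} = {1, 2, 3, 4, 5, 6, 7, 8::nat}" by auto
  then show "dverts scheme8 = {1..8}" unfolding scheme8_def by auto
  show "scheme scheme8" unfolding scheme8_def by (simp add: star_def doubleton_eq_iff)
qed

lemma scheme8_graph: "elimination_scheme graph8 scheme8" "cliques graph8 = cliques8"
proof -
  have c: "complete_in (dedges scheme8) C" if "C \<in> cliques8" for C
    using that unfolding insert_iff empty_iff
    by (elim disjE FalseE) (simp_all add: complete_in_def scheme8_def star_def doubleton_eq_iff)
  have f: "\<exists>C\<in>cliques8. insert v (set N) \<subseteq> C" if "(v, N) \<in> set scheme8" for v N
    using that unfolding scheme8_def by (simp, elim disjE conjE; simp)
  have a: "C = D" if "C \<in> cliques8" "D \<in> cliques8" "C \<subseteq> D" for C D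
    using that(1,2) unfolding insert_iff empty_iff
    by (elim disjE FalseE) (use that(3) in simp_all)
  show "elimination_scheme graph8 scheme8" "cliques graph8 = cliques8"
    by (rule graph_of_scheme[OF scheme8 f c a]; simp)+
qed

interpretation G8: elimination_scheme graph8 scheme8 by (rule scheme8_graph)

lemma sep8: "sep order8 2 = {7,8}" "sep order8 3 = {8}" "sep order8 4 = {6}" "sep order8 5 = {5,6}"
  by (auto simp: sep_take order8_def numeral_eq_Suc)

lemma order8: "order8 \<in> Ord graph8"
proof -
  have "\<exists>i\<in>{1..<j}. sep order8 j \<subseteq> clq order8 i" if "j \<in> {2..5}" for j
  proof -
    have "j = 2 \<or> j = 3 \<or> j = 4 \<or> j = 5" using that by auto
    then show ?thesis
    proof (elim disjE)
      assume "j = 2" then show ?thesis using sep8 by (intro bexI[of _ 1]) (auto simp: order8_def clq_def)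
    next
      assume "j = 3" then show ?thesis using sep8 by (intro bexI[of _ 1]) (auto simp: order8_def clq_def)
    next
      assume "j = 4" then show ?thesis using sep8 by (intro bexI[of _ 3]) (auto simp: order8_def clq_def)
    next
      assume "j = 5" then show ?thesis using sep8 by (intro bexI[of _ 4]) (auto simp: order8_def clq_def)
    qed
  qed
  moreover have "distinct order8" "set order8 = cliques graph8" "length order8 = 5"
    unfolding scheme8_graph(2) by (auto simp: order8_def set_eq_subset)
  ultimately show ?thesis by (simp add: Ord_def)
qed

lemma separators8: "separators graph8 = {{7,8}, {8}, {6}, {5,6}}"
  and sep_mult8: "sep_mult graph8 {8} = 1" "sep_mult graph8 {7,8} = 1"
proof -
  have l: "{2..length order8} = {2, 3, 4, 5}" by (auto simp: order8_def)
  show "separators graph8 = {{7,8}, {8}, {6}, {5,6}}"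
    unfolding separators_eq[OF order8] l using sep8 by simp
  have "Jset order8 {8} = {3}" "Jset order8 {7,8} = {2}"
    unfolding Jset_def l using sep8 by (auto simp: doubleton_eq_iff)
  then show "sep_mult graph8 {8} = 1" "sep_mult graph8 {7,8} = 1"
    unfolding sep_mult_eq[OF order8] by simp_all
qed

lemma markov_ratio8:
  "markov_ratio graph8 \<alpha> \<beta> g =
     (det (block {4,7,8} g) powr \<alpha> {4,7,8} * det (block {3,7,8} g) powr \<alpha> {3,7,8} *
       det (block {6,8} g) powr \<alpha> {6,8} * det (block {2,5,6} g) powr \<alpha> {2,5,6} *
       det (block {1,5,6} g) powr \<alpha> {1,5,6}) /
     (det (block {7,8} g) powr \<beta> {7,8} * det (block {8} g) powr \<beta> {8} * det (block {6} g) powr \<beta> {6} *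
       det (block {5,6} g) powr \<beta> {5,6})"
proof -
  have l: "{1..length order8} = {1, 2, 3, 4, 5}" "{2..length order8} = {2, 3, 4, 5}" by (auto simp: order8_def)
  have c: "clq order8 1 = {4,7,8}" "clq order8 2 = {3,7,8}" "clq order8 3 = {6,8}" "clq order8 4 = {2,5,6}"
    "clq order8 5 = {1,5,6}"
    by (simp_all add: clq_def order8_def)
  show ?thesis
    unfolding markov_ratio_Ord[OF order8] l using c sep8 by (simp add: mult.assoc)
qed

lemma det_blocks8:
  assumes "in_Q scheme8 g"
  shows "det (block {4,7,8} g) = pvar 4 [7,8] g * (pvar 7 [8] g * pvar 8 [] g)"
    "det (block {3,7,8} g) = pvar 3 [7,8] g * (pvar 7 [8] g * pvar 8 [] g)"
    "det (block {6,8} g) = pvar 6 [8] g * pvar 8 [] g"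
    "det (block {2,5,6} g) = pvar 2 [5,6] g * (pvar 5 [6] g * pdet [6] g)"
    "det (block {1,5,6} g) = pvar 1 [5,6] g * (pvar 5 [6] g * pdet [6] g)"
    "det (block {7,8} g) = pvar 7 [8] g * pvar 8 [] g"
    "det (block {8} g) = pvar 8 [] g" "det (block {6} g) = pdet [6] g"
    "det (block {5,6} g) = pvar 5 [6] g * pdet [6] g"
    "pdet [7,8] g = pvar 7 [8] g * pvar 8 [] g" "pdet [5,6] g = pvar 5 [6] g * pdet [6] g" "pdet [8] g = pvar 8 [] g"
    "pvar 1 [5,6] g > 0" "pvar 2 [5,6] g > 0" "pvar 3 [7,8] g > 0" "pvar 4 [7,8] g > 0" "pvar 5 [6] g > 0"
    "pvar 6 [8] g > 0" "pvar 7 [8] g > 0" "pvar 8 [] g > 0" "pdet [6] g > 0"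
proof -
  note pos = in_Q_pvar_pos[OF scheme8(1) assms]
  show p: "pvar 1 [5,6] g > 0" "pvar 2 [5,6] g > 0" "pvar 3 [7,8] g > 0" "pvar 4 [7,8] g > 0" "pvar 5 [6] g > 0"
    "pvar 6 [8] g > 0" "pvar 7 [8] g > 0" "pvar 8 [] g > 0" by (rule pos(1), simp add: scheme8_def)+
  show p6: "pdet [6] g > 0" by (rule pos(2)[of 5], simp add: scheme8_def)
  have p78: "pdet [7,8] g > 0" by (rule pos(2)[of 3], simp add: scheme8_def)
  have p56: "pdet [5,6] g > 0" by (rule pos(2)[of 1], simp add: scheme8_def)
  show b8: "det (block {8} g) = pvar 8 [] g" "pdet [8] g = pvar 8 [] g" by (simp_all add: det_block_1 pvar_def)
  show "det (block {6} g) = pdet [6] g" by (simp add: det_block_1)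
  have s: "{7,8} = insert 7 (set [8::nat])" "{6,8} = insert 6 (set [8::nat])" "{5,6} = insert 5 (set [6::nat])"
    "{4,7,8} = insert 4 (set [7,8::nat])" "{3,7,8} = insert 3 (set [7,8::nat])"
    "{2,5,6} = insert 2 (set [5,6::nat])" "{1,5,6} = insert 1 (set [5,6::nat])" by auto
  show b78: "det (block {7,8} g) = pvar 7 [8] g * pvar 8 [] g" "det (block {6,8} g) = pvar 6 [8] g * pvar 8 [] g"
    unfolding s b8(2)[symmetric] using p(8) b8(2) by (intro det_block_family; simp)+
  show b56: "det (block {5,6} g) = pvar 5 [6] g * pdet [6] g"
    unfolding s using det_block_family[of "[6]" 5 g] p6 by simp
  show p2: "pdet [7,8] g = pvar 7 [8] g * pvar 8 [] g"
    unfolding b78(1)[symmetric] using det_block_set[of "[7,8]" g] by simp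
  show p3: "pdet [5,6] g = pvar 5 [6] g * pdet [6] g"
    unfolding b56[symmetric] using det_block_set[of "[5,6]" g] by simp
  show "det (block {4,7,8} g) = pvar 4 [7,8] g * (pvar 7 [8] g * pvar 8 [] g)"
    "det (block {3,7,8} g) = pvar 3 [7,8] g * (pvar 7 [8] g * pvar 8 [] g)"
    unfolding s(4,5) p2[symmetric] using p78 by (intro det_block_family; simp)+
  show "det (block {2,5,6} g) = pvar 2 [5,6] g * (pvar 5 [6] g * pdet [6] g)"
    "det (block {1,5,6} g) = pvar 1 [5,6] g * (pvar 5 [6] g * pdet [6] g)"
    unfolding s(6,7) p3[symmetric] using p56 by (intro det_block_family; simp)+
qed

text \<open>These are the shapes for which the Markov ratio is the product of \<open>pvar v N g powr a v\<close> with
  \<open>a v = 2\<close> for \<open>v \<noteq> 7\<close> and \<open>a 7 = 1\<close>. Lowering \<open>a 7\<close> raises \<open>\<beta> {7, 8}\<close> and lowers \<open>\<beta> {8}\<close>, so that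
  both differ from the value 2 of \<open>\<alpha>\<close>.\<close>

definition alpha8 :: "nat set \<Rightarrow> real" where
  "alpha8 = (\<lambda>C\<in>cliques8. 2)"

definition beta8 :: "nat set \<Rightarrow> real" where
  "beta8 = (\<lambda>S\<in>{{7,8}, {8}, {6}, {5,6}}. if S = {7,8} then 3 else if S = {8} then 1 else 2)"

lemma beta8: "beta8 {7,8} = 3" "beta8 {8} = 1" "beta8 {6} = 2" "beta8 {5,6} = 2"
  by (simp_all add: beta8_def doubleton_eq_iff)

text \<open>The Markov ratio in terms of the residual variances \<open>p1\<close>, ..., \<open>p8\<close> and the variance \<open>q\<close> of vertex 6.\<close>

lemma powr_identity8:
  fixes p1 p2 p3 p4 p5 p6 p7 p8 q :: real
  assumes "p1 > 0" "p2 > 0" "p3 > 0" "p4 > 0" "p5 > 0" "p6 > 0" "p7 > 0" "p8 > 0" "q > 0"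
  shows "((p4 * (p7 * p8)) powr 2 * (p3 * (p7 * p8)) powr 2 * (p6 * p8) powr 2 * (p2 * (p5 * q)) powr 2 *
      (p1 * (p5 * q)) powr 2) / ((p7 * p8) powr 3 * p8 powr 1 * q powr 2 * (p5 * q) powr 2) =
    p1 powr 2 * (p2 powr 2 * (p3 powr 2 * (p4 powr 2 * (p5 powr 2 * (p6 powr 2 * (p7 powr 1 * p8 powr 2))))))"
proof -
  obtain x1 x2 x3 x4 x5 x6 x7 x8 y where
    e: "p1 = exp x1" "p2 = exp x2" "p3 = exp x3" "p4 = exp x4" "p5 = exp x5" "p6 = exp x6" "p7 = exp x7"
      "p8 = exp x8" "q = exp y"
    using assms by (metis exp_ln)
  then show ?thesis
    by (simp only: exp_add[symmetric] exp_diff[symmetric] exp_powr) (rule arg_cong[where f = exp], simp add: field_simps)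
qed

lemma powr_identity_mu8:
  fixes p1 p2 p3 p4 p5 p6 p7 p8 q :: real
  assumes "p1 > 0" "p2 > 0" "p3 > 0" "p4 > 0" "p5 > 0" "p6 > 0" "p7 > 0" "p8 > 0" "q > 0"
  shows "((p4 * (p7 * p8)) powr - 2 * (p3 * (p7 * p8)) powr - 2 * (p6 * p8) powr (- 3 / 2) * (p2 * (p5 * q)) powr - 2 *
      (p1 * (p5 * q)) powr - 2) / ((p7 * p8) powr (- 3 / 2) * p8 powr - 1 * q powr - 1 * (p5 * q) powr (- 3 / 2)) =
    (p1 powr - 2 * (p5 * q) powr (- 1 / 2)) * ((p2 powr - 2 * (p5 * q) powr (- 1 / 2)) *
     ((p3 powr - 2 * (p7 * p8) powr (- 1 / 2)) * ((p4 powr - 2 * (p7 * p8) powr (- 1 / 2)) *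
      ((p5 powr (- 3 / 2) * q powr (- 1 / 2)) * ((p6 powr (- 3 / 2) * p8 powr (- 1 / 2)) *
       ((p7 powr (- 3 / 2) * p8 powr (- 1 / 2)) * p8 powr - 1))))))"
proof -
  obtain x1 x2 x3 x4 x5 x6 x7 x8 y where
    e: "p1 = exp x1" "p2 = exp x2" "p3 = exp x3" "p4 = exp x4" "p5 = exp x5" "p6 = exp x6" "p7 = exp x7"
      "p8 = exp x8" "q = exp y"
    using assms by (metis exp_ln)
  then show ?thesis
    by (simp only: exp_add[symmetric] exp_diff[symmetric] exp_powr) (rule arg_cong[where f = exp], simp add: field_simps)
qed

lemma mem_A8: "(alpha8, beta8) \<in> \<A> graph8"
proof (rule G8.mem_A[where a = "\<lambda>v. if v = 7 then 1 else 2"])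
  show "(alpha8, beta8) \<in> shapes graph8"
    unfolding shapes_def scheme8_graph(2) separators8 alpha8_def beta8_def by auto
  show "markov_ratio graph8 alpha8 beta8 g = (\<Prod>(v, N)\<leftarrow>scheme8. pvar v N g powr (if v = 7 then 1 else 2))"
    if "in_Q scheme8 g" for g
    using powr_identity8[OF det_blocks8(13-21)[OF that]]
    unfolding markov_ratio8 det_blocks8(1-9)[OF that] by (simp add: scheme8_def alpha8_def beta8 del: pdet.simps(2,3))
  show "markov_ratio graph8 (\<lambda>C. - (real (card C) + 1) / 2) (\<lambda>S. - (real (card S) + 1) / 2) g =
      (\<Prod>(v, N)\<leftarrow>scheme8. pvar v N g powr (- real (length N) / 2 - 1) * pdet N g powr (- 1 / 2))"
    if "in_Q scheme8 g" for g
    using powr_identity_mu8[OF det_blocks8(13-21)[OF that]] det_blocks8(10-12)[OF that]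
    unfolding markov_ratio8 det_blocks8(1-9)[OF that] by (simp add: scheme8_def del: pdet.simps(2,3))
  show "(if v = 7 then 1 else 2) > real (length N) / 2" if "(v, N) \<in> set scheme8" for v N
    using that unfolding scheme8_def by (simp, elim disjE conjE; simp)
qed

lemma not_mem_A_ord8: "(alpha8, beta8) \<notin> (\<Union>P\<in>Ord graph8. A_ord graph8 P)"
proof (rule not_mem_A_ord[of "{8}" _ "{7,8}"])
  show "alpha8 C \<noteq> beta8 {8}" if "C \<in> cliques graph8" for C
    using that unfolding scheme8_graph(2) by (simp add: alpha8_def beta8)
  show "alpha8 C \<noteq> beta8 {7,8}" if "C \<in> cliques graph8" for C
    using that unfolding scheme8_graph(2) by (simp add: alpha8_def beta8)
qed (use separators8 sep_mult8 in auto)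

lemma not_homogeneous8: "\<not> homogeneous graph8"
  by (rule not_homogeneousI[of 8 6 7 5], unfold G8.dedges[symmetric] G8.dverts[symmetric])
     (simp_all add: scheme8_def star_def doubleton_eq_iff)

theorem mainTheorem1:
  shows "\<not> (\<forall>G. is_graph G \<and> decomposable G \<and> \<not> homogeneous G \<longrightarrow> (\<Union>P\<in>Ord G. A_ord G P) = \<A> G) \<and>
    \<not> (\<forall>G. is_graph G \<and> decomposable G \<and> \<not> homogeneous G \<longrightarrow> (\<Union>P\<in>Ord G. B_ord G P) = \<B> G) \<and>
    (let \<C> = {{2,3,5}, {2,4,5}, {4,6}, {1,2}}; G = graph_of 6 \<C>
     in is_graph G \<and> cliques G = \<C> \<and> decomposable G \<and> \<not> homogeneous G \<and>
        (\<Union>P\<in>Ord G. B_ord G P) \<noteq> \<B> G) \<and>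
    (let \<C> = {{4,7,8}, {3,7,8}, {6,8}, {2,5,6}, {1,5,6}}; G = graph_of 8 \<C>
     in is_graph G \<and> cliques G = \<C> \<and> decomposable G \<and> \<not> homogeneous G \<and>
        (\<Union>P\<in>Ord G. A_ord G P) \<noteq> \<A> G)"
proof -
  have B: "(\<Union>P\<in>Ord graph6. B_ord graph6 P) \<noteq> \<B> graph6"
    using mem_B6 not_mem_B_ord6 by metis
  have A: "(\<Union>P\<in>Ord graph8. A_ord graph8 P) \<noteq> \<A> graph8"
    using mem_A8 not_mem_A_ord8 by metis
  have "\<not> (\<forall>G. is_graph G \<and> decomposable G \<and> \<not> homogeneous G \<longrightarrow> (\<Union>P\<in>Ord G. A_ord G P) = \<A> G)"
    using A G8.is_graph G8.decomposable not_homogeneous8 by blast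
  moreover have "\<not> (\<forall>G. is_graph G \<and> decomposable G \<and> \<not> homogeneous G \<longrightarrow> (\<Union>P\<in>Ord G. B_ord G P) = \<B> G)"
    using B G6.is_graph G6.decomposable not_homogeneous6 by blast
  ultimately show ?thesis
    unfolding Let_def
    using A B G6.is_graph G6.decomposable not_homogeneous6 scheme6_graph(2)
      G8.is_graph G8.decomposable not_homogeneous8 scheme8_graph(2) by blast
qed

end
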